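(* In each item, "smallest" means having the least possible number of vertices among circulant graphs with the stated properties. (i) The disconnected graph $C_8(2)$ is the smallest well-covered circulant graph that is not Buchsbaum. The graph $C_{10}(1,4)$ is the smallest connected well-covered circulant graph that is not Buchsbaum. (ii) The graph $C_4(1)$ is the smallest well-covered circulant graph that is Buchsbaum but not Cohen-Macaulay. (iii) The graph $C_{16}(1,4,8)$ is the smallest well-covered circulant graph that is shellable but not vertex decomposable.
   Context: For an integer $n\ge 1$ and a set $S\subseteq\{1,\ldots,\lfloor n/2\rfloor\}$, the circulant graph $C_n(S)$ has vertex set $\{0,1,\ldots,n-1\}$, and distinct $a,b$ are adjacent if and only if $|a-b|\in S$ or $n-|a-b|\in S$; write $C_n(a_1,\ldots,a_t)$ for $C_n(\{a_1,\ldots,a_t\})$. A finite simple graph is well-covered if all its minimal vertex covers (equivalently, all its inclusion-maximal independent sets) have the same cardinality. The independence complex $\mathrm{Ind}(G)$ is the simplicial complex of all independent sets of $G$; it is pure (all facets of the same dimension) if and only if $G$ is well-covered. For a simplicial complex $\Delta$ and a face $F$: $\mathrm{link}_\Delta(F)=\{H\in\Delta : F\cap H=\emptyset,\ F\cup H\in\Delta\}$ and $\mathrm{del}_\Delta(F)=\{H\in\Delta : F\not\subseteq H\}$; for a vertex $x$ write $x$ instead of $\{x\}$. Also $\dim F=|F|-1$. Fix a field $k$. A pure simplicial complex $\Delta$ is: - vertex decomposable if $\Delta$ is a simplex (its whole vertex set is its unique facet), or there is a vertex $x$ such that $\mathrm{link}_\Delta(x)$ and $\mathrm{del}_\Delta(x)$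 are (pure and) vertex decomposable; - shellable if its facets can be ordered $F_1,\ldots,F_t$ so that for all $1\le j<i\le t$ there are $x\in F_i\setminus F_j$ and $l\in\{1,\ldots,i-1\}$ with $F_i\setminus F_l=\{x\}$; - Cohen-Macaulay if for all $F\in\Delta$, $\tilde H_i(\mathrm{link}_\Delta(F),k)=0$ for all $i<\dim \mathrm{link}_\Delta(F)$ (reduced simplicial homology); - Buchsbaum if $\mathrm{link}_\Delta(x)$ is Cohen-Macaulay for every vertex $x$. A graph $G$ is said to have one of these properties if $\mathrm{Ind}(G)$ is pure and has it. *)

theory Defs
  imports "HOL-Algebra.Elementary_Groups"
begin

section \<open>Finite simple graphs and circulant graphs\<close>

text \<open>A graph is a pair of a vertex set and a set of edges, each edge being a two-element set.\<close>

type_synonym 'a graph = "'a set \<times> 'a set set"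

abbreviation vertices :: "'a graph \<Rightarrow> 'a set" where "vertices G \<equiv> fst G"
abbreviation edges :: "'a graph \<Rightarrow> 'a set set" where "edges G \<equiv> snd G"

definition simple_graph :: "'a graph \<Rightarrow> bool" where
  "simple_graph G \<longleftrightarrow> finite (vertices G) \<and> (\<forall>e\<in>edges G. e \<subseteq> vertices G \<and> card e = 2)"

definition connected_graph :: "'a graph \<Rightarrow> bool" where
  "connected_graph G \<longleftrightarrow>
     (\<forall>u\<in>vertices G. \<forall>v\<in>vertices G. (u, v) \<in> {(a, b). {a, b} \<in> edges G}\<^sup>*)"

definition vertex_cover :: "'a graph \<Rightarrow> 'a set \<Rightarrow> bool" where
  "vertex_cover G C \<longleftrightarrow> C \<subseteq> vertices G \<and> (\<forall>e\<in>edges G. e \<inter> C \<noteq> {})"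

definition minimal_vertex_cover :: "'a graph \<Rightarrow> 'a set \<Rightarrow> bool" where
  "minimal_vertex_cover G C \<longleftrightarrow> vertex_cover G C \<and> (\<forall>C'. C' \<subset> C \<longrightarrow> \<not> vertex_cover G C')"

definition well_covered :: "'a graph \<Rightarrow> bool" where
  "well_covered G \<longleftrightarrow>
     (\<forall>C D. minimal_vertex_cover G C \<and> minimal_vertex_cover G D \<longrightarrow> card C = card D)"

text \<open>The outer subtraction below is on natural numbers, but it never truncates, since
  \<open>\<bar>a - b\<bar> < n\<close> for vertices \<open>a\<close> and \<open>b\<close>.\<close>

definition circulant :: "nat \<Rightarrow> nat set \<Rightarrow> nat graph" where
  "circulant n S =
     ({0..<n},
      {{a, b} | a b. a < n \<and> b < n \<and> a \<noteq> b \<and>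
         (nat \<bar>int a - int b\<bar> \<in> S \<or> n - nat \<bar>int a - int b\<bar> \<in> S)})"

definition circulant_graph :: "nat graph \<Rightarrow> bool" where
  "circulant_graph G \<longleftrightarrow> (\<exists>n S. n \<ge> 1 \<and> S \<subseteq> {1..n div 2} \<and> G = circulant n S)"

lemma simple_graph_circulant: "simple_graph (circulant n S)"
  by (auto simp: simple_graph_def circulant_def)

text \<open>Minimality is of the number of vertices only; no uniqueness up to isomorphism is claimed.\<close>

definition smallest_circulant :: "(nat graph \<Rightarrow> bool) \<Rightarrow> nat graph \<Rightarrow> bool" where
  "smallest_circulant P G \<longleftrightarrow> circulant_graph G \<and> P G \<and>
     (\<forall>H. circulant_graph H \<and> P H \<longrightarrow> card (vertices G) \<le> card (vertices H))"

section \<open>Simplicial complexes\<close>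

text \<open>A complex is the set of its faces, so its vertex set is the union of its faces.\<close>

definition simplicial_complex :: "'a set set \<Rightarrow> bool" where
  "simplicial_complex \<Delta> \<longleftrightarrow>
     finite \<Delta> \<and> \<Delta> \<noteq> {} \<and> (\<forall>F\<in>\<Delta>. finite F \<and> (\<forall>H. H \<subseteq> F \<longrightarrow> H \<in> \<Delta>))"

definition facets :: "'a set set \<Rightarrow> 'a set set" where
  "facets \<Delta> = {F \<in> \<Delta>. \<forall>H\<in>\<Delta>. F \<subseteq> H \<longrightarrow> H = F}"

definition face_dim :: "'a set \<Rightarrow> int" where
  "face_dim F = int (card F) - 1"

definition complex_dim :: "'a set set \<Rightarrow> int" where
  "complex_dim \<Delta> = Max (face_dim ` \<Delta>)"

definition pure_complex :: "'a set set \<Rightarrow> bool" where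
  "pure_complex \<Delta> \<longleftrightarrow> simplicial_complex \<Delta> \<and>
     (\<forall>F\<in>facets \<Delta>. \<forall>H\<in>facets \<Delta>. face_dim F = face_dim H)"

definition link :: "'a set set \<Rightarrow> 'a set \<Rightarrow> 'a set set" where
  "link \<Delta> F = {H \<in> \<Delta>. F \<inter> H = {} \<and> F \<union> H \<in> \<Delta>}"

definition deletion :: "'a set set \<Rightarrow> 'a set \<Rightarrow> 'a set set" where
  "deletion \<Delta> F = {H \<in> \<Delta>. \<not> F \<subseteq> H}"

definition indep_complex :: "'a graph \<Rightarrow> 'a set set" where
  "indep_complex G = {F. F \<subseteq> vertices G \<and> (\<forall>e\<in>edges G. \<not> e \<subseteq> F)}"

lemma simplicial_complex_indep_complex:
  assumes "simple_graph G"
  shows "simplicial_complex (indep_complex G)"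
proof -
  have fin: "finite (vertices G)" and e: "\<forall>e\<in>edges G. card e = 2"
    using assms by (auto simp: simple_graph_def)
  have "finite (indep_complex G)"
    by (rule finite_subset[of _ "Pow (vertices G)"]) (auto simp: indep_complex_def fin)
  moreover have "{} \<in> indep_complex G"
    using e by (auto simp: indep_complex_def)
  moreover have "finite F \<and> (\<forall>H. H \<subseteq> F \<longrightarrow> H \<in> indep_complex G)" if "F \<in> indep_complex G" for F
    using that fin finite_subset by (fastforce simp: indep_complex_def)
  ultimately show ?thesis
    by (auto simp: simplicial_complex_def)
qed

inductive vertex_decomposable :: "'a set set \<Rightarrow> bool" where
  simplex: "pure_complex \<Delta> \<Longrightarrow> facets \<Delta> = {\<Union>\<Delta>} \<Longrightarrow> vertex_decomposable \<Delta>"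
| shed: "pure_complex \<Delta> \<Longrightarrow> x \<in> \<Union>\<Delta> \<Longrightarrow>
    vertex_decomposable (link \<Delta> {x}) \<Longrightarrow> vertex_decomposable (deletion \<Delta> {x}) \<Longrightarrow>
    vertex_decomposable \<Delta>"

definition shellable :: "'a set set \<Rightarrow> bool" where
  "shellable \<Delta> \<longleftrightarrow> pure_complex \<Delta> \<and>
     (\<exists>Fs. distinct Fs \<and> set Fs = facets \<Delta> \<and>
        (\<forall>i<length Fs. \<forall>j<i. \<exists>x\<in>Fs ! i - Fs ! j. \<exists>l<i. Fs ! i - Fs ! l = {x}))"

section \<open>Reduced simplicial homology with coefficients in a field\<close>

text \<open>A chain is a coefficient function on faces, and each face is oriented by the linear order
  of the vertices.  Degrees are integers, so that the empty face lives in degree \<open>-1\<close>.\<close>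

definition faces_of_dim :: "'a set set \<Rightarrow> int \<Rightarrow> 'a set set" where
  "faces_of_dim \<Delta> i = {F \<in> \<Delta>. face_dim F = i}"

definition chains :: "'a set set \<Rightarrow> int \<Rightarrow> ('a set \<Rightarrow> 'k::field) set" where
  "chains \<Delta> i = {c. \<forall>F. F \<notin> faces_of_dim \<Delta> i \<longrightarrow> c F = 0}"

text \<open>The linear map sending a face \<open>{v\<^sub>0 < \<dots> < v\<^sub>i}\<close> to the sum of
  \<open>(-1)^j\<close> times the face without \<open>v\<^sub>j\<close>; here \<open>j\<close> is the number of vertices below \<open>v\<^sub>j\<close>.\<close>

definition boundary ::
    "'a::linorder set set \<Rightarrow> int \<Rightarrow> ('a set \<Rightarrow> 'k::field) \<Rightarrow> ('a set \<Rightarrow> 'k)" where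
  "boundary \<Delta> i c =
     (\<lambda>H. \<Sum>F\<in>faces_of_dim \<Delta> i. \<Sum>x\<in>F.
        if F - {x} = H then (- 1) ^ card {y \<in> F. y < x} * c F else 0)"

definition cycles :: "'a::linorder set set \<Rightarrow> int \<Rightarrow> ('a set \<Rightarrow> 'k::field) set" where
  "cycles \<Delta> i = {c \<in> chains \<Delta> i. boundary \<Delta> i c = (\<lambda>_. 0)}"

definition boundaries :: "'a::linorder set set \<Rightarrow> int \<Rightarrow> ('a set \<Rightarrow> 'k::field) set" where
  "boundaries \<Delta> i = boundary \<Delta> (i + 1) ` chains \<Delta> (i + 1)"

definition cycle_group :: "'a::linorder set set \<Rightarrow> int \<Rightarrow> ('a set \<Rightarrow> 'k::field) monoid" where
  "cycle_group \<Delta> i = \<lparr>carrier = cycles \<Delta> i, mult = (\<lambda>c d F. c F + d F), one = (\<lambda>_. 0)\<rparr>"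

text \<open>Only the additive group underlying the homology space is recorded, which is enough to
  say that the space is zero.\<close>

definition reduced_homology ::
    "'k::field itself \<Rightarrow> 'a::linorder set set \<Rightarrow> int \<Rightarrow> ('a set \<Rightarrow> 'k) set monoid" where
  "reduced_homology k \<Delta> i = cycle_group \<Delta> i Mod boundaries \<Delta> i"

definition cohen_macaulay :: "'k::field itself \<Rightarrow> 'a::linorder set set \<Rightarrow> bool" where
  "cohen_macaulay k \<Delta> \<longleftrightarrow> pure_complex \<Delta> \<and>
     (\<forall>F\<in>\<Delta>. \<forall>i<complex_dim (link \<Delta> F). trivial_group (reduced_homology k (link \<Delta> F) i))"

definition buchsbaum :: "'k::field itself \<Rightarrow> 'a::linorder set set \<Rightarrow> bool" where
  "buchsbaum k \<Delta> \<longleftrightarrow> pure_complex \<Delta> \<and> (\<forall>x\<in>\<Union>\<Delta>. cohen_macaulay k (link \<Delta> {x}))"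

end

theory Submission
  imports Defs
begin

text \<open>
  In each item the properties of the named graph rest on a few explicit witnesses, while its
  minimality is a statement about all circulant graphs on fewer vertices.

  Over any field a vertex decomposable complex is Cohen-Macaulay
  (\<open>vertex_decomposable_imp_cohen_macaulay\<close>): a cycle is a cone over its part in the link of a
  shedding vertex plus a chain in the deletion, and a filling of the former moves the cycle into
  the latter.  Conversely, a Cohen-Macaulay complex of positive dimension is connected, and so are
  its links (\<open>cohen_macaulay_constant_label\<close>).  For the first two items nothing more is required.
  The graphs \<open>C\<^sub>8(2)\<close> and \<open>C\<^sub>1\<^sub>0(1,4)\<close> have a face through the vertex \<open>0\<close> whose link consists of two
  disjoint edges, and the independence complex of \<open>C\<^sub>4(1)\<close> itself does; all other well-covered
  circulant graphs on fewer than ten vertices have vertex decomposable vertex links.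

  For the third item, a circulant graph on fewer than sixteen vertices is handled in one of three
  ways.  A greedy choice of shedding vertices shows that it is vertex decomposable, or two maximal
  independent sets of different sizes show that it is not well-covered, or it is not shellable.
  Non-shellability is seen in low-dimensional cohomology.  Links of shellable complexes are
  shellable, and a shellable complex has no cohomology below its dimension.  In degree zero this
  is connectedness (\<open>shellable_constant_label\<close>).  In degree one it says that an edge labelling
  which is additive on triangles is a difference of vertex labels (\<open>shellable_potential\<close>); both
  follow by adding facets one at a time.  In all cases that arise in degree one, some additive
  labelling depends only on the difference of the end points, so that it is given by a table of
  integers indexed by residues.  Such a labelling is a difference of vertex labels only if it
  vanishes, as its sum along a closed walk with constant step shows
  (\<open>winding_not_shellable\<close>).  Multiplication by units modulo \<open>n\<close> cuts down the number of cases.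

  Finally \<open>C\<^sub>1\<^sub>6(1,4,8)\<close> is shellable by an explicit order of its eighty facets.  It is not vertex
  decomposable because of Euler characteristics.  For a vertex decomposable complex, the
  reduced Euler characteristic is nonnegative once it is given the sign that makes spheres positive
  (\<open>vertex_decomposable_euler\<close>).  That number is 1 for the complex and 2 for each vertex link, and
  it is additive over link and deletion; hence it would be -1 for the deletion of any
  vertex.
\<close>

section \<open>Links and deletions in pure complexes\<close>

lemma simplicial_complexD:
  assumes "simplicial_complex \<Delta>"
  shows "finite \<Delta>" "{} \<in> \<Delta>" "F \<in> \<Delta> \<Longrightarrow> finite F" "F \<in> \<Delta> \<Longrightarrow> H \<subseteq> F \<Longrightarrow> H \<in> \<Delta>"
  using assms unfolding simplicial_complex_def by blast+

lemma finite_vertices_complex: "simplicial_complex \<Delta> \<Longrightarrow> finite (\<Union>\<Delta>)"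
  by (auto simp: simplicial_complex_def)

lemma pure_complexD: "pure_complex \<Delta> \<Longrightarrow> simplicial_complex \<Delta>"
  by (simp add: pure_complex_def)

lemma face_subset_facet:
  assumes "simplicial_complex \<Delta>" "F \<in> \<Delta>"
  obtains G where "G \<in> facets \<Delta>" "F \<subseteq> G"
proof -
  obtain G where "G \<in> \<Delta>" "F \<subseteq> G" "\<forall>H\<in>\<Delta>. G \<subseteq> H \<longrightarrow> G = H"
    using finite_has_maximal2[OF simplicial_complexD(1)[OF assms(1)] assms(2)] by auto
  then show thesis by (intro that[of G]) (auto simp: facets_def)
qed

lemma facets_subset: "facets \<Delta> \<subseteq> \<Delta>"
  by (auto simp: facets_def)

lemma facets_maximal: "F \<in> facets \<Delta> \<Longrightarrow> H \<in> \<Delta> \<Longrightarrow> F \<subseteq> H \<Longrightarrow> H = F"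
  unfolding facets_def by blast

lemma facets_nonempty: "simplicial_complex \<Delta> \<Longrightarrow> facets \<Delta> \<noteq> {}"
  by (metis empty_iff face_subset_facet simplicial_complexD(2))

text \<open>Purity is most convenient with the common size of the facets as a parameter.\<close>

lemma pure_complex_iff:
  "pure_complex \<Delta> \<longleftrightarrow> simplicial_complex \<Delta> \<and> (\<exists>d. \<forall>F\<in>facets \<Delta>. card F = d)"
proof
  assume p: "pure_complex \<Delta>"
  then obtain G where "G \<in> facets \<Delta>"
    using facets_nonempty pure_complexD by blast
  with p show "simplicial_complex \<Delta> \<and> (\<exists>d. \<forall>F\<in>facets \<Delta>. card F = d)"
    unfolding pure_complex_def face_dim_def by (metis add_diff_cancel_right' diff_add_cancel of_nat_eq_iff)
next
  assume "simplicial_complex \<Delta> \<and> (\<exists>d. \<forall>F\<in>facets \<Delta>. card F = d)"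
  then show "pure_complex \<Delta>"
    unfolding pure_complex_def face_dim_def by auto
qed

lemma link_empty [simp]: "link \<Delta> {} = \<Delta>"
  by (auto simp: link_def)

lemma link_link:
  assumes "simplicial_complex \<Delta>" "F \<inter> H = {}"
  shows "link (link \<Delta> F) H = link \<Delta> (F \<union> H)"
proof (intro equalityI subsetI)
  fix K assume "K \<in> link (link \<Delta> F) H"
  then show "K \<in> link \<Delta> (F \<union> H)" by (auto simp: link_def Un_assoc)
next
  fix K assume "K \<in> link \<Delta> (F \<union> H)"
  then have K: "K \<in> \<Delta>" "F \<inter> K = {}" "H \<inter> K = {}" "F \<union> (H \<union> K) \<in> \<Delta>"
    by (auto simp: link_def Un_assoc)
  have sub: "L \<in> \<Delta>" if "L \<subseteq> F \<union> (H \<union> K)" for L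
    using simplicial_complexD(4)[OF assms(1) K(4) that] .
  have "H \<in> \<Delta>" "F \<union> H \<in> \<Delta>" "F \<union> K \<in> \<Delta>" "H \<union> K \<in> \<Delta>" by (auto intro: sub)
  then show "K \<in> link (link \<Delta> F) H" using K assms(2) by (auto simp: link_def)
qed

lemma simplicial_complex_link:
  assumes "simplicial_complex \<Delta>" "F \<in> \<Delta>"
  shows "simplicial_complex (link \<Delta> F)"
  unfolding simplicial_complex_def
proof (intro conjI ballI allI impI)
  show "finite (link \<Delta> F)"
    using simplicial_complexD(1)[OF assms(1)] by (simp add: link_def)
  show "link \<Delta> F \<noteq> {}"
    using assms simplicial_complexD(2)[OF assms(1)] by (force simp: link_def)
  show "finite H" if "H \<in> link \<Delta> F" for H
    using that simplicial_complexD(3)[OF assms(1)] by (simp add: link_def)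
  show "K \<in> link \<Delta> F" if "H \<in> link \<Delta> F" "K \<subseteq> H" for H K
  proof -
    have H: "H \<in> \<Delta>" "F \<inter> H = {}" "F \<union> H \<in> \<Delta>" using that by (auto simp: link_def)
    have "K \<subseteq> F \<union> H" "F \<union> K \<subseteq> F \<union> H" using that(2) by auto
    then have "K \<in> \<Delta>" "F \<union> K \<in> \<Delta>"
      using simplicial_complexD(4)[OF assms(1) H(3)] by blast+
    then show ?thesis using H that(2) by (auto simp: link_def)
  qed
qed

lemma simplicial_complex_deletion:
  assumes "simplicial_complex \<Delta>"
  shows "simplicial_complex (deletion \<Delta> {x})"
  unfolding simplicial_complex_def
proof (intro conjI ballI allI impI)
  show "deletion \<Delta> {x} \<noteq> {}"
    using simplicial_complexD(2)[OF assms] by (auto simp: deletion_def)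
  show "H \<in> deletion \<Delta> {x}" if "F \<in> deletion \<Delta> {x}" "H \<subseteq> F" for F H
    using that simplicial_complexD(4)[OF assms, of F H] by (auto simp: deletion_def)
qed (use simplicial_complexD(1,3)[OF assms] in \<open>auto simp: deletion_def\<close>)

lemma facets_link:
  assumes "simplicial_complex \<Delta>" "F \<in> \<Delta>"
  shows "facets (link \<Delta> F) = (\<lambda>G. G - F) ` {G \<in> facets \<Delta>. F \<subseteq> G}"
proof (intro equalityI subsetI)
  fix H assume H: "H \<in> facets (link \<Delta> F)"
  then have *: "H \<in> \<Delta>" "F \<inter> H = {}" "F \<union> H \<in> \<Delta>" by (auto simp: facets_def link_def)
  obtain G where G: "G \<in> facets \<Delta>" "F \<union> H \<subseteq> G"
    using face_subset_facet[OF assms(1) *(3)] .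
  then have "G \<in> \<Delta>" by (simp add: facets_def)
  have "G - F \<in> link \<Delta> F"
    using G \<open>G \<in> \<Delta>\<close> simplicial_complexD(4)[OF assms(1) \<open>G \<in> \<Delta>\<close>] by (auto simp: link_def Un_absorb1)
  moreover have "H \<subseteq> G - F" using G * by auto
  ultimately have "G - F = H" using H by (auto simp: facets_def)
  then show "H \<in> (\<lambda>G. G - F) ` {G \<in> facets \<Delta>. F \<subseteq> G}" using G by auto
next
  fix H assume "H \<in> (\<lambda>G. G - F) ` {G \<in> facets \<Delta>. F \<subseteq> G}"
  then obtain G where G: "G \<in> facets \<Delta>" "F \<subseteq> G" "H = G - F" by auto
  then have GD: "G \<in> \<Delta>" and max: "\<And>K. K \<in> \<Delta> \<Longrightarrow> G \<subseteq> K \<Longrightarrow> K = G" by (auto simp: facets_def)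
  have "H \<in> link \<Delta> F"
    using G GD simplicial_complexD(4)[OF assms(1) GD] by (auto simp: link_def Un_absorb1)
  moreover have "K = H" if K: "K \<in> link \<Delta> F" "H \<subseteq> K" for K
  proof -
    have "F \<union> K = G"
      by (rule max) (use K G in \<open>auto simp: link_def\<close>)
    then show ?thesis using K G by (auto simp: link_def)
  qed
  ultimately show "H \<in> facets (link \<Delta> F)" by (auto simp: facets_def)
qed

lemma card_facets_link:
  assumes "simplicial_complex \<Delta>" "\<forall>G\<in>facets \<Delta>. card G = d" "F \<in> \<Delta>" "H \<in> facets (link \<Delta> F)"
  shows "card H = d - card F"
  using assms simplicial_complexD(3)[OF assms(1,3)] facets_link[OF assms(1,3)]
  by (auto simp: card_Diff_subset)

lemma pure_complex_link:
  assumes "pure_complex \<Delta>" "F \<in> \<Delta>"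
  shows "pure_complex (link \<Delta> F)"
  using assms card_facets_link[of \<Delta> _ F] simplicial_complex_link[of \<Delta> F]
  unfolding pure_complex_iff by blast

text \<open>If every facet contains \<open>x\<close>, then so does a facet above any given face, and \<open>x\<close> is the apex of a
  cone.  A facet that avoids \<open>x\<close> survives in the deletion and preserves the dimension.\<close>

lemma facet_avoiding_or_cone:
  assumes sc: "simplicial_complex \<Delta>" and x: "{x} \<in> \<Delta>"
  shows "(\<exists>G\<in>facets \<Delta>. x \<notin> G) \<or>
    deletion \<Delta> {x} = link \<Delta> {x} \<and> (\<forall>H\<in>\<Delta>. insert x H \<in> \<Delta>)"
proof (cases "\<exists>G\<in>facets \<Delta>. x \<notin> G")
  case False
  have cone: "insert x H \<in> \<Delta>" if H: "H \<in> \<Delta>" for H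
  proof -
    obtain G where "G \<in> facets \<Delta>" "H \<subseteq> G"
      using face_subset_facet[OF sc H] .
    then show ?thesis
      using False simplicial_complexD(4)[OF sc, of G "insert x H"] by (auto simp: facets_def)
  qed
  then have "deletion \<Delta> {x} = link \<Delta> {x}"
    by (auto simp: deletion_def link_def)
  with cone show ?thesis by blast
qed blast

lemma facet_deletion:
  "G \<in> facets \<Delta> \<Longrightarrow> x \<notin> G \<Longrightarrow> G \<in> facets (deletion \<Delta> {x})"
  by (auto simp: facets_def deletion_def)

section \<open>Shellings\<close>

text \<open>The shelling condition, read as a recursion that adds one facet at a time; the head of
  the list is the facet added last.\<close>

primrec shelling :: "'a set list \<Rightarrow> bool" where
  "shelling [] \<longleftrightarrow> True"
| "shelling (F # Gs) \<longleftrightarrow>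
     shelling Gs \<and> (\<forall>H\<in>set Gs. \<exists>x\<in>F - H. \<exists>L\<in>set Gs. F - L = {x})"

lemma shelling_rev_iff:
  "shelling (rev Fs) \<longleftrightarrow>
     (\<forall>i<length Fs. \<forall>j<i. \<exists>x\<in>Fs ! i - Fs ! j. \<exists>l<i. Fs ! i - Fs ! l = {x})"
proof (induction Fs rule: rev_induct)
  case (snoc F Fs)
  have last: "(\<forall>H\<in>set Fs. \<exists>x\<in>F - H. \<exists>L\<in>set Fs. F - L = {x}) \<longleftrightarrow>
      (\<forall>j<length Fs. \<exists>x\<in>F - Fs ! j. \<exists>l<length Fs. F - Fs ! l = {x})"
    by (simp add: set_conv_nth Bex_def Ball_def; blast)
  show ?case (is "_ = ?rhs")
  proof -
    define Q where "Q Fs i \<longleftrightarrow> (\<forall>j<i. \<exists>x\<in>Fs ! i - Fs ! j. \<exists>l<i. Fs ! i - Fs ! l = {x})"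
      for Fs :: "'a set list" and i
    have "Q (Fs @ [F]) i \<longleftrightarrow> Q Fs i" if "i < length Fs" for i
    proof -
      have "(Fs @ [F]) ! j = Fs ! j" if "j \<le> i" for j
        using that \<open>i < length Fs\<close> by (simp add: nth_append)
      then show ?thesis by (simp add: Q_def cong: conj_cong)
    qed
    moreover have "Q (Fs @ [F]) (length Fs) \<longleftrightarrow>
        (\<forall>j<length Fs. \<exists>x\<in>F - Fs ! j. \<exists>l<length Fs. F - Fs ! l = {x})"
      by (simp add: Q_def nth_append cong: conj_cong)
    moreover have "?rhs \<longleftrightarrow> (\<forall>i<Suc (length Fs). Q (Fs @ [F]) i)"
      by (simp add: Q_def)
    ultimately have "?rhs \<longleftrightarrow> (\<forall>i<length Fs. Q Fs i) \<and>
        (\<forall>j<length Fs. \<exists>x\<in>F - Fs ! j. \<exists>l<length Fs. F - Fs ! l = {x})"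
      unfolding All_less_Suc by auto
    then show ?thesis by (simp add: snoc last Q_def)
  qed
qed simp

lemma shellable_iff_shelling:
  "shellable \<Delta> \<longleftrightarrow> pure_complex \<Delta> \<and> (\<exists>Fs. distinct Fs \<and> set Fs = facets \<Delta> \<and> shelling Fs)"
  unfolding shellable_def shelling_rev_iff[symmetric]
  by (metis distinct_rev rev_rev_ident set_rev)

text \<open>The facets through a face, in their old order, shell its link.\<close>

lemma shellable_link:
  assumes "shellable \<Delta>" "F \<in> \<Delta>"
  shows "shellable (link \<Delta> F)"
proof -
  obtain Fs where Fs: "distinct Fs" "set Fs = facets \<Delta>" "shelling Fs" and pure: "pure_complex \<Delta>"
    using assms(1) by (auto simp: shellable_iff_shelling)
  let ?star = "filter (\<lambda>G. F \<subseteq> G) Fs"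
  have "shelling (map (\<lambda>G. G - F) (filter (\<lambda>G. F \<subseteq> G) Gs))" if "shelling Gs" for Gs
    using that
  proof (induction Gs)
    case (Cons G Gs)
    have "\<exists>x\<in>G - F - (H - F). \<exists>L\<in>{L\<in>set Gs. F \<subseteq> L}. G - F - (L - F) = {x}"
      if H: "F \<subseteq> G" "H \<in> set Gs" "F \<subseteq> H" for H
    proof -
      obtain x L where "x \<in> G - H" "L \<in> set Gs" "G - L = {x}"
        using Cons.prems H by auto
      then show ?thesis using H by (intro bexI[of _ x] bexI[of _ L]) auto
    qed
    then show ?case using Cons by auto
  qed simp
  then have "shelling (map (\<lambda>G. G - F) ?star)" using Fs by blast
  moreover have "inj_on (\<lambda>G. G - F) {G. F \<subseteq> G}" by (auto intro!: inj_onI)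
  then have "distinct (map (\<lambda>G. G - F) ?star)"
    using Fs(1) by (auto simp: distinct_map intro: inj_on_subset)
  moreover have "set (map (\<lambda>G. G - F) ?star) = facets (link \<Delta> F)"
    using facets_link[OF pure_complexD[OF pure] assms(2)] Fs(2) by auto
  ultimately show ?thesis
    using pure_complex_link[OF pure assms(2)] unfolding shellable_iff_shelling by blast
qed

text \<open>Each facet after the first contains a ridge of an earlier one, so labels that agree along
  edges are carried over as soon as ridges are nonempty.\<close>

lemma shelling_constant_label:
  assumes "shelling Fs" "\<forall>F\<in>set Fs. 2 \<le> card F"
    "\<forall>F\<in>set Fs. \<forall>a\<in>F. \<forall>b\<in>F. g a = g b"
    "a \<in> \<Union>(set Fs)" "b \<in> \<Union>(set Fs)"
  shows "g a = g b"
  using assms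
proof (induction Fs arbitrary: a b)
  case (Cons F Gs)
  have sub: "set Gs \<subseteq> set (F # Gs)" by auto
  have old: "g u = g v" if "u \<in> \<Union>(set Gs)" "v \<in> \<Union>(set Gs)" for u v
  proof (rule Cons.IH[OF _ _ _ that])
    show "shelling Gs" using Cons.prems(1) by simp
    show "\<forall>F\<in>set Gs. 2 \<le> card F" using Cons.prems(2) sub by blast
    show "\<forall>F\<in>set Gs. \<forall>a\<in>F. \<forall>b\<in>F. g a = g b" using Cons.prems(3) sub by blast
  qed
  have new: "g u = g v" if H: "u \<in> F" "v \<in> H" "H \<in> set Gs" for u v H
  proof -
    obtain x L where L: "L \<in> set Gs" "F - L = {x}"
      using Cons.prems(1) H by auto
    obtain w where w: "w \<in> F" "w \<noteq> x"
      using Cons.prems(2) by (metis One_nat_def card_le_Suc0_iff_eq card.infinite list.set_intros(1)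
          not_less_eq_eq numeral_2_eq_2 zero_le)
    have "g u = g w" using Cons.prems(3) H(1) w(1) by (meson list.set_intros(1))
    also have "\<dots> = g v"
      by (rule old) (use L w H in blast)+
    finally show ?thesis .
  qed
  consider "a \<in> F" "b \<in> F" | "a \<in> F" "b \<in> \<Union>(set Gs)" | "a \<in> \<Union>(set Gs)" "b \<in> F"
    | "a \<in> \<Union>(set Gs)" "b \<in> \<Union>(set Gs)"
    using Cons.prems(4,5) by auto
  then show ?case
  proof cases
    case 1 then show ?thesis using Cons.prems(3) by (meson list.set_intros(1))
  next
    case 2 then show ?thesis using new by blast
  next
    case 3 then show ?thesis using new by (metis UnionE)
  next
    case 4 then show ?thesis by (rule old)
  qed
qed simp

lemma shellable_constant_label:
  assumes "shellable \<Delta>" "\<forall>F\<in>facets \<Delta>. 2 \<le> card F"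
    "\<And>a b. {a, b} \<in> \<Delta> \<Longrightarrow> g a = g b" "a \<in> \<Union>\<Delta>" "b \<in> \<Union>\<Delta>"
  shows "g a = g b"
proof -
  obtain Fs where Fs: "set Fs = facets \<Delta>" "shelling Fs" and sc: "simplicial_complex \<Delta>"
    using assms(1) pure_complexD by (auto simp: shellable_iff_shelling)
  have "\<Union>\<Delta> \<subseteq> \<Union>(facets \<Delta>)"
    by (meson UnionE UnionI face_subset_facet[OF sc] subsetD subsetI)
  moreover have "\<forall>F\<in>facets \<Delta>. \<forall>a\<in>F. \<forall>b\<in>F. g a = g b"
  proof (intro ballI)
    fix F a b assume "F \<in> facets \<Delta>" "a \<in> F" "b \<in> F"
    then have "{a, b} \<in> \<Delta>"
      using simplicial_complexD(4)[OF sc, of F "{a, b}"] facets_subset by blast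
    then show "g a = g b" by (rule assms(3))
  qed
  ultimately show ?thesis
    using shelling_constant_label[OF Fs(2), of g a b] assms(2,4,5) Fs(1) by blast
qed

text \<open>A shellable complex of dimension at least two has no first cohomology: every edge
  labelling that is additive on triangles is a difference of vertex labels.  The vertex labels
  extend over a new facet because its ridges on the old complex meet pairwise, so that the old
  labels there differ by a single constant from labels of the new facet.\<close>

lemma shelling_potential:
  fixes f :: "'a \<Rightarrow> 'a \<Rightarrow> 'b::ab_group_add"
  assumes "shelling Fs" "\<forall>F\<in>set Fs. 3 \<le> card F"
    "\<forall>F\<in>set Fs. \<forall>a\<in>F. \<forall>b\<in>F. \<forall>c\<in>F. f a b + f b c = f a c"
  shows "\<exists>g. \<forall>F\<in>set Fs. \<forall>a\<in>F. \<forall>b\<in>F. f a b = g b - g a"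
  using assms
proof (induction Fs)
  case (Cons F Gs)
  then obtain g where g: "\<And>G a b. G \<in> set Gs \<Longrightarrow> a \<in> G \<Longrightarrow> b \<in> G \<Longrightarrow> f a b = g b - g a"
    by auto
  have add: "f a b + f b c = f a c" if "a \<in> F" "b \<in> F" "c \<in> F" for a b c
    using Cons.prems(3) that by auto
  have three: "3 \<le> card F" using Cons.prems(2) by simp
  have avoid: "\<exists>w\<in>F. w \<noteq> x \<and> w \<noteq> y" for x y
  proof (rule ccontr)
    assume "\<not> ?thesis"
    then have "F \<subseteq> {x, y}" by blast
    then have "card F \<le> card {x, y}" by (intro card_mono) auto
    also have "\<dots> \<le> 2" by (simp add: card_insert_if)
    finally show False using three by simp
  qed
  show ?case
  proof (cases "Gs = []")
    case True
    obtain p where p: "p \<in> F" using avoid by blast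
    have "f a b = f p b - f p a" if "a \<in> F" "b \<in> F" for a b
      using add[OF p that] by (simp add: algebra_simps)
    then show ?thesis using True by (intro exI[of _ "f p"]) simp
  next
    case False
    have ridge: "\<exists>x L. x \<notin> H \<and> L \<in> set Gs \<and> F - L = {x}" if "H \<in> set Gs" for H
      using Cons.prems(1) that by fastforce
    then obtain x0 L0 where L0: "L0 \<in> set Gs" "F - L0 = {x0}"
      using False by (metis last_in_set)
    obtain p where p: "p \<in> F" "p \<noteq> x0" using avoid by blast
    have overlap: "g v = f p v + g p" if v: "v \<in> F" "v \<in> H" and H: "H \<in> set Gs" for v H
    proof -
      obtain x L where L: "x \<notin> H" "L \<in> set Gs" "F - L = {x}" using ridge[OF H] by blast
      have vL: "v \<in> L" "v \<noteq> x" using v L by auto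
      show ?thesis
      proof (cases "p = x")
        case False
        then have "p \<in> L" using L p by blast
        then show ?thesis using g[OF L(2) _ vL(1), of p] by simp
      next
        case True
        \<comment> \<open>the base point is missing from the ridge through \<open>v\<close>; pass through a common vertex of
          that ridge and the first one\<close>
        obtain q where q: "q \<in> F" "q \<noteq> x0" "q \<noteq> p" using avoid by metis
        have "f q v = g v - g q" using g[OF L(2), of q v] L(3) q True vL by blast
        moreover have "f p q = g q - g p" using g[OF L0(1), of p q] L0(2) p q by blast
        ultimately show ?thesis using add[OF p(1) q(1) v(1), symmetric] by simp
      qed
    qed
    define h where "h = (\<lambda>v. if v \<in> F then f p v + g p else g v)"
    have "h v = g v" if "v \<in> H" "H \<in> set Gs" for v H
      using overlap that by (auto simp: h_def)
    then have "f a b = h b - h a" if "a \<in> H" "b \<in> H" "H \<in> set Gs" for a b H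
      using g that by metis
    moreover have "f a b = h b - h a" if "a \<in> F" "b \<in> F" for a b
      using add[OF p(1) that] that by (simp add: h_def algebra_simps)
    ultimately show ?thesis by (intro exI[of _ h]) auto
  qed
qed simp

lemma shellable_potential:
  fixes f :: "'a \<Rightarrow> 'a \<Rightarrow> 'b::ab_group_add"
  assumes "shellable \<Delta>" "\<forall>F\<in>facets \<Delta>. 3 \<le> card F"
    "\<And>a b c. {a, b, c} \<in> \<Delta> \<Longrightarrow> f a b + f b c = f a c"
  shows "\<exists>g. \<forall>a b. {a, b} \<in> \<Delta> \<longrightarrow> f a b = g b - g a"
proof -
  obtain Fs where Fs: "set Fs = facets \<Delta>" "shelling Fs" and sc: "simplicial_complex \<Delta>"
    using assms(1) pure_complexD by (auto simp: shellable_iff_shelling)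
  have "\<forall>F\<in>set Fs. \<forall>a\<in>F. \<forall>b\<in>F. \<forall>c\<in>F. f a b + f b c = f a c"
  proof (intro ballI)
    fix F a b c assume "F \<in> set Fs" "a \<in> F" "b \<in> F" "c \<in> F"
    then have "{a, b, c} \<in> \<Delta>"
      using simplicial_complexD(4)[OF sc, of F "{a, b, c}"] facets_subset Fs(1) by blast
    then show "f a b + f b c = f a c" by (rule assms(3))
  qed
  then obtain g where g: "\<forall>F\<in>facets \<Delta>. \<forall>a\<in>F. \<forall>b\<in>F. f a b = g b - g a"
    using shelling_potential[OF Fs(2), of f] assms(2) Fs(1) by auto
  have "f a b = g b - g a" if "{a, b} \<in> \<Delta>" for a b
    using face_subset_facet[OF sc that] g by (metis insert_subset)
  then show ?thesis by blast
qed

section \<open>Chain complexes of simplicial complexes\<close>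

definition vertex_sign :: "'a::linorder \<Rightarrow> 'a set \<Rightarrow> 'k::field" where
  "vertex_sign x H = (- 1) ^ card {y \<in> H. y < x}"

lemma vertex_sign_nonzero [simp]: "vertex_sign x H \<noteq> (0 :: 'k::field)"
  by (simp add: vertex_sign_def)

lemma vertex_sign_square [simp]: "vertex_sign x H * vertex_sign x H = (1 :: 'k::field)"
  by (simp add: vertex_sign_def flip: power_mult_distrib)

lemma vertex_sign_square' [simp]: "vertex_sign x H * (vertex_sign x H * c) = (c :: 'k::field)"
  by (simp flip: mult.assoc)

lemma vertex_sign_insert:
  assumes "finite H" "x \<notin> H"
  shows "(vertex_sign y (insert x H) :: 'k::field) =
    (if x < y then - vertex_sign y H else vertex_sign y H)"
proof -
  have "{z \<in> insert x H. z < y} = (if x < y then insert x {z \<in> H. z < y} else {z \<in> H. z < y})"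
    by auto
  then show ?thesis using assms by (simp add: vertex_sign_def)
qed

lemma vertex_sign_swap:
  assumes "finite H" "x \<notin> H" "y \<notin> H" "x \<noteq> y"
  shows "vertex_sign x H * vertex_sign y (insert x H) =
    - (vertex_sign y H * vertex_sign x (insert y H) :: 'k::field)"
  using assms by (auto simp: vertex_sign_insert)

text \<open>The boundary operator read from the coefficient of a face in the boundary: it collects
  the faces of one dimension more.  In this form it depends neither on the complex nor on the
  degree.\<close>

definition bd :: "'a::linorder set \<Rightarrow> ('a set \<Rightarrow> 'k::field) \<Rightarrow> 'a set \<Rightarrow> 'k" where
  "bd V c H = (\<Sum>x\<in>V - H. vertex_sign x H * c (insert x H))"

lemma bd_add: "bd V (\<lambda>F. c F + d F) H = bd V c H + bd V d H"
  by (simp add: bd_def algebra_simps sum.distrib)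

lemma bd_diff: "bd V (\<lambda>F. c F - d F) H = bd V c H - bd V d H"
  by (simp add: bd_def algebra_simps sum_subtractf)

lemma bd_uminus: "bd V (\<lambda>F. - c F) H = - bd V c H"
  by (simp add: bd_def sum_negf)

lemma boundary_eq_bd:
  fixes c :: "'a::linorder set \<Rightarrow> 'k::field"
  assumes sc: "simplicial_complex \<Delta>" and V: "finite V" "\<Union>\<Delta> \<subseteq> V"
    and c: "c \<in> chains \<Delta> i"
  shows "boundary \<Delta> i c = bd V c"
proof
  fix H :: "'a set"
  let ?FF = "faces_of_dim \<Delta> i"
  have fin: "finite ?FF" using simplicial_complexD(1)[OF sc] by (simp add: faces_of_dim_def)
  have sub: "F \<subseteq> V" if "F \<in> ?FF" for F using that V(2) by (auto simp: faces_of_dim_def)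
  have sgn: "(- 1) ^ card {y \<in> insert x H. y < x} = (vertex_sign x H :: 'k)" for x
  proof -
    have "{y \<in> insert x H. y < x} = {y \<in> H. y < x}" by auto
    then show ?thesis by (simp add: vertex_sign_def)
  qed
  have "boundary \<Delta> i c H =
      (\<Sum>F\<in>?FF. \<Sum>x\<in>V. if x \<in> F \<and> F - {x} = H then (- 1) ^ card {y \<in> F. y < x} * c F else 0)"
    unfolding boundary_def
  proof (rule sum.cong[OF refl])
    fix F assume F: "F \<in> ?FF"
    show "(\<Sum>x\<in>F. if F - {x} = H then (- 1) ^ card {y \<in> F. y < x} * c F else 0) =
      (\<Sum>x\<in>V. if x \<in> F \<and> F - {x} = H then (- 1) ^ card {y \<in> F. y < x} * c F else 0)"
      by (rule sum.mono_neutral_cong_left) (use V(1) sub[OF F] in auto)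
  qed
  also have "\<dots> = (\<Sum>x\<in>V. \<Sum>F\<in>?FF. if x \<in> F \<and> F - {x} = H
      then (- 1) ^ card {y \<in> F. y < x} * c F else 0)"
    by (rule sum.swap)
  also have "\<dots> = (\<Sum>x\<in>V. if x \<in> H then 0 else vertex_sign x H * c (insert x H))"
  proof (rule sum.cong[OF refl])
    fix x
    show "(\<Sum>F\<in>?FF. if x \<in> F \<and> F - {x} = H then (- 1) ^ card {y \<in> F. y < x} * c F else 0) =
      (if x \<in> H then 0 else vertex_sign x H * c (insert x H))"
    proof (cases "x \<in> H")
      case True
      then show ?thesis by (auto intro!: sum.neutral)
    next
      case False
      then have eq: "x \<in> F \<and> F - {x} = H \<longleftrightarrow> F = insert x H" for F by auto
      have "(\<Sum>F\<in>?FF. if x \<in> F \<and> F - {x} = H then (- 1) ^ card {y \<in> F. y < x} * c F else 0)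
          = (\<Sum>F\<in>?FF. if F = insert x H then vertex_sign x H * c (insert x H) else 0)"
        unfolding eq by (rule sum.cong[OF refl]) (use sgn[of x] in \<open>simp split: if_split\<close>)
      also have "\<dots> = vertex_sign x H * c (insert x H)"
        using fin c by (auto simp: chains_def)
      finally show ?thesis using False by simp
    qed
  qed
  also have "\<dots> = bd V c H"
    unfolding bd_def by (rule sum.mono_neutral_cong_right) (use V(1) in auto)
  finally show "boundary \<Delta> i c H = bd V c H" .
qed

lemma sum_antisymmetric:
  fixes t :: "'a::linorder \<Rightarrow> 'a \<Rightarrow> 'b::ab_group_add"
  assumes "finite W" "\<And>x y. x \<in> W \<Longrightarrow> y \<in> W \<Longrightarrow> x \<noteq> y \<Longrightarrow> t x y = - t y x"
  shows "(\<Sum>x\<in>W. \<Sum>y\<in>W - {x}. t x y) = 0"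
proof -
  have "(\<Sum>x\<in>W. \<Sum>y\<in>W - {x}. t x y) =
      (\<Sum>x\<in>W. (\<Sum>y\<in>W. if x < y then t x y else 0) + (\<Sum>y\<in>W. if y < x then t x y else 0))"
  proof (rule sum.cong[OF refl])
    fix x assume "x \<in> W"
    have "(\<Sum>y\<in>W - {x}. t x y) = (\<Sum>y\<in>W. if y = x then 0 else t x y)"
      by (rule sum.mono_neutral_cong_left) (use assms(1) in auto)
    also have "\<dots> = (\<Sum>y\<in>W. (if x < y then t x y else 0) + (if y < x then t x y else 0))"
      by (rule sum.cong) auto
    finally show "(\<Sum>y\<in>W - {x}. t x y) =
        (\<Sum>y\<in>W. if x < y then t x y else 0) + (\<Sum>y\<in>W. if y < x then t x y else 0)"
      by (simp add: sum.distrib)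
  qed
  also have "\<dots> = (\<Sum>x\<in>W. \<Sum>y\<in>W. if x < y then t x y else 0) +
      (\<Sum>x\<in>W. \<Sum>y\<in>W. if y < x then t x y else 0)"
    by (simp add: sum.distrib)
  also have "(\<Sum>x\<in>W. \<Sum>y\<in>W. if y < x then t x y else 0) =
      (\<Sum>y\<in>W. \<Sum>x\<in>W. if y < x then t x y else 0)"
    by (rule sum.swap)
  also have "\<dots> = - (\<Sum>y\<in>W. \<Sum>x\<in>W. if y < x then t y x else 0)"
  proof -
    have "(if y < x then t x y else 0) = - (if y < x then t y x else 0)" if "x \<in> W" "y \<in> W" for x y
      using assms(2)[OF that] by (cases "y < x") simp_all
    then show ?thesis by (simp flip: sum_negf cong: sum.cong)
  qed
  finally show ?thesis by simp
qed

text \<open>Two vertices can be added to a face in two orders, with opposite signs.\<close>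

lemma bd_bd:
  fixes c :: "'a::linorder set \<Rightarrow> 'k::field"
  assumes V: "finite V" and c: "\<And>F. infinite F \<Longrightarrow> c F = 0"
  shows "bd V (bd V c) H = 0"
proof (cases "finite H")
  case False
  then show ?thesis using c by (simp add: bd_def)
next
  case True
  let ?t = "\<lambda>x y. vertex_sign x H * (vertex_sign y (insert x H) * c (insert y (insert x H)))"
  have diff: "V - insert x H = V - H - {x}" for x by auto
  have "bd V (bd V c) H = (\<Sum>x\<in>V - H. \<Sum>y\<in>V - H - {x}. ?t x y)"
    unfolding bd_def by (simp add: sum_distrib_left diff)
  also have "\<dots> = 0"
  proof (rule sum_antisymmetric)
    fix x y assume xy: "x \<in> V - H" "y \<in> V - H" "x \<noteq> y"
    then have "vertex_sign x H * vertex_sign y (insert x H) =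
        - (vertex_sign y H * vertex_sign x (insert y H) :: 'k)"
      using True by (intro vertex_sign_swap) auto
    then show "?t x y = - ?t y x"
      by (simp add: insert_commute[of x y] flip: mult.assoc)
  qed (use V in simp)
  finally show ?thesis .
qed

lemma chains_finite_support: "simplicial_complex \<Delta> \<Longrightarrow> c \<in> chains \<Delta> i \<Longrightarrow> infinite F \<Longrightarrow> c F = 0"
  using simplicial_complexD(3) by (fastforce simp: chains_def faces_of_dim_def)

lemma boundary_chains:
  fixes c :: "'a::linorder set \<Rightarrow> 'k::field"
  assumes sc: "simplicial_complex \<Delta>" and c: "c \<in> chains \<Delta> (i + 1)"
  shows "boundary \<Delta> (i + 1) c \<in> chains \<Delta> i"
proof -
  have "bd (\<Union>\<Delta>) c H = 0" if H: "H \<notin> faces_of_dim \<Delta> i" for H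
  proof -
    have "c (insert x H) = 0" if x: "x \<notin> H" for x
    proof (rule ccontr)
      assume "c (insert x H) \<noteq> 0"
      then have F: "insert x H \<in> \<Delta>" "face_dim (insert x H) = i + 1"
        using c by (auto simp: chains_def faces_of_dim_def)
      then have "H \<in> \<Delta>" "finite H"
        using simplicial_complexD(3,4)[OF sc F(1)] by auto
      then show False using H F(2) x by (simp add: faces_of_dim_def face_dim_def)
    qed
    then show ?thesis by (simp add: bd_def)
  qed
  then show ?thesis
    unfolding boundary_eq_bd[OF sc finite_vertices_complex[OF sc] order_refl c]
    by (simp add: chains_def)
qed

lemma boundaries_subset_cycles:
  assumes sc: "simplicial_complex \<Delta>"
  shows "(boundaries \<Delta> i :: ('a::linorder set \<Rightarrow> 'k::field) set) \<subseteq> cycles \<Delta> i"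
proof
  fix b :: "'a set \<Rightarrow> 'k" assume "b \<in> boundaries \<Delta> i"
  then obtain c where c: "c \<in> chains \<Delta> (i + 1)" "b = boundary \<Delta> (i + 1) c"
    by (auto simp: boundaries_def)
  note eq = boundary_eq_bd[OF sc finite_vertices_complex[OF sc] order_refl]
  have b: "b \<in> chains \<Delta> i" unfolding c(2) by (rule boundary_chains[OF sc c(1)])
  have "bd (\<Union>\<Delta>) (bd (\<Union>\<Delta>) c) H = 0" for H
    by (rule bd_bd[OF finite_vertices_complex[OF sc] chains_finite_support[OF sc c(1)]])
  moreover have "boundary \<Delta> i b = bd (\<Union>\<Delta>) (bd (\<Union>\<Delta>) c)"
    using eq[OF b] c(2) eq[OF c(1)] by simp
  ultimately have "boundary \<Delta> i b = (\<lambda>_. 0)" by (simp add: fun_eq_iff)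
  with b show "b \<in> cycles \<Delta> i" by (simp add: cycles_def)
qed

lemma chains_add: "c \<in> chains \<Delta> i \<Longrightarrow> d \<in> chains \<Delta> i \<Longrightarrow> (\<lambda>F. c F + d F) \<in> chains \<Delta> i"
  by (simp add: chains_def)

lemma chains_uminus: "c \<in> chains \<Delta> i \<Longrightarrow> (\<lambda>F. - c F) \<in> chains \<Delta> i"
  by (simp add: chains_def)

lemma boundary_add:
  assumes "simplicial_complex \<Delta>" "c \<in> chains \<Delta> i" "d \<in> chains \<Delta> i"
  shows "boundary \<Delta> i (\<lambda>F. c F + d F) = (\<lambda>H. boundary \<Delta> i c H + boundary \<Delta> i d H)"
  by (simp add: fun_eq_iff bd_add assms chains_add
      boundary_eq_bd[OF assms(1) finite_vertices_complex[OF assms(1)] order_refl])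

lemma boundary_uminus:
  assumes "simplicial_complex \<Delta>" "c \<in> chains \<Delta> i"
  shows "boundary \<Delta> i (\<lambda>F. - c F) = (\<lambda>H. - boundary \<Delta> i c H)"
  by (simp add: fun_eq_iff bd_uminus assms chains_uminus
      boundary_eq_bd[OF assms(1) finite_vertices_complex[OF assms(1)] order_refl])

lemma boundary_zero [simp]: "boundary \<Delta> i (\<lambda>_. 0) = (\<lambda>_. 0)"
  by (simp add: boundary_def fun_eq_iff cong: if_cong)

lemma zero_in_boundaries: "(\<lambda>_. 0) \<in> boundaries \<Delta> i"
  unfolding boundaries_def by (rule image_eqI[of _ _ "\<lambda>_. 0"]) (simp_all add: chains_def)

lemma comm_group_cycle_group:
  assumes sc: "simplicial_complex \<Delta>"
  shows "comm_group (cycle_group \<Delta> i :: ('a::linorder set \<Rightarrow> 'k::field) monoid)"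
    (is "comm_group ?Z")
proof (rule comm_groupI)
  fix c assume c: "c \<in> carrier ?Z"
  then have "(\<lambda>F. - c F) \<in> carrier ?Z"
    by (auto simp: cycle_group_def cycles_def chains_uminus boundary_uminus[OF sc])
  then show "\<exists>d\<in>carrier ?Z. d \<otimes>\<^bsub>?Z\<^esub> c = \<one>\<^bsub>?Z\<^esub>"
    by (rule bexI[rotated]) (simp add: cycle_group_def)
next
  fix c d assume "c \<in> carrier ?Z" "d \<in> carrier ?Z"
  then show "c \<otimes>\<^bsub>?Z\<^esub> d \<in> carrier ?Z"
    by (auto simp: cycle_group_def cycles_def chains_add boundary_add[OF sc])
next
  show "\<one>\<^bsub>?Z\<^esub> \<in> carrier ?Z"
    by (simp add: cycle_group_def cycles_def chains_def)
qed (auto simp: cycle_group_def algebra_simps)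

text \<open>The coset of a cycle contains that cycle, so it is the trivial coset only if the cycle bounds.\<close>

lemma trivial_reduced_homology_iff:
  assumes sc: "simplicial_complex (\<Delta> :: 'a::linorder set set)"
  shows "trivial_group (reduced_homology (k :: 'k::field itself) \<Delta> i) \<longleftrightarrow>
    cycles \<Delta> i \<subseteq> (boundaries \<Delta> i :: ('a set \<Rightarrow> 'k) set)"
proof
  let ?Z = "cycle_group \<Delta> i :: ('a set \<Rightarrow> 'k) monoid"
  interpret comm_group ?Z by (rule comm_group_cycle_group[OF sc])
  assume t: "trivial_group (reduced_homology k \<Delta> i)"
  show "cycles \<Delta> i \<subseteq> (boundaries \<Delta> i :: ('a set \<Rightarrow> 'k) set)"
  proof
    fix c :: "'a set \<Rightarrow> 'k" assume c: "c \<in> cycles \<Delta> i"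
    then have "boundaries \<Delta> i #>\<^bsub>?Z\<^esub> c \<in> carrier (reduced_homology k \<Delta> i)"
      by (auto simp: reduced_homology_def FactGroup_def RCOSETS_def cycle_group_def)
    then have "boundaries \<Delta> i #>\<^bsub>?Z\<^esub> c = boundaries \<Delta> i"
      using t by (simp add: trivial_group_def reduced_homology_def FactGroup_def)
    moreover have "c \<in> boundaries \<Delta> i #>\<^bsub>?Z\<^esub> c"
      using zero_in_boundaries[of \<Delta> i] by (force simp: r_coset_def cycle_group_def)
    ultimately show "c \<in> boundaries \<Delta> i" by simp
  qed
next
  let ?Z = "cycle_group \<Delta> i :: ('a set \<Rightarrow> 'k) monoid"
  interpret comm_group ?Z by (rule comm_group_cycle_group[OF sc])
  assume "cycles \<Delta> i \<subseteq> (boundaries \<Delta> i :: ('a set \<Rightarrow> 'k) set)"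
  then have "boundaries \<Delta> i = carrier ?Z"
    using boundaries_subset_cycles[OF sc] by (auto simp: cycle_group_def)
  moreover have "carrier ?Z \<lhd> ?Z"
    by (simp add: normal_self)
  moreover have "carrier ?Z #>\<^bsub>?Z\<^esub> c = carrier ?Z" if "c \<in> carrier ?Z" for c
    using that by (simp add: coset_join2 subgroup_self)
  moreover have "group (?Z Mod carrier ?Z)"
    using \<open>carrier ?Z \<lhd> ?Z\<close> by (rule normal.factorgroup_is_group)
  ultimately show "trivial_group (reduced_homology k \<Delta> i)"
    unfolding reduced_homology_def trivial_group_def by (auto simp: FactGroup_def RCOSETS_def)
qed

section \<open>Vertex decomposable complexes are Cohen-Macaulay\<close>

definition cone_chain :: "'a::linorder \<Rightarrow> ('a set \<Rightarrow> 'k::field) \<Rightarrow> 'a set \<Rightarrow> 'k" where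
  "cone_chain x a H = (if x \<in> H then vertex_sign x (H - {x}) * a (H - {x}) else 0)"

text \<open>Coning is a contracting homotopy, up to sign, away from the apex.\<close>

lemma bd_cone_chain:
  fixes a :: "'a::linorder set \<Rightarrow> 'k::field"
  assumes V: "finite V" "x \<in> V" and a: "\<And>H. x \<in> H \<or> infinite H \<Longrightarrow> a H = 0"
  shows "bd V (cone_chain x a) H = a H - cone_chain x (bd V a) H"
proof (cases "x \<in> H")
  case False
  have "bd V (cone_chain x a) H = (\<Sum>y\<in>{x}. vertex_sign y H * cone_chain x a (insert y H))"
    unfolding bd_def by (rule sum.mono_neutral_right) (use V False in \<open>auto simp: cone_chain_def\<close>)
  also have "\<dots> = a H" using False by (simp add: cone_chain_def)
  finally show ?thesis using False by (simp add: cone_chain_def)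
next
  case True
  define K where "K = H - {x}"
  have K: "H = insert x K" "x \<notin> K" using True by (auto simp: K_def)
  show ?thesis
  proof (cases "finite K")
    case False
    then have "cone_chain x a (insert y H) = 0" "a (insert y K) = 0" for y
      using a K by (auto simp: cone_chain_def)
    then show ?thesis using a K False by (simp add: bd_def cone_chain_def)
  next
    case fin: True
    have "vertex_sign y H * cone_chain x a (insert y H) =
        - (vertex_sign x K * (vertex_sign y K * a (insert y K)))" if "y \<in> V - H" for y
    proof -
      have y: "y \<noteq> x" "y \<notin> K" using that K by auto
      then have "insert y H - {x} = insert y K" using K by auto
      then have "vertex_sign y H * cone_chain x a (insert y H) =
          vertex_sign y (insert x K) * vertex_sign x (insert y K) * a (insert y K)"
        using K by (simp add: cone_chain_def)
      also have "vertex_sign y (insert x K) * vertex_sign x (insert y K) =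
          - (vertex_sign x K * vertex_sign y K :: 'k)"
        using y K(2) fin by (auto simp: vertex_sign_insert)
      finally show ?thesis by (simp add: mult.assoc)
    qed
    then have "bd V (cone_chain x a) H =
        (\<Sum>y\<in>V - H. - (vertex_sign x K * (vertex_sign y K * a (insert y K))))"
      unfolding bd_def by (intro sum.cong) auto
    also have "\<dots> = - (vertex_sign x K * (\<Sum>y\<in>V - H. vertex_sign y K * a (insert y K)))"
      by (simp add: sum_negf sum_distrib_left)
    also have "(\<Sum>y\<in>V - H. vertex_sign y K * a (insert y K)) = bd V a K"
      unfolding bd_def by (rule sum.mono_neutral_left) (use V K a in auto)
    finally have "bd V (cone_chain x a) H = - (vertex_sign x K * bd V a K)" .
    moreover have "cone_chain x (bd V a) H = vertex_sign x K * bd V a K"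
      using K by (simp add: cone_chain_def)
    ultimately show ?thesis using a[of H] True by simp
  qed
qed

text \<open>The parts of a chain on the faces through a vertex (with that vertex removed) and on the
  faces avoiding it.\<close>

definition link_part :: "'a::linorder \<Rightarrow> ('a set \<Rightarrow> 'k::field) \<Rightarrow> 'a set \<Rightarrow> 'k" where
  "link_part x z H = (if x \<in> H then 0 else vertex_sign x H * z (insert x H))"

definition deletion_part :: "'a \<Rightarrow> ('a set \<Rightarrow> 'k::field) \<Rightarrow> 'a set \<Rightarrow> 'k" where
  "deletion_part x z H = (if x \<in> H then 0 else z H)"

lemma cone_chain_link_part: "cone_chain x (link_part x z) H + deletion_part x z H = z H"
  by (auto simp: cone_chain_def link_part_def deletion_part_def insert_absorb)

lemma link_part_chains:
  assumes sc: "simplicial_complex \<Delta>" and z: "z \<in> chains \<Delta> i"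
  shows "link_part x z \<in> chains (link \<Delta> {x}) (i - 1)"
proof -
  have "H \<in> faces_of_dim (link \<Delta> {x}) (i - 1)" if H: "link_part x z H \<noteq> 0" for H
  proof -
    have x: "x \<notin> H" "z (insert x H) \<noteq> 0" using H by (auto simp: link_part_def split: if_splits)
    then have F: "insert x H \<in> \<Delta>" "face_dim (insert x H) = i"
      using z by (auto simp: chains_def faces_of_dim_def)
    then have "H \<in> \<Delta>" "finite H" using simplicial_complexD(3,4)[OF sc F(1)] by auto
    then show ?thesis using F x by (simp add: faces_of_dim_def link_def face_dim_def)
  qed
  then show ?thesis by (auto simp: chains_def)
qed

lemma deletion_part_chains: "z \<in> chains \<Delta> i \<Longrightarrow> deletion_part x z \<in> chains (deletion \<Delta> {x}) i"
  by (auto simp: chains_def faces_of_dim_def deletion_part_def deletion_def)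

lemma cone_chain_chains:
  assumes sc: "simplicial_complex \<Delta>" and a: "a \<in> chains \<Gamma> i"
    and cone: "\<And>H. H \<in> \<Gamma> \<Longrightarrow> x \<notin> H \<Longrightarrow> insert x H \<in> \<Delta>"
  shows "cone_chain x a \<in> chains \<Delta> (i + 1)"
proof -
  have "H \<in> faces_of_dim \<Delta> (i + 1)" if H: "cone_chain x a H \<noteq> 0" for H
  proof -
    have x: "x \<in> H" "a (H - {x}) \<noteq> 0" using H by (auto simp: cone_chain_def split: if_splits)
    then have F: "H - {x} \<in> \<Gamma>" "face_dim (H - {x}) = i"
      using a by (auto simp: chains_def faces_of_dim_def)
    have "H \<in> \<Delta>" using cone[OF F(1)] x by (simp add: insert_absorb)
    moreover from this have "finite H" by (rule simplicial_complexD(3)[OF sc])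
    ultimately show ?thesis using F(2) card_Suc_Diff1[of H x] x(1)
      by (auto simp: faces_of_dim_def face_dim_def)
  qed
  then show ?thesis by (auto simp: chains_def)
qed

lemma chains_mono: "\<Gamma> \<subseteq> \<Delta> \<Longrightarrow> chains \<Gamma> i \<subseteq> chains \<Delta> i"
  by (auto simp: chains_def faces_of_dim_def)

lemma cycles_bd:
  assumes "simplicial_complex \<Delta>" "finite V" "\<Union>\<Delta> \<subseteq> V"
  shows "cycles \<Delta> i = {c \<in> chains \<Delta> i. \<forall>H. bd V c H = 0}"
  unfolding cycles_def by (auto simp: boundary_eq_bd[OF assms] fun_eq_iff)

lemma in_boundariesI:
  assumes "simplicial_complex \<Delta>" "finite V" "\<Union>\<Delta> \<subseteq> V" "c \<in> chains \<Delta> (i + 1)"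
    "\<And>H. bd V c H = z H"
  shows "z \<in> boundaries \<Delta> i"
  unfolding boundaries_def
  by (rule image_eqI[of _ _ c]) (simp_all add: boundary_eq_bd[OF assms(1-4)] assms(4,5) fun_eq_iff)

text \<open>The boundary of a cycle, split along a vertex: the link part is again a cycle, and it is,
  up to sign, the boundary of the deletion part.\<close>

lemma split_cycle:
  fixes z :: "'a::linorder set \<Rightarrow> 'k::field"
  assumes V: "finite V" "x \<in> V" and z: "\<And>H. infinite H \<Longrightarrow> z H = 0" and cyc: "\<And>H. bd V z H = 0"
  shows "bd V (link_part x z) H = 0" "bd V (deletion_part x z) H = - link_part x z H"
proof -
  have lp: "link_part x z H = 0" if "x \<in> H \<or> infinite H" for H
    using that z by (auto simp: link_part_def)
  have "z = (\<lambda>H. cone_chain x (link_part x z) H + deletion_part x z H)"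
    by (simp add: cone_chain_link_part)
  then have "0 = bd V (\<lambda>H. cone_chain x (link_part x z) H + deletion_part x z H) H" for H
    using cyc by metis
  then have main: "0 = link_part x z H - cone_chain x (bd V (link_part x z)) H +
      bd V (deletion_part x z) H" for H
    unfolding bd_add using bd_cone_chain[OF V lp] by simp
  have off: "bd V (deletion_part x z) H = 0" if "x \<in> H" for H
    using that by (simp add: bd_def deletion_part_def)
  show "bd V (link_part x z) H = 0"
  proof (cases "x \<in> H")
    case True
    then show ?thesis by (simp add: bd_def link_part_def)
  next
    case False
    then show ?thesis
      using main[of "insert x H"] off[of "insert x H"] lp[of "insert x H"]
      by (simp add: cone_chain_def)
  qed
  show "bd V (deletion_part x z) H = - link_part x z H"
  proof (cases "x \<in> H")
    case True
    then show ?thesis using off lp by simp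
  next
    case False
    then show ?thesis using main[of H] by (simp add: cone_chain_def eq_neg_iff_add_eq_0 add.commute)
  qed
qed

lemma cone_acyclic:
  assumes sc: "simplicial_complex (\<Delta> :: 'a::linorder set set)" and x: "x \<in> \<Union>\<Delta>"
    and cone: "\<And>H. H \<in> \<Delta> \<Longrightarrow> insert x H \<in> \<Delta>"
  shows "cycles \<Delta> i \<subseteq> (boundaries \<Delta> i :: ('a set \<Rightarrow> 'k::field) set)"
proof
  note V = finite_vertices_complex[OF sc] order_refl[of "\<Union>\<Delta>"]
  fix z :: "'a set \<Rightarrow> 'k" assume "z \<in> cycles \<Delta> i"
  then have z: "z \<in> chains \<Delta> i" "\<And>H. bd (\<Union>\<Delta>) z H = 0"
    by (auto simp: cycles_bd[OF sc V])
  have fin: "z H = 0" if "infinite H" for H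
    by (rule chains_finite_support[OF sc z(1) that])
  let ?b = "deletion_part x z"
  have "?b \<in> chains \<Delta> i"
    using deletion_part_chains[OF z(1)] chains_mono[of "deletion \<Delta> {x}" \<Delta>] by (auto simp: deletion_def)
  then have "cone_chain x ?b \<in> chains \<Delta> (i + 1)"
    by (rule cone_chain_chains[OF sc]) (rule cone)
  then show "z \<in> boundaries \<Delta> i"
  proof (rule in_boundariesI[OF sc V])
    fix H
    have "bd (\<Union>\<Delta>) (cone_chain x ?b) H = ?b H - cone_chain x (bd (\<Union>\<Delta>) ?b) H"
      by (rule bd_cone_chain[OF V(1) x]) (use fin in \<open>auto simp: deletion_part_def\<close>)
    also have "bd (\<Union>\<Delta>) ?b = (\<lambda>H. - link_part x z H)"
      using split_cycle(2)[OF V(1) x fin z(2)] by blast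
    also have "cone_chain x (\<lambda>H. - link_part x z H) H = - cone_chain x (link_part x z) H"
      by (simp add: cone_chain_def)
    finally show "bd (\<Union>\<Delta>) (cone_chain x ?b) H = z H"
      using cone_chain_link_part[of x z H] by (simp add: add.commute)
  qed
qed

text \<open>A Mayer-Vietoris argument for the cover of the complex by the deletion of a vertex and the
  cone over its link.  A filling of the link part, coned off, moves the cycle into the
  deletion.\<close>

lemma acyclic_of_link_deletion:
  assumes sc: "simplicial_complex (\<Delta> :: 'a::linorder set set)" and x: "{x} \<in> \<Delta>"
    and lk: "cycles (link \<Delta> {x}) (i - 1) \<subseteq>
      (boundaries (link \<Delta> {x}) (i - 1) :: ('a set \<Rightarrow> 'k::field) set)"
    and dl: "cycles (deletion \<Delta> {x}) i \<subseteq> (boundaries (deletion \<Delta> {x}) i :: ('a set \<Rightarrow> 'k) set)"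
  shows "cycles \<Delta> i \<subseteq> (boundaries \<Delta> i :: ('a set \<Rightarrow> 'k) set)"
proof
  let ?V = "\<Union>\<Delta>" and ?L = "link \<Delta> {x}" and ?D = "deletion \<Delta> {x}"
  have V: "finite ?V" "\<Union>\<Delta> \<subseteq> ?V" "\<Union>?L \<subseteq> ?V" "\<Union>?D \<subseteq> ?V" and xV: "x \<in> ?V"
    using finite_vertices_complex[OF sc] x by (auto simp: link_def deletion_def)
  have scL: "simplicial_complex ?L" and scD: "simplicial_complex ?D"
    using simplicial_complex_link[OF sc x] simplicial_complex_deletion[OF sc] by auto
  fix z :: "'a set \<Rightarrow> 'k" assume "z \<in> cycles \<Delta> i"
  then have z: "z \<in> chains \<Delta> i" "\<And>H. bd ?V z H = 0"
    by (auto simp: cycles_bd[OF sc V(1,2)])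
  have fin: "z H = 0" if "infinite H" for H
    by (rule chains_finite_support[OF sc z(1) that])
  let ?a = "link_part x z" and ?b = "deletion_part x z"
  have "?a \<in> cycles ?L (i - 1)"
    unfolding cycles_bd[OF scL V(1,3)]
    using link_part_chains[OF sc z(1)] split_cycle(1)[OF V(1) xV fin z(2)] by simp
  then have "?a \<in> boundaries ?L (i - 1)" using lk by blast
  then obtain a' where a': "a' \<in> chains ?L i" "?a = boundary ?L i a'"
    by (auto simp: boundaries_def)
  then have bda: "bd ?V a' = ?a" using boundary_eq_bd[OF scL V(1,3)] by metis
  have off: "a' H = 0" if "x \<in> H \<or> infinite H" for H
    using that a'(1) chains_finite_support[OF scL a'(1)]
    by (auto simp: chains_def faces_of_dim_def link_def)
  let ?c = "\<lambda>H. ?b H + a' H"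
  have "?L \<subseteq> ?D" by (auto simp: link_def deletion_def)
  then have cD: "?c \<in> chains ?D i"
    using chains_mono a'(1) by (intro chains_add deletion_part_chains[OF z(1)]) blast
  have "bd ?V ?c H = 0" for H
    using split_cycle(2)[OF V(1) xV fin z(2), of H] by (simp add: bd_add bda)
  then have "?c \<in> cycles ?D i" using cD by (simp add: cycles_bd[OF scD V(1,4)])
  then have "?c \<in> boundaries ?D i" using dl by blast
  then obtain c where c: "c \<in> chains ?D (i + 1)" "?c = boundary ?D (i + 1) c"
    by (auto simp: boundaries_def)
  then have bdc: "bd ?V c H = ?c H" for H using boundary_eq_bd[OF scD V(1,4)] by metis
  have "c \<in> chains \<Delta> (i + 1)"
    using c(1) chains_mono[of ?D \<Delta>] by (auto simp: deletion_def)
  moreover have "cone_chain x a' \<in> chains \<Delta> (i + 1)"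
    by (rule cone_chain_chains[OF sc a'(1)]) (simp add: link_def)
  ultimately have "(\<lambda>H. c H - cone_chain x a' H) \<in> chains \<Delta> (i + 1)"
    by (simp add: chains_def)
  then show "z \<in> boundaries \<Delta> i"
  proof (rule in_boundariesI[OF sc V(1,2)])
    fix H
    have "bd ?V (cone_chain x a') H = a' H - cone_chain x ?a H"
      using bd_cone_chain[OF V(1) xV off] bda by simp
    then show "bd ?V (\<lambda>H. c H - cone_chain x a' H) H = z H"
      unfolding bd_diff bdc using cone_chain_link_part[of x z H] by (simp add: add.commute)
  qed
qed

lemma face_dim_le_complex_dim:
  "simplicial_complex \<Delta> \<Longrightarrow> F \<in> \<Delta> \<Longrightarrow> face_dim F \<le> complex_dim \<Delta>"
  unfolding complex_dim_def by (rule Max_ge) (simp_all add: simplicial_complexD(1))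

lemma complex_dim_eq:
  assumes sc: "simplicial_complex \<Delta>" and d: "\<forall>F\<in>facets \<Delta>. card F = d"
  shows "complex_dim \<Delta> = int d - 1"
  unfolding complex_dim_def
proof (rule Max_eqI)
  show "finite (face_dim ` \<Delta>)" using simplicial_complexD(1)[OF sc] by simp
  show "int d - 1 \<in> face_dim ` \<Delta>"
    using facets_nonempty[OF sc] facets_subset[of \<Delta>] d by (force simp: face_dim_def)
  fix e assume "e \<in> face_dim ` \<Delta>"
  then obtain F where F: "F \<in> \<Delta>" "e = face_dim F" by blast
  obtain G where G: "G \<in> facets \<Delta>" "F \<subseteq> G" using face_subset_facet[OF sc F(1)] .
  then have "card F \<le> d"
    using d card_mono[OF simplicial_complexD(3)[OF sc, of G]] facets_subset[of \<Delta>] by fastforce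
  then show "e \<le> int d - 1" using F(2) by (simp add: face_dim_def)
qed

lemma vertex_decomposable_pure: "vertex_decomposable \<Delta> \<Longrightarrow> pure_complex \<Delta>"
  by (cases rule: vertex_decomposable.cases) auto

lemma link_deletion:
  assumes "x \<notin> F"
  shows "link (deletion \<Delta> {x}) F = deletion (link \<Delta> F) {x}"
  using assms by (auto simp: link_def deletion_def)

text \<open>All links are treated at once, because link and deletion at \<open>x\<close> commute with the link of \<open>F\<close>.
  If \<open>x\<close> is in \<open>F\<close> or not joined to \<open>F\<close>, the link of \<open>F\<close> already lives in the link or in the deletion
  of \<open>x\<close>; otherwise \<open>x\<close> is a vertex of it, and the Mayer-Vietoris argument applies unless \<open>x\<close> is a
  cone apex.\<close>

lemma vertex_decomposable_link_acyclic:
  assumes "vertex_decomposable (\<Delta> :: 'a::linorder set set)" "F \<in> \<Delta>"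
    "i < complex_dim (link \<Delta> F)"
  shows "cycles (link \<Delta> F) i \<subseteq> (boundaries (link \<Delta> F) i :: ('a set \<Rightarrow> 'k::field) set)"
  using assms
proof (induction arbitrary: F i rule: vertex_decomposable.induct)
  case (simplex \<Delta>)
  have sc: "simplicial_complex \<Delta>" using simplex.hyps(1) by (rule pure_complexD)
  have top: "\<Union>\<Delta> \<in> \<Delta>" using simplex.hyps(2) facets_subset[of \<Delta>] by simp
  have all: "H \<in> \<Delta>" if "H \<subseteq> \<Union>\<Delta>" for H using simplicial_complexD(4)[OF sc top that] .
  have scL: "simplicial_complex (link \<Delta> F)" by (rule simplicial_complex_link[OF sc simplex.prems(1)])
  show ?case
  proof (cases "\<Union>\<Delta> \<subseteq> F")
    case True
    then have L: "link \<Delta> F = {{}}"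
      using simplicial_complexD(2)[OF scL] by (auto simp: link_def)
    then have "faces_of_dim (link \<Delta> F) i = {}"
      using simplex.prems(2) by (auto simp: faces_of_dim_def complex_dim_def face_dim_def)
    then have "c = (\<lambda>_. 0)" if "c \<in> cycles (link \<Delta> F) i" for c :: "'a set \<Rightarrow> 'k"
      using that by (auto simp: cycles_def chains_def)
    then show ?thesis using zero_in_boundaries by blast
  next
    case False
    then obtain x where x: "x \<in> \<Union>\<Delta>" "x \<notin> F" by blast
    have cone: "insert x H \<in> link \<Delta> F" if "H \<in> link \<Delta> F" for H
      using that x simplex.prems(1) by (auto simp: link_def intro!: all)
    then have "x \<in> \<Union>(link \<Delta> F)" using simplicial_complexD(2)[OF scL] by blast
    then show ?thesis by (rule cone_acyclic[OF scL _ cone])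
  qed
next
  case (shed \<Delta> x)
  have sc: "simplicial_complex \<Delta>" using shed.hyps(1) by (rule pure_complexD)
  have x: "{x} \<in> \<Delta>" using shed.hyps(2) simplicial_complexD(4)[OF sc] by blast
  have scL: "simplicial_complex (link \<Delta> F)" by (rule simplicial_complex_link[OF sc shed.prems(1)])
  consider "x \<in> F" | "x \<notin> F" "insert x F \<notin> \<Delta>" | "x \<notin> F" "insert x F \<in> \<Delta>" by blast
  then show ?case
  proof cases
    case 1
    then have "link \<Delta> F = link (link \<Delta> {x}) (F - {x})"
      using link_link[OF sc, of "{x}" "F - {x}"] by (simp add: insert_absorb)
    moreover have "F - {x} \<in> link \<Delta> {x}"
      using 1 shed.prems(1) simplicial_complexD(4)[OF sc] by (auto simp: link_def insert_absorb)
    ultimately show ?thesis using shed.IH(1)[of "F - {x}" i] shed.prems(2) by simp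
  next
    case 2
    have "x \<notin> H" if "H \<in> link \<Delta> F" for H
      using that 2 simplicial_complexD(4)[OF sc, of "F \<union> H" "insert x F"] by (auto simp: link_def)
    then have "link \<Delta> F = link (deletion \<Delta> {x}) F"
      unfolding link_deletion[OF 2(1)] by (auto simp: deletion_def)
    moreover have "F \<in> deletion \<Delta> {x}" using 2 shed.prems(1) by (simp add: deletion_def)
    ultimately show ?thesis using shed.IH(2)[of F i] shed.prems(2) by simp
  next
    case 3
    let ?L = "link \<Delta> F"
    have xL: "{x} \<in> ?L" using 3 x by (simp add: link_def)
    have lk: "link ?L {x} = link (link \<Delta> {x}) F"
      using link_link[OF sc, of F "{x}"] link_link[OF sc, of "{x}" F] 3(1) by simp
    have dl: "deletion ?L {x} = link (deletion \<Delta> {x}) F" by (rule link_deletion[OF 3(1), symmetric])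
    have Flk: "F \<in> link \<Delta> {x}" using 3 shed.prems(1) by (simp add: link_def)
    have Fdl: "F \<in> deletion \<Delta> {x}" using 3 shed.prems(1) by (simp add: deletion_def)
    have "pure_complex ?L" by (rule pure_complex_link[OF shed.hyps(1) shed.prems(1)])
    then obtain d where d: "\<forall>G\<in>facets ?L. card G = d" by (auto simp: pure_complex_iff)
    have dim: "complex_dim ?L = int d - 1" by (rule complex_dim_eq[OF scL d])
    consider G where "G \<in> facets ?L" "x \<notin> G" | "\<forall>H\<in>?L. insert x H \<in> ?L"
      using facet_avoiding_or_cone[OF scL xL] by blast
    then show ?thesis
    proof cases
      case 1
      have "G \<in> deletion ?L {x}" using 1 facets_subset[of ?L] by (auto simp: deletion_def)
      then have "face_dim G \<le> complex_dim (deletion ?L {x})"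
        by (rule face_dim_le_complex_dim[OF simplicial_complex_deletion[OF scL]])
      then have i2: "i < complex_dim (deletion ?L {x})"
        using shed.prems(2) dim d 1 by (simp add: face_dim_def)
      have scLx: "simplicial_complex (link ?L {x})" by (rule simplicial_complex_link[OF scL xL])
      have "\<forall>H\<in>facets (link ?L {x}). card H = d - 1"
        using card_facets_link[OF scL d xL] by simp
      then have "complex_dim (link ?L {x}) = int (d - 1) - 1" by (rule complex_dim_eq[OF scLx])
      then have i1: "i - 1 < complex_dim (link ?L {x})" using shed.prems(2) dim by simp
      show ?thesis
      proof (rule acyclic_of_link_deletion[OF scL xL])
        show "cycles (link ?L {x}) (i - 1) \<subseteq>
            (boundaries (link ?L {x}) (i - 1) :: ('a set \<Rightarrow> 'k) set)"
          unfolding lk by (rule shed.IH(1)[OF Flk]) (use i1 lk in simp)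
        show "cycles (deletion ?L {x}) i \<subseteq>
            (boundaries (deletion ?L {x}) i :: ('a set \<Rightarrow> 'k) set)"
          unfolding dl by (rule shed.IH(2)[OF Fdl]) (use i2 dl in simp)
      qed
    next
      case 2
      then show ?thesis using xL by (intro cone_acyclic[OF scL, of x]) auto
    qed
  qed
qed

lemma vertex_decomposable_imp_cohen_macaulay:
  fixes \<Delta> :: "'a::linorder set set" and k :: "'k::field itself"
  assumes "vertex_decomposable \<Delta>"
  shows "cohen_macaulay k \<Delta>"
  unfolding cohen_macaulay_def
proof (intro conjI ballI allI impI)
  show pure: "pure_complex \<Delta>" by (rule vertex_decomposable_pure[OF assms])
  fix F i assume "F \<in> \<Delta>" "i < complex_dim (link \<Delta> F)"
  then show "trivial_group (reduced_homology k (link \<Delta> F) i)"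
    using vertex_decomposable_link_acyclic[OF assms] pure_complexD[OF pure]
    by (simp add: trivial_reduced_homology_iff simplicial_complex_link)
qed

text \<open>Acyclicity in degree zero is connectedness: the difference of two vertices bounds, and
  pairing a boundary with a function that is constant along edges gives zero.\<close>

lemma acyclic_constant_label:
  fixes \<Delta> :: "'a::linorder set set"
  assumes sc: "simplicial_complex \<Delta>"
    and ac: "cycles \<Delta> 0 \<subseteq> (boundaries \<Delta> 0 :: ('a set \<Rightarrow> 'k::field) set)"
    and g: "\<And>a b. {a, b} \<in> \<Delta> \<Longrightarrow> g a = g b" and u: "u \<in> \<Union>\<Delta>" and v: "v \<in> \<Union>\<Delta>"
  shows "g u = g v"
proof (rule ccontr)
  assume uv: "g u \<noteq> g v"
  let ?V = "\<Union>\<Delta>"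
  note V = finite_vertices_complex[OF sc] order_refl[of ?V]
  define c :: "'a set \<Rightarrow> 'k" where "c F = (if F = {u} then 1 else if F = {v} then - 1 else 0)" for F
  have single: "{u} \<in> \<Delta>" "{v} \<in> \<Delta>" using u v simplicial_complexD(4)[OF sc] by blast+
  then have "c \<in> chains \<Delta> 0" by (auto simp: c_def chains_def faces_of_dim_def face_dim_def)
  moreover have "bd ?V c H = 0" for H
  proof (cases "H = {}")
    case True
    have "(\<Sum>x\<in>?V. if x = u then 1 else if x = v then - 1 else (0 :: 'k)) =
        (\<Sum>x\<in>?V. (if x = u then 1 else 0) + (if x = v then - 1 else 0))"
      using uv by (intro sum.cong) auto
    also have "\<dots> = 0" using u v V(1) by (simp add: sum.distrib del: Union_iff)
    finally show ?thesis using True by (simp add: bd_def c_def vertex_sign_def cong: if_cong)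
  next
    case False
    then have "c (insert x H) = 0" if "x \<notin> H" for x using that by (auto simp: c_def)
    then show ?thesis by (simp add: bd_def)
  qed
  ultimately have "c \<in> boundaries \<Delta> 0" using ac by (auto simp: cycles_bd[OF sc V])
  then obtain w where w: "w \<in> chains \<Delta> 1" "c = boundary \<Delta> 1 w" by (auto simp: boundaries_def)
  then have cw: "c = bd ?V w" using boundary_eq_bd[OF sc V] by metis
  let ?\<chi> = "\<lambda>y. if g y = g u then 1 else (0 :: 'k)"
  have "(\<Sum>y\<in>?V. \<Sum>x\<in>?V - {y}. ?\<chi> y * (vertex_sign x {y} * w {x, y})) = 0"
  proof (rule sum_antisymmetric[OF V(1)])
    fix x y :: 'a assume xy: "x \<noteq> y"
    have "w {x, y} = 0 \<or> g x = g y"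
      using w(1) g by (auto simp: chains_def faces_of_dim_def)
    moreover have "(vertex_sign x {y} :: 'k) = - vertex_sign y {x}"
    proof -
      have empty: "vertex_sign a {} = (1 :: 'k)" for a :: 'a by (simp add: vertex_sign_def)
      show ?thesis using xy by (auto simp: vertex_sign_insert empty)
    qed
    ultimately show "?\<chi> x * (vertex_sign y {x} * w {y, x}) =
        - (?\<chi> y * (vertex_sign x {y} * w {x, y}))"
      by (auto simp: insert_commute)
  qed
  also have "(\<Sum>y\<in>?V. \<Sum>x\<in>?V - {y}. ?\<chi> y * (vertex_sign x {y} * w {x, y})) =
      (\<Sum>y\<in>?V. ?\<chi> y * c {y})"
    unfolding cw bd_def by (simp add: sum_distrib_left)
  also have "\<dots> = (\<Sum>y\<in>?V. if y = u then 1 else 0)"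
    using uv by (intro sum.cong) (auto simp: c_def)
  also have "\<dots> = 1" using u V(1) by (simp del: Union_iff)
  finally show False by simp
qed

lemma cohen_macaulay_constant_label:
  fixes k :: "'k::field itself"
  assumes cm: "cohen_macaulay k \<Delta>" and dim: "\<forall>F\<in>facets \<Delta>. 2 \<le> card F"
    and g: "\<And>a b. {a, b} \<in> \<Delta> \<Longrightarrow> g a = g b" and uv: "u \<in> \<Union>\<Delta>" "v \<in> \<Union>\<Delta>"
  shows "g u = g v"
proof -
  have pure: "pure_complex \<Delta>" and
    van: "\<And>F i. F \<in> \<Delta> \<Longrightarrow> i < complex_dim (link \<Delta> F) \<Longrightarrow>
      trivial_group (reduced_homology k (link \<Delta> F) i)"
    using cm unfolding cohen_macaulay_def by blast+
  have sc: "simplicial_complex \<Delta>" by (rule pure_complexD[OF pure])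
  obtain d where d: "\<forall>F\<in>facets \<Delta>. card F = d" using pure unfolding pure_complex_iff by blast
  then have "2 \<le> d" using dim facets_nonempty[OF sc] by auto
  then have "0 < complex_dim (link \<Delta> {})" using complex_dim_eq[OF sc d] by simp
  then have "trivial_group (reduced_homology k \<Delta> 0)"
    using van[OF simplicial_complexD(2)[OF sc]] by simp
  then have "cycles \<Delta> 0 \<subseteq> (boundaries \<Delta> 0 :: (_ \<Rightarrow> 'k) set)"
    unfolding trivial_reduced_homology_iff[OF sc] .
  then show ?thesis by (rule acyclic_constant_label[where g = g, OF sc _ g uv])
qed

lemma cohen_macaulay_link:
  assumes "cohen_macaulay k \<Delta>" "F \<in> \<Delta>"
  shows "cohen_macaulay k (link \<Delta> F)"
proof -
  have pure: "pure_complex \<Delta>" and sc: "simplicial_complex \<Delta>"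
    using assms(1) pure_complexD unfolding cohen_macaulay_def by blast+
  have "link (link \<Delta> F) H = link \<Delta> (F \<union> H)" "F \<union> H \<in> \<Delta>" if "H \<in> link \<Delta> F" for H
    using that link_link[OF sc] by (auto simp: link_def)
  then show ?thesis
    using assms(1) pure_complex_link[OF pure assms(2)] unfolding cohen_macaulay_def by simp
qed

section \<open>The Euler characteristic of a vertex decomposable complex\<close>

definition euler :: "'a set set \<Rightarrow> int" where
  "euler \<Delta> = (\<Sum>F\<in>\<Delta>. (- 1) ^ card F)"

lemma euler_link_deletion:
  assumes sc: "simplicial_complex \<Delta>"
  shows "euler \<Delta> = euler (deletion \<Delta> {x}) - euler (link \<Delta> {x})"
proof -
  let ?L = "link \<Delta> {x}" and ?D = "deletion \<Delta> {x}"
  have fin: "finite ?L" "finite ?D" using simplicial_complexD(1)[OF sc] by (simp_all add: link_def deletion_def)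
  have "\<Delta> = ?D \<union> insert x ` ?L"
  proof (intro equalityI subsetI)
    fix F assume F: "F \<in> \<Delta>"
    show "F \<in> ?D \<union> insert x ` ?L"
    proof (cases "x \<in> F")
      case True
      then have "F = insert x (F - {x})" "F - {x} \<in> ?L"
        using F simplicial_complexD(4)[OF sc F, of "F - {x}"] by (auto simp: link_def insert_absorb)
      then show ?thesis by blast
    qed (use F in \<open>simp add: deletion_def\<close>)
  qed (auto simp: link_def deletion_def)
  then have "euler \<Delta> = sum (\<lambda>F. (- 1) ^ card F) (?D \<union> insert x ` ?L)"
    by (simp add: euler_def)
  also have "\<dots> = euler ?D + (\<Sum>F\<in>insert x ` ?L. (- 1) ^ card F)"
    unfolding euler_def by (rule sum.union_disjoint) (use fin in \<open>auto simp: deletion_def\<close>)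
  also have "(\<Sum>F\<in>insert x ` ?L. (- 1 :: int) ^ card F) = (\<Sum>F\<in>?L. (- 1) ^ card (insert x F))"
    by (subst sum.reindex) (auto simp: link_def inj_on_def)
  also have "\<dots> = (\<Sum>F\<in>?L. - ((- 1) ^ card F))"
    using simplicial_complexD(3)[OF sc] by (intro sum.cong) (auto simp: link_def)
  also have "\<dots> = - euler ?L" by (simp add: euler_def sum_negf)
  finally show ?thesis by simp
qed

lemma euler_simplex:
  assumes sc: "simplicial_complex \<Delta>" and facets: "facets \<Delta> = {\<Union>\<Delta>}" and x: "x \<in> \<Union>\<Delta>"
  shows "euler \<Delta> = 0"
proof -
  have "{x} \<in> \<Delta>" using x simplicial_complexD(4)[OF sc] by blast
  then have "deletion \<Delta> {x} = link \<Delta> {x}"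
    using facet_avoiding_or_cone[OF sc, of x] facets x by auto
  then show ?thesis using euler_link_deletion[OF sc, of x] by simp
qed

text \<open>Signed so as to be positive on a sphere, the reduced Euler characteristic adds up over link
  and deletion, and a cone contributes nothing; so it is nonnegative throughout.\<close>

lemma vertex_decomposable_euler:
  assumes "vertex_decomposable \<Delta>" "\<forall>F\<in>facets \<Delta>. card F = d"
  shows "0 \<le> (- 1) ^ d * euler \<Delta>"
  using assms
proof (induction arbitrary: d rule: vertex_decomposable.induct)
  case (simplex \<Delta>)
  have sc: "simplicial_complex \<Delta>" using simplex.hyps(1) by (rule pure_complexD)
  show ?case
  proof (cases "\<Union>\<Delta> = {}")
    case True
    then have "\<Delta> = {{}}" using simplicial_complexD(2)[OF sc] by blast
    then show ?thesis using simplex by (simp add: euler_def)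
  next
    case False
    then obtain x where "x \<in> \<Union>\<Delta>" by blast
    then show ?thesis using euler_simplex[OF sc simplex.hyps(2)] by simp
  qed
next
  case (shed \<Delta> x)
  have sc: "simplicial_complex \<Delta>" using shed.hyps(1) by (rule pure_complexD)
  have x: "{x} \<in> \<Delta>" using shed.hyps(2) simplicial_complexD(4)[OF sc] by blast
  consider G where "G \<in> facets \<Delta>" "x \<notin> G" | "deletion \<Delta> {x} = link \<Delta> {x}"
    using facet_avoiding_or_cone[OF sc x] by blast
  then show ?case
  proof cases
    case 1
    obtain e where e: "\<forall>F\<in>facets (deletion \<Delta> {x}). card F = e"
      using vertex_decomposable_pure[OF shed.hyps(4)] unfolding pure_complex_iff by blast
    then have "e = d" using facet_deletion[OF 1] 1(1) shed.prems by auto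
    then have "0 \<le> (- 1) ^ d * euler (deletion \<Delta> {x})" using shed.IH(2) e by blast
    moreover have "0 \<le> (- 1) ^ (d - 1) * euler (link \<Delta> {x})"
      using shed.IH(1) card_facets_link[OF sc shed.prems x] by simp
    moreover obtain H where "H \<in> facets \<Delta>" "{x} \<subseteq> H" using face_subset_facet[OF sc x] .
    then have "d \<noteq> 0"
      using shed.prems simplicial_complexD(3)[OF sc, of H] facets_subset[of \<Delta>]
      by (metis card_eq_0_iff insert_subset empty_iff subsetD)
    then have "(- 1 :: int) ^ d = - ((- 1) ^ (d - 1))" by (cases d) auto
    ultimately show ?thesis by (simp add: euler_link_deletion[OF sc, of x] algebra_simps)
  next
    case 2
    then show ?thesis using euler_link_deletion[OF sc, of x] by simp
  qed
qed

text \<open>If every vertex link has a larger signed Euler characteristic than the complex, then every vertex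
  deletion has one of the wrong sign.\<close>

lemma not_vertex_decomposable_if_euler:
  assumes pure: "pure_complex \<Delta>" and d: "\<forall>F\<in>facets \<Delta>. card F = Suc d"
    and nonzero: "euler \<Delta> \<noteq> 0"
    and lk: "\<And>x. x \<in> \<Union>\<Delta> \<Longrightarrow> (- 1) ^ Suc d * euler \<Delta> < (- 1) ^ d * euler (link \<Delta> {x})"
  shows "\<not> vertex_decomposable \<Delta>"
proof
  have sc: "simplicial_complex \<Delta>" using pure by (rule pure_complexD)
  obtain G where "G \<in> facets \<Delta>" using facets_nonempty[OF sc] by blast
  then have ne: "\<Union>\<Delta> \<noteq> {}" using d facets_subset[of \<Delta>] by fastforce
  assume "vertex_decomposable \<Delta>"
  then show False
  proof cases
    case simplex
    then show False using euler_simplex[OF sc] ne nonzero by blast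
  next
    case (shed x)
    have x: "{x} \<in> \<Delta>" using shed(2) simplicial_complexD(4)[OF sc] by blast
    then obtain G where G: "G \<in> facets \<Delta>" "x \<notin> G"
      using facet_avoiding_or_cone[OF sc x] euler_link_deletion[OF sc, of x] nonzero by auto
    obtain e where e: "\<forall>F\<in>facets (deletion \<Delta> {x}). card F = e"
      using vertex_decomposable_pure[OF shed(4)] unfolding pure_complex_iff by blast
    then have "e = Suc d" using facet_deletion[OF G] G(1) d by auto
    then have "0 \<le> (- 1) ^ Suc d * euler (deletion \<Delta> {x})"
      using vertex_decomposable_euler[OF shed(4)] e by blast
    then show False
      using lk[OF shed(2)] by (simp add: euler_link_deletion[OF sc, of x] algebra_simps)
  qed
qed

section \<open>Images of complexes\<close>

abbreviation relabel :: "('a \<Rightarrow> 'b) \<Rightarrow> 'a set set \<Rightarrow> 'b set set" where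
  "relabel f \<Delta> \<equiv> (\<lambda>F. f ` F) ` \<Delta>"

context
  fixes f :: "'a \<Rightarrow> 'b"
  assumes f: "inj f"
begin

lemma relabel_mem: "f ` F \<in> relabel f \<Delta> \<longleftrightarrow> F \<in> \<Delta>"
  by (auto simp: inj_image_eq_iff[OF f])

lemma simplicial_complex_relabel:
  assumes "simplicial_complex \<Delta>"
  shows "simplicial_complex (relabel f \<Delta>)"
  unfolding simplicial_complex_def
proof (intro conjI ballI allI impI)
  show "H \<in> relabel f \<Delta>" if "F \<in> relabel f \<Delta>" "H \<subseteq> F" for F H
    using that simplicial_complexD(4)[OF assms] by (auto simp: subset_image_iff)
qed (use simplicial_complexD(1,2,3)[OF assms] in auto)

lemma facets_relabel: "facets (relabel f \<Delta>) = relabel f (facets \<Delta>)"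
proof -
  have *: "f ` F \<in> facets (relabel f \<Delta>) \<longleftrightarrow> F \<in> facets \<Delta>" for F
    unfolding facets_def mem_Collect_eq relabel_mem ball_simps inj_image_subset_iff[OF f]
      inj_image_eq_iff[OF f] by (rule refl)
  have "F \<in> relabel f (facets \<Delta>)" if F: "F \<in> facets (relabel f \<Delta>)" for F
  proof -
    obtain H where "F = f ` H" using F facets_subset by blast
    then show ?thesis using F * by blast
  qed
  then show ?thesis using * by blast
qed

lemma pure_complex_relabel:
  assumes "pure_complex \<Delta>"
  shows "pure_complex (relabel f \<Delta>)"
proof -
  obtain d where "\<forall>F\<in>facets \<Delta>. card F = d" using assms unfolding pure_complex_iff by blast
  then have "\<forall>F\<in>facets (relabel f \<Delta>). card F = d"
    using inj_on_subset[OF f] by (auto simp: facets_relabel card_image)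
  then show ?thesis
    using simplicial_complex_relabel[OF pure_complexD[OF assms]] unfolding pure_complex_iff by blast
qed

lemma link_relabel: "link (relabel f \<Delta>) (f ` F) = relabel f (link \<Delta> F)"
proof -
  have disjoint: "f ` F \<inter> f ` H = {} \<longleftrightarrow> F \<inter> H = {}" for H
    using f by (simp flip: image_Int)
  have *: "f ` H \<in> link (relabel f \<Delta>) (f ` F) \<longleftrightarrow> H \<in> link \<Delta> F" for H
    unfolding link_def mem_Collect_eq image_Un[symmetric] relabel_mem disjoint by (rule refl)
  have "link (relabel f \<Delta>) (f ` F) \<subseteq> relabel f \<Delta>" by (auto simp: link_def)
  then show ?thesis using * by blast
qed

lemma deletion_relabel: "deletion (relabel f \<Delta>) (f ` F) = relabel f (deletion \<Delta> F)"
  by (auto simp: deletion_def inj_image_subset_iff[OF f])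

lemma shelling_relabel: "shelling Fs \<Longrightarrow> shelling (map (\<lambda>F. f ` F) Fs)"
proof (induction Fs)
  case (Cons F Gs)
  have "\<exists>x\<in>f ` F - f ` H. \<exists>L\<in>set Gs. f ` F - f ` L = {x}" if H: "H \<in> set Gs" for H
  proof -
    obtain x L where "x \<in> F - H" "L \<in> set Gs" "F - L = {x}" using Cons.prems H by auto
    then show ?thesis
      using f by (intro bexI[of _ "f x"] bexI[of _ L]) (auto simp: inj_image_mem_iff simp flip: image_set_diff)
  qed
  then show ?case using Cons by simp
qed simp

lemma shellable_relabel:
  assumes "shellable \<Delta>"
  shows "shellable (relabel f \<Delta>)"
proof -
  obtain Fs where "distinct Fs" "set Fs = facets \<Delta>" "shelling Fs" "pure_complex \<Delta>"
    using assms by (auto simp: shellable_iff_shelling)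
  moreover from this have "distinct (map (\<lambda>F. f ` F) Fs)"
    using f by (auto simp: distinct_map inj_on_def inj_image_eq_iff)
  moreover have "set (map (\<lambda>F. f ` F) Fs) = relabel f (set Fs)" by simp
  ultimately show ?thesis
    unfolding shellable_iff_shelling facets_relabel
    by (metis pure_complex_relabel shelling_relabel)
qed

lemma vertex_decomposable_relabel:
  "vertex_decomposable \<Delta> \<Longrightarrow> vertex_decomposable (relabel f \<Delta>)"
proof (induction rule: vertex_decomposable.induct)
  case (simplex \<Delta>)
  then show ?case
    by (intro vertex_decomposable.simplex pure_complex_relabel) (auto simp: facets_relabel image_Union)
next
  case (shed \<Delta> x)
  show ?case
  proof (rule vertex_decomposable.shed)
    show "f x \<in> \<Union>(relabel f \<Delta>)" using shed.hyps(2) by blast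
    show "vertex_decomposable (link (relabel f \<Delta>) {f x})"
      using shed.IH(1) link_relabel[of \<Delta> "{x}"] by simp
    show "vertex_decomposable (deletion (relabel f \<Delta>) {f x})"
      using shed.IH(2) deletion_relabel[of \<Delta> "{x}"] by simp
  qed (rule pure_complex_relabel[OF shed.hyps(1)])
qed

end

lemma shellable_relabel_iff:
  assumes f: "bij f"
  shows "shellable (relabel f \<Delta>) \<longleftrightarrow> shellable \<Delta>"
proof -
  let ?g = "inv_into UNIV f"
  have "relabel ?g (relabel f \<Delta>) = \<Delta>"
    by (simp add: image_image inv_f_f[OF bij_is_inj[OF f]])
  moreover have "inj ?g" by (rule bij_is_inj[OF bij_imp_bij_inv[OF f]])
  ultimately show ?thesis
    using shellable_relabel[OF bij_is_inj[OF f]] shellable_relabel[of ?g "relabel f \<Delta>"] by auto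
qed

section \<open>Independence complexes given by an adjacency relation\<close>

definition independent_sets :: "('a \<Rightarrow> 'a \<Rightarrow> bool) \<Rightarrow> 'a set \<Rightarrow> 'a set set" where
  "independent_sets E A = {F. F \<subseteq> A \<and> (\<forall>a\<in>F. \<forall>b\<in>F. \<not> E a b)}"

locale adjacency =
  fixes E :: "'a \<Rightarrow> 'a \<Rightarrow> bool"
  assumes sym: "E a b \<Longrightarrow> E b a" and irrefl: "\<not> E a a"
begin

lemma simplicial_complex_independent_sets:
  assumes "finite A"
  shows "simplicial_complex (independent_sets E A)"
  unfolding simplicial_complex_def
proof (intro conjI ballI allI impI)
  show "finite (independent_sets E A)"
    by (rule finite_subset[of _ "Pow A"]) (use assms in \<open>auto simp: independent_sets_def\<close>)
  show "independent_sets E A \<noteq> {}" by (auto simp: independent_sets_def)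
  show "finite F" if "F \<in> independent_sets E A" for F
    using that assms finite_subset by (auto simp: independent_sets_def)
  show "H \<in> independent_sets E A" if "F \<in> independent_sets E A" "H \<subseteq> F" for F H
    using that by (auto simp: independent_sets_def)
qed

lemma singleton_independent: "{x} \<in> independent_sets E A \<longleftrightarrow> x \<in> A"
  by (auto simp: independent_sets_def irrefl)

lemma Union_independent_sets: "\<Union>(independent_sets E A) = A"
  using singleton_independent by (auto simp: independent_sets_def)

lemma edge_independent:
  assumes "a \<in> A" "b \<in> A"
  shows "{a, b} \<in> independent_sets E A \<longleftrightarrow> \<not> E a b"
  using assms sym irrefl by (auto simp: independent_sets_def)

lemma link_independent_sets:
  assumes "F \<in> independent_sets E A"
  shows "link (independent_sets E A) F = independent_sets E {a \<in> A - F. \<forall>b\<in>F. \<not> E b a}"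
  using assms sym unfolding link_def independent_sets_def by blast

lemma link_vertex:
  assumes "x \<in> A"
  shows "link (independent_sets E A) {x} = independent_sets E {a \<in> A - {x}. \<not> E x a}"
  using link_independent_sets[of "{x}" A] assms singleton_independent by simp

lemma deletion_vertex: "deletion (independent_sets E A) {x} = independent_sets E (A - {x})"
  by (auto simp: deletion_def independent_sets_def)

lemma facets_independent_sets:
  "F \<in> facets (independent_sets E A) \<longleftrightarrow>
    F \<in> independent_sets E A \<and> (\<forall>a\<in>A. a \<in> F \<or> (\<exists>b\<in>F. E a b))"
proof
  assume F: "F \<in> facets (independent_sets E A)"
  then have ind: "F \<in> independent_sets E A" using facets_subset by blast
  have "\<exists>b\<in>F. E a b" if a: "a \<in> A" "a \<notin> F" for a
  proof (rule ccontr)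
    assume "\<not> ?thesis"
    then have "insert a F \<in> independent_sets E A"
      using ind a(1) sym irrefl unfolding independent_sets_def by blast
    then have "insert a F = F" using F unfolding facets_def by blast
    then show False using a by blast
  qed
  with ind show "F \<in> independent_sets E A \<and> (\<forall>a\<in>A. a \<in> F \<or> (\<exists>b\<in>F. E a b))" by blast
next
  assume F: "F \<in> independent_sets E A \<and> (\<forall>a\<in>A. a \<in> F \<or> (\<exists>b\<in>F. E a b))"
  have "H = F" if "H \<in> independent_sets E A" "F \<subseteq> H" for H
    using that F unfolding independent_sets_def by blast
  with F show "F \<in> facets (independent_sets E A)" unfolding facets_def by blast
qed

lemma pure_size:
  assumes "finite A" "\<forall>F\<in>facets (independent_sets E A). card F = d"
  shows "pure_complex (independent_sets E A)"
  using assms simplicial_complex_independent_sets unfolding pure_complex_iff by blast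

text \<open>Consecutive facet sizes of link and deletion say that the vertex is no cone apex; every
  facet is then accounted for by one of the two.\<close>

lemma facets_of_link_deletion:
  assumes x: "x \<in> A"
    and lk: "\<forall>F\<in>facets (independent_sets E {a \<in> A - {x}. \<not> E x a}). card F = d"
    and dl: "\<forall>F\<in>facets (independent_sets E (A - {x})). card F = Suc d"
    and A: "finite A"
  shows "\<forall>F\<in>facets (independent_sets E A). card F = Suc d"
proof
  let ?I = "independent_sets E A"
  have sc: "simplicial_complex ?I" by (rule simplicial_complex_independent_sets[OF A])
  have xI: "{x} \<in> ?I" using x by (simp add: singleton_independent)
  fix F assume F: "F \<in> facets ?I"
  show "card F = Suc d"
  proof (cases "x \<in> F")
    case True
    then have "F - {x} \<in> facets (link ?I {x})"
      using F facets_link[OF sc xI] by auto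
    then have "card (F - {x}) = d" using lk link_vertex[OF x] by simp
    moreover have "finite F" using F facets_subset simplicial_complexD(3)[OF sc] by blast
    ultimately show ?thesis using True card_Suc_Diff1 by metis
  next
    case False
    then show ?thesis using facet_deletion[OF F] dl deletion_vertex by simp
  qed
qed

end

section \<open>Executable tests\<close>

text \<open>Vertex sets are given as distinct lists.  The greedy procedure sheds a neighbour of largest
  degree of a vertex of least positive degree and returns the size of the facets when it succeeds.
  Any other choice of the vertex would be sound as well; this one works for a representative of
  every vertex decomposable circulant graph on fewer than sixteen vertices.  The first argument of
  \<open>greedy_shedding\<close> bounds the depth of the recursion.\<close>

definition positive_degrees :: "('a \<Rightarrow> 'a \<Rightarrow> bool) \<Rightarrow> 'a list \<Rightarrow> ('a \<times> nat) list" where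
  "positive_degrees E xs =
     filter (\<lambda>p. 0 < snd p) (map (\<lambda>x. (x, length (filter (E x) xs))) xs)"

definition greedy_choice :: "('a \<Rightarrow> 'a \<Rightarrow> bool) \<Rightarrow> ('a \<times> nat) list \<Rightarrow> 'a" where
  "greedy_choice E ds =
     (let u = fst (arg_min_list snd ds)
      in fst (arg_min_list (\<lambda>p. - int (snd p)) (filter (\<lambda>p. E u (fst p)) ds)))"

primrec greedy_shedding :: "'b list \<Rightarrow> ('a \<Rightarrow> 'a \<Rightarrow> bool) \<Rightarrow> 'a list \<Rightarrow> nat option" where
  "greedy_shedding [] E xs = None"
| "greedy_shedding (k # ks) E xs =
     (let ds = positive_degrees E xs in
      if ds = [] then Some (length xs)
      else let x = greedy_choice E ds; ys = filter (\<lambda>y. y \<noteq> x) xs in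
        if x \<notin> set xs then None
        else case greedy_shedding ks E (filter (\<lambda>y. \<not> E x y) ys) of
          None \<Rightarrow> None
        | Some d \<Rightarrow> if greedy_shedding ks E ys = Some (Suc d) then Some (Suc d) else None)"

primrec first_fit :: "('a \<Rightarrow> 'a \<Rightarrow> bool) \<Rightarrow> 'a list \<Rightarrow> 'a list \<Rightarrow> 'a list" where
  "first_fit E F [] = F"
| "first_fit E F (x # xs) =
     first_fit E (if x \<in> set F \<or> list_ex (E x) F then F else x # F) xs"

primrec first_fit_differs :: "('a \<Rightarrow> 'a \<Rightarrow> bool) \<Rightarrow> nat \<Rightarrow> 'a list list \<Rightarrow> bool" where
  "first_fit_differs E d [] \<longleftrightarrow> False"
| "first_fit_differs E d (xs # xss) \<longleftrightarrow>
     (if length (first_fit E [] xs) \<noteq> d then True else first_fit_differs E d xss)"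

text \<open>Moving two vertices to the front of the order already produces maximal independent sets of
  different sizes in the graphs that are not well-covered and matter here.\<close>

definition visibly_mixed :: "('a \<Rightarrow> 'a \<Rightarrow> bool) \<Rightarrow> 'a list \<Rightarrow> bool" where
  "visibly_mixed E xs =
     first_fit_differs E (length (first_fit E [] xs)) [a # b # xs. a \<leftarrow> xs, b \<leftarrow> xs]"

fun independent_lists :: "('a \<Rightarrow> 'a \<Rightarrow> bool) \<Rightarrow> 'a list \<Rightarrow> 'a list list" where
  "independent_lists E [] = [[]]"
| "independent_lists E (x # xs) =
     independent_lists E xs @ map ((#) x) (independent_lists E (filter (\<lambda>y. \<not> E x y) xs))"

definition facet_lists :: "('a \<Rightarrow> 'a \<Rightarrow> bool) \<Rightarrow> 'a list \<Rightarrow> 'a list list" where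
  "facet_lists E xs =
     filter (\<lambda>F. list_all (\<lambda>x. x \<in> set F \<or> list_ex (E x) F) xs) (independent_lists E xs)"

fun euler_list :: "('a \<Rightarrow> 'a \<Rightarrow> bool) \<Rightarrow> 'a list \<Rightarrow> int" where
  "euler_list E [] = 1"
| "euler_list E (x # xs) = euler_list E xs - euler_list E (filter (\<lambda>y. \<not> E x y) xs)"

definition link_list :: "('a \<Rightarrow> 'a \<Rightarrow> bool) \<Rightarrow> 'a list \<Rightarrow> 'a list \<Rightarrow> 'a list" where
  "link_list E xs F = filter (\<lambda>y. y \<notin> set F \<and> list_all (\<lambda>b. \<not> E b y) F) xs"

definition independent_list :: "('a \<Rightarrow> 'a \<Rightarrow> bool) \<Rightarrow> 'a list \<Rightarrow> 'a list \<Rightarrow> bool" where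
  "independent_list E xs F \<longleftrightarrow> distinct F \<and> list_all (\<lambda>a. a \<in> set xs \<and> list_all (\<lambda>b. \<not> E a b) F) F"

text \<open>In the link of \<open>F\<close>, which contains the edge or larger face \<open>T\<close>, the vertices of \<open>C\<close> are
  separated from the others.\<close>

definition split_link :: "('a \<Rightarrow> 'a \<Rightarrow> bool) \<Rightarrow> 'a list \<Rightarrow> 'a list \<Rightarrow> 'a list \<Rightarrow> 'a list \<Rightarrow> bool" where
  "split_link E xs F T C \<longleftrightarrow>
     (let ys = link_list E xs F; zs = filter (\<lambda>y. y \<notin> set C) ys in
      independent_list E xs F \<and> independent_list E ys T \<and> 2 \<le> length T \<and>
      list_all (\<lambda>c. c \<in> set ys) C \<and> C \<noteq> [] \<and> zs \<noteq> [] \<and> list_all (\<lambda>c. list_all (E c) zs) C)"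

context adjacency
begin

lemma greedy_shedding_sound:
  assumes "greedy_shedding ks E xs = Some d" "distinct xs"
  shows "vertex_decomposable (independent_sets E (set xs)) \<and>
    (\<forall>F\<in>facets (independent_sets E (set xs)). card F = d)"
  using assms
proof (induction ks arbitrary: xs d)
  case (Cons k ks)
  let ?I = "independent_sets E (set xs)"
  let ?ds = "positive_degrees E xs"
  show ?case
  proof (cases "?ds = []")
    case True
    then have d: "d = length xs" using Cons.prems(1) by simp
    have "\<not> E a b" if "a \<in> set xs" "b \<in> set xs" for a b
      using True that by (auto simp: positive_degrees_def filter_empty_conv)
    then have I: "?I = Pow (set xs)" by (auto simp: independent_sets_def)
    then have facets: "facets ?I = {\<Union>?I}" by (auto simp: facets_def)
    have size: "\<forall>F\<in>facets ?I. card F = d"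
      using facets I d distinct_card[OF Cons.prems(2)] by simp
    have "pure_complex ?I" by (rule pure_size[OF _ size]) simp
    then show ?thesis using vertex_decomposable.simplex[OF _ facets] size by blast
  next
    case False
    define x where "x = greedy_choice E ?ds"
    define ys where "ys = filter (\<lambda>y. y \<noteq> x) xs"
    define zs where "zs = filter (\<lambda>y. \<not> E x y) ys"
    have eq: "greedy_shedding (k # ks) E xs = (if x \<notin> set xs then None
        else case greedy_shedding ks E zs of None \<Rightarrow> None
          | Some d \<Rightarrow> if greedy_shedding ks E ys = Some (Suc d) then Some (Suc d) else None)"
      using False by (simp only: greedy_shedding.simps Let_def if_False x_def ys_def zs_def)
    then have x: "x \<in> set xs" using Cons.prems(1) by (auto split: if_splits)
    obtain e where e: "greedy_shedding ks E zs = Some e" "greedy_shedding ks E ys = Some (Suc e)" "d = Suc e"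
      using Cons.prems(1) eq by (auto split: if_splits option.splits)
    have dist: "distinct ys" "distinct zs" using Cons.prems(2) by (simp_all add: ys_def zs_def)
    have zs: "set zs = {a \<in> set xs - {x}. \<not> E x a}" and ys: "set ys = set xs - {x}"
      by (auto simp: ys_def zs_def)
    note lk = Cons.IH[OF e(1) dist(2), unfolded zs]
    note dl = Cons.IH[OF e(2) dist(1), unfolded ys]
    have size: "\<forall>F\<in>facets ?I. card F = d"
      unfolding e(3) by (rule facets_of_link_deletion[OF x]) (use lk dl in blast)+
    moreover have "vertex_decomposable ?I"
    proof (rule vertex_decomposable.shed)
      show "pure_complex ?I" by (rule pure_size[OF _ size]) simp
      show "x \<in> \<Union>?I" using x by (simp add: Union_independent_sets del: Union_iff)
      show "vertex_decomposable (link ?I {x})" using lk by (simp add: link_vertex[OF x])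
      show "vertex_decomposable (deletion ?I {x})" using dl by (simp add: deletion_vertex)
    qed
    ultimately show ?thesis by blast
  qed
qed simp

lemma first_fit_maximal:
  assumes "set F \<in> independent_sets E A" "set xs \<subseteq> A" "distinct F"
  shows "set (first_fit E F xs) \<in> independent_sets E A \<and> distinct (first_fit E F xs) \<and>
    set F \<subseteq> set (first_fit E F xs) \<and>
    (\<forall>x\<in>set xs. x \<in> set (first_fit E F xs) \<or> (\<exists>b\<in>set (first_fit E F xs). E x b))"
  using assms
proof (induction xs arbitrary: F)
  case (Cons x xs)
  let ?F = "if x \<in> set F \<or> list_ex (E x) F then F else x # F"
  have "set ?F \<in> independent_sets E A" "distinct ?F"
    using Cons.prems sym irrefl by (auto simp: independent_sets_def list_ex_iff)
  note IH = Cons.IH[OF this(1) _ this(2)]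
  have "x \<in> set ?F \<or> (\<exists>b\<in>set ?F. E x b)" "set F \<subseteq> set ?F"
    by (auto simp: list_ex_iff)
  then show ?case using IH Cons.prems(2) unfolding first_fit.simps by (auto 0 4)
qed simp

lemma visibly_mixed_sound:
  assumes "visibly_mixed E xs"
  shows "\<not> pure_complex (independent_sets E (set xs))"
proof
  let ?I = "independent_sets E (set xs)"
  assume "pure_complex ?I"
  then obtain d where d: "\<forall>F\<in>facets ?I. card F = d" unfolding pure_complex_iff by blast
  have size: "length (first_fit E [] os) = d" if "set os = set xs" for os
  proof -
    have "set [] \<in> ?I" by (simp add: independent_sets_def)
    then have "set (first_fit E [] os) \<in> facets ?I" "distinct (first_fit E [] os)"
      using first_fit_maximal[of "[]" "set xs" os] that
      by (simp_all add: facets_independent_sets)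
    then show ?thesis using d distinct_card by metis
  qed
  have "\<not> first_fit_differs E d oss" if "\<forall>os\<in>set oss. set os = set xs" for oss
    using that by (induction oss) (auto simp: size)
  moreover have "\<forall>os\<in>set [a # b # xs. a \<leftarrow> xs, b \<leftarrow> xs]. set os = set xs" by auto
  ultimately show False using assms unfolding visibly_mixed_def size[OF refl] by blast
qed

lemma independent_sets_insert:
  "independent_sets E (insert x A) =
    independent_sets E A \<union> insert x ` independent_sets E {a \<in> A. \<not> E x a}"
proof (intro equalityI subsetI)
  fix F assume F: "F \<in> independent_sets E (insert x A)"
  show "F \<in> independent_sets E A \<union> insert x ` independent_sets E {a \<in> A. \<not> E x a}"
  proof (cases "x \<in> F")
    case True
    then have "F = insert x (F - {x})" "F - {x} \<in> independent_sets E {a \<in> A. \<not> E x a}"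
      using F by (auto simp: independent_sets_def)
    then show ?thesis by blast
  qed (use F in \<open>auto simp: independent_sets_def\<close>)
next
  fix F assume "F \<in> independent_sets E A \<union> insert x ` independent_sets E {a \<in> A. \<not> E x a}"
  then show "F \<in> independent_sets E (insert x A)"
    using sym irrefl by (auto simp: independent_sets_def)
qed

lemma set_filter_nonadjacent: "set (filter (\<lambda>y. \<not> E x y) xs) = {a \<in> set xs. \<not> E x a}"
  by auto

lemma independent_lists_sound:
  "set (map set (independent_lists E xs)) = independent_sets E (set xs)"
proof (induction xs rule: length_induct)
  case (1 xs)
  show ?case
  proof (cases xs)
    case Nil
    then show ?thesis by (auto simp: independent_sets_def)
  next
    case (Cons x ys)
    let ?zs = "filter (\<lambda>y. \<not> E x y) ys"
    have "length ys < length xs" "length ?zs < length xs"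
      using Cons by (auto simp: le_imp_less_Suc)
    then have IH: "set (map set (independent_lists E ys)) = independent_sets E (set ys)"
      "set (map set (independent_lists E ?zs)) = independent_sets E (set ?zs)"
      using 1 by blast+
    have "set (map set (independent_lists E xs)) =
        set (map set (independent_lists E ys)) \<union> insert x ` set (map set (independent_lists E ?zs))"
      unfolding Cons by (simp add: image_image image_Un)
    also have "\<dots> = independent_sets E (set xs)"
      unfolding IH Cons list.set independent_sets_insert set_filter_nonadjacent ..
    finally show ?thesis .
  qed
qed

lemma independent_lists_distinct:
  "distinct xs \<Longrightarrow> F \<in> set (independent_lists E xs) \<Longrightarrow> distinct F \<and> set F \<subseteq> set xs"
proof (induction xs arbitrary: F rule: length_induct)
  case (1 xs)
  show ?case
  proof (cases xs)
    case Nil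
    then show ?thesis using 1 by simp
  next
    case (Cons x ys)
    let ?zs = "filter (\<lambda>y. \<not> E x y) ys"
    have "length ys < length xs" "length ?zs < length xs"
      using Cons by (auto simp: le_imp_less_Suc)
    moreover have "distinct ys" "distinct ?zs" "x \<notin> set ys" using 1(2) Cons by auto
    ultimately have IH: "\<And>G. G \<in> set (independent_lists E ys) \<Longrightarrow> distinct G \<and> set G \<subseteq> set ys"
      "\<And>G. G \<in> set (independent_lists E ?zs) \<Longrightarrow> distinct G \<and> set G \<subseteq> set ?zs"
      using 1(1) by blast+
    consider "F \<in> set (independent_lists E ys)"
      | G where "F = x # G" "G \<in> set (independent_lists E ?zs)"
      using 1(3) Cons by auto
    then show ?thesis
    proof cases
      case 1
      then show ?thesis using IH(1) Cons by fastforce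
    next
      case 2
      then show ?thesis using IH(2)[of G] Cons \<open>x \<notin> set ys\<close> by auto
    qed
  qed
qed

lemma facet_lists_sound:
  "set (map set (facet_lists E xs)) = facets (independent_sets E (set xs))"
proof -
  have "F \<in> facets (independent_sets E (set xs)) \<longleftrightarrow>
      F \<in> set ` set (independent_lists E xs) \<and> (\<forall>a\<in>set xs. a \<in> F \<or> (\<exists>b\<in>F. E a b))" for F
    using facets_independent_sets[of F "set xs"] independent_lists_sound[of xs] by simp
  then show ?thesis
    by (auto simp: facet_lists_def list_all_iff list_ex_iff)
qed

lemma facet_lists_size:
  assumes "list_all (\<lambda>F. length F = d) (facet_lists E xs)" "distinct xs"
  shows "\<forall>F\<in>facets (independent_sets E (set xs)). card F = d"
proof
  fix F assume "F \<in> facets (independent_sets E (set xs))"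
  then obtain G where "G \<in> set (facet_lists E xs)" "F = set G"
    unfolding facet_lists_sound[symmetric] by auto
  then show "card F = d"
    using assms independent_lists_distinct[OF assms(2)]
    by (auto simp: list_all_iff facet_lists_def distinct_card)
qed

lemma euler_list_sound: "distinct xs \<Longrightarrow> euler (independent_sets E (set xs)) = euler_list E xs"
proof (induction xs rule: length_induct)
  case (1 xs)
  show ?case
  proof (cases xs)
    case Nil
    then have "independent_sets E (set xs) = {{}}" by (auto simp: independent_sets_def)
    then show ?thesis using Nil by (simp add: euler_def)
  next
    case (Cons x ys)
    let ?zs = "filter (\<lambda>y. \<not> E x y) ys"
    have "length ys < length xs" "length ?zs < length xs"
      using Cons by (auto simp: le_imp_less_Suc)
    moreover have dist: "distinct ys" "distinct ?zs" "x \<notin> set ys" using 1(2) Cons by auto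
    ultimately have IH: "euler (independent_sets E (set ys)) = euler_list E ys"
      "euler (independent_sets E (set ?zs)) = euler_list E ?zs"
      using 1(1) by blast+
    have "set xs - {x} = set ys" "{a \<in> set xs - {x}. \<not> E x a} = set ?zs" "x \<in> set xs"
      using Cons dist(3) by auto
    then show ?thesis
      using euler_link_deletion[OF simplicial_complex_independent_sets, of "set xs" x] IH Cons
      by (simp add: link_vertex deletion_vertex)
  qed
qed

lemma set_link_list: "set (link_list E xs F) = {a \<in> set xs - set F. \<forall>b\<in>set F. \<not> E b a}"
  by (auto simp: link_list_def list_all_iff)

lemma independent_list_sound:
  "independent_list E xs F \<longleftrightarrow> distinct F \<and> set F \<in> independent_sets E (set xs)"
  by (auto simp: independent_list_def independent_sets_def list_all_iff)

lemma link_list_sound: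
  assumes "independent_list E xs F"
  shows "link (independent_sets E (set xs)) (set F) = independent_sets E (set (link_list E xs F))"
  using assms unfolding independent_list_sound set_link_list by (intro link_independent_sets) blast

text \<open>In a pure complex one face of the link bounds the size of all its facets from below.\<close>

lemma link_facets_size:
  assumes pure: "pure_complex (independent_sets E (set xs))" and F: "independent_list E xs F"
    and T: "independent_list E (link_list E xs F) T" "m \<le> length T"
  shows "\<forall>G\<in>facets (link (independent_sets E (set xs)) (set F)). m \<le> card G"
proof
  let ?L = "link (independent_sets E (set xs)) (set F)"
  have FI: "set F \<in> independent_sets E (set xs)" using F by (simp add: independent_list_sound)
  have pL: "pure_complex ?L" by (rule pure_complex_link[OF pure FI])
  then obtain d where d: "\<forall>G\<in>facets ?L. card G = d" unfolding pure_complex_iff by blast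
  have "set T \<in> ?L" using T(1) by (simp add: link_list_sound[OF F] independent_list_sound)
  then obtain G where G: "G \<in> facets ?L" "set T \<subseteq> G"
    using face_subset_facet[OF pure_complexD[OF pL]] by metis
  have "finite G" using G(1) facets_subset simplicial_complexD(3)[OF pure_complexD[OF pL]] by blast
  then have "card (set T) \<le> d" using G d card_mono by metis
  moreover have "card (set T) = length T"
    using T(1) by (simp add: independent_list_sound distinct_card)
  ultimately have "m \<le> d" using T(2) by simp
  then show "m \<le> card H" if "H \<in> facets ?L" for H using d that by simp
qed

lemma split_link_label:
  assumes pure: "pure_complex (independent_sets E (set xs))" and split: "split_link E xs F T C"
  defines "L \<equiv> link (independent_sets E (set xs)) (set F)"
  obtains u v where "set F \<in> independent_sets E (set xs)" "\<forall>G\<in>facets L. 2 \<le> card G"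
    "\<And>a b. {a, b} \<in> L \<Longrightarrow> (a \<in> set C) = (b \<in> set C)" "u \<in> \<Union>L" "v \<in> \<Union>L"
    "(u \<in> set C) \<noteq> (v \<in> set C)"
proof -
  let ?ys = "link_list E xs F"
  have F: "independent_list E xs F" and T: "independent_list E ?ys T" "2 \<le> length T"
    and C: "set C \<subseteq> set ?ys" "C \<noteq> []"
    and zs: "filter (\<lambda>y. y \<notin> set C) ?ys \<noteq> []"
    and all: "\<And>c y. c \<in> set C \<Longrightarrow> y \<in> set ?ys \<Longrightarrow> y \<notin> set C \<Longrightarrow> E c y"
    using split by (auto simp: split_link_def Let_def list_all_iff)
  obtain v where v: "v \<in> set ?ys" "v \<notin> set C" using zs by (auto simp: filter_empty_conv)
  obtain u where u: "u \<in> set C" using C(2) by (cases C) auto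
  have L: "L = independent_sets E (set ?ys)" unfolding L_def by (rule link_list_sound[OF F])
  show thesis
  proof (rule that)
    show "set F \<in> independent_sets E (set xs)" using F by (simp add: independent_list_sound)
    show "\<forall>G\<in>facets L. 2 \<le> card G" unfolding L_def by (rule link_facets_size[OF pure F T])
    show "(a \<in> set C) = (b \<in> set C)" if "{a, b} \<in> L" for a b
    proof -
      have "a \<in> set ?ys" "b \<in> set ?ys" "\<not> E a b" "\<not> E b a"
        using that by (auto simp: L independent_sets_def)
      then show ?thesis using all by blast
    qed
    show "u \<in> \<Union>L" "v \<in> \<Union>L" unfolding L Union_independent_sets using u v C by auto
    show "(u \<in> set C) \<noteq> (v \<in> set C)" using u v by simp
  qed
qed

lemma split_link_not_shellable:
  assumes "split_link E xs F T C"
  shows "\<not> shellable (independent_sets E (set xs))"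
proof
  let ?I = "independent_sets E (set xs)"
  assume sh: "shellable ?I"
  then have "pure_complex ?I" by (simp add: shellable_def)
  then obtain u v where *: "set F \<in> ?I" "\<forall>G\<in>facets (link ?I (set F)). 2 \<le> card G"
    "\<And>a b. {a, b} \<in> link ?I (set F) \<Longrightarrow> (a \<in> set C) = (b \<in> set C)"
    "u \<in> \<Union>(link ?I (set F))" "v \<in> \<Union>(link ?I (set F))" "(u \<in> set C) \<noteq> (v \<in> set C)"
    using split_link_label[OF _ assms] by blast
  have "(u \<in> set C) = (v \<in> set C)"
    by (rule shellable_constant_label[where g = "\<lambda>a. a \<in> set C",
          OF shellable_link[OF sh *(1)] *(2,3,4,5)])
  then show False using *(6) by blast
qed

end

lemma split_link_not_cohen_macaulay:
  fixes E :: "'a::linorder \<Rightarrow> 'a \<Rightarrow> bool"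
  assumes "adjacency E" and split: "split_link E xs F T C"
  shows "\<not> cohen_macaulay k (independent_sets E (set xs))"
proof
  interpret adjacency E by fact
  let ?I = "independent_sets E (set xs)"
  assume cm: "cohen_macaulay k ?I"
  then have "pure_complex ?I" unfolding cohen_macaulay_def by blast
  then obtain u v where *: "set F \<in> ?I" "\<forall>G\<in>facets (link ?I (set F)). 2 \<le> card G"
    "\<And>a b. {a, b} \<in> link ?I (set F) \<Longrightarrow> (a \<in> set C) = (b \<in> set C)"
    "u \<in> \<Union>(link ?I (set F))" "v \<in> \<Union>(link ?I (set F))" "(u \<in> set C) \<noteq> (v \<in> set C)"
    using split_link_label[OF _ split] by blast
  have "(u \<in> set C) = (v \<in> set C)"
    by (rule cohen_macaulay_constant_label[where g = "\<lambda>a. a \<in> set C",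
          OF cohen_macaulay_link[OF cm *(1)] *(2,3,4,5)])
  then show False using *(6) by blast
qed

text \<open>A Buchsbaum complex is locally Cohen-Macaulay, so the obstruction may sit in the link of
  any vertex.\<close>

lemma split_link_not_buchsbaum:
  fixes E :: "'a::linorder \<Rightarrow> 'a \<Rightarrow> bool"
  assumes "adjacency E" and x: "x \<in> set xs" and split: "split_link E (link_list E xs [x]) F T C"
  shows "\<not> buchsbaum k (independent_sets E (set xs))"
proof
  interpret adjacency E by fact
  assume "buchsbaum k (independent_sets E (set xs))"
  then have "cohen_macaulay k (link (independent_sets E (set xs)) {x})"
    using x by (simp add: buchsbaum_def Union_independent_sets del: Union_iff)
  moreover have "link (independent_sets E (set xs)) {x} = independent_sets E (set (link_list E xs [x]))"
    using link_list_sound[of xs "[x]"] x by (simp add: independent_list_sound singleton_independent)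
  ultimately show False using split_link_not_cohen_macaulay[OF assms(1) split, of k] by simp
qed

section \<open>Circulant graphs\<close>

definition circulant_adj :: "nat \<Rightarrow> nat list \<Rightarrow> nat \<Rightarrow> nat \<Rightarrow> bool" where
  "circulant_adj n ss a b \<longleftrightarrow> a \<noteq> b \<and>
     (let d = (if a < b then b - a else a - b) in d \<in> set ss \<or> n - d \<in> set ss)"

lemma adjacency_circulant: "adjacency (circulant_adj n ss)"
  by unfold_locales (auto simp: circulant_adj_def Let_def)

lemma edge_circulant:
  assumes "a < n" "b < n"
  shows "{a, b} \<in> edges (circulant n (set ss)) \<longleftrightarrow> circulant_adj n ss a b"
proof -
  let ?Q = "\<lambda>a b. a \<noteq> b \<and> (nat \<bar>int a - int b\<bar> \<in> set ss \<or> n - nat \<bar>int a - int b\<bar> \<in> set ss)"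
  have abs: "nat \<bar>int a - int b\<bar> = (if a < b then b - a else a - b)" for a b by auto
  have "?Q a b \<longleftrightarrow> ?Q b a" for a b by (auto simp: abs_minus_commute)
  then have "{a, b} \<in> edges (circulant n (set ss)) \<longleftrightarrow> ?Q a b"
    using assms by (auto simp: circulant_def doubleton_eq_iff)
  then show ?thesis unfolding abs by (simp add: circulant_adj_def Let_def)
qed

lemma indep_complex_circulant:
  "indep_complex (circulant n (set ss)) = independent_sets (circulant_adj n ss) (set [0..<n])"
proof -
  interpret adjacency "circulant_adj n ss" by (rule adjacency_circulant)
  have "(\<forall>e\<in>edges (circulant n (set ss)). \<not> e \<subseteq> F) \<longleftrightarrow>
      (\<forall>a\<in>F. \<forall>b\<in>F. \<not> circulant_adj n ss a b)" if F: "F \<subseteq> {0..<n}" for F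
  proof
    assume *: "\<forall>e\<in>edges (circulant n (set ss)). \<not> e \<subseteq> F"
    show "\<forall>a\<in>F. \<forall>b\<in>F. \<not> circulant_adj n ss a b"
    proof (intro ballI notI)
      fix a b assume ab: "a \<in> F" "b \<in> F" "circulant_adj n ss a b"
      then have "a < n" "b < n" using F by auto
      then have "{a, b} \<in> edges (circulant n (set ss))" using edge_circulant ab(3) by simp
      with * have "\<not> {a, b} \<subseteq> F" by (rule bspec)
      then show False using ab by simp
    qed
  next
    assume *: "\<forall>a\<in>F. \<forall>b\<in>F. \<not> circulant_adj n ss a b"
    show "\<forall>e\<in>edges (circulant n (set ss)). \<not> e \<subseteq> F"
    proof (intro ballI notI)
      fix e assume e: "e \<in> edges (circulant n (set ss))" "e \<subseteq> F"
      then obtain a b where ab: "e = {a, b}" "a < n" "b < n"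
        unfolding circulant_def snd_conv by blast
      then have "circulant_adj n ss a b" using e(1) edge_circulant by simp
      then show False using * e(2) ab(1) by simp
    qed
  qed
  then show ?thesis
    by (auto simp: indep_complex_def independent_sets_def circulant_def)
qed

text \<open>A set meets all edges if and only if its complement is independent, and complementation reverses
  inclusions.\<close>

lemma minimal_vertex_cover_iff:
  assumes "simple_graph G" "C \<subseteq> vertices G"
  shows "minimal_vertex_cover G C \<longleftrightarrow> vertices G - C \<in> facets (indep_complex G)"
proof -
  let ?V = "vertices G" and ?I = "indep_complex G"
  have cover: "vertex_cover G D \<longleftrightarrow> ?V - D \<in> ?I" if "D \<subseteq> ?V" for D
  proof -
    have "e \<inter> D \<noteq> {} \<longleftrightarrow> \<not> e \<subseteq> ?V - D" if "e \<in> edges G" for e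
    proof -
      have "e \<subseteq> ?V" using that assms(1) unfolding simple_graph_def by blast
      then show ?thesis by blast
    qed
    then show ?thesis using that by (simp add: vertex_cover_def indep_complex_def)
  qed
  have sub: "F \<subseteq> ?V" if "F \<in> ?I" for F using that by (simp add: indep_complex_def)
  show ?thesis
  proof
    assume C: "minimal_vertex_cover G C"
    then have "?V - C \<in> ?I" using cover[OF assms(2)] by (simp add: minimal_vertex_cover_def)
    moreover have "H = ?V - C" if H: "H \<in> ?I" "?V - C \<subseteq> H" for H
    proof (rule ccontr)
      assume "H \<noteq> ?V - C"
      then have less: "?V - H \<subset> C" using H sub[OF H(1)] assms(2) by blast
      have "?V - (?V - H) = H" using sub[OF H(1)] by blast
      then have "vertex_cover G (?V - H)" using cover[of "?V - H"] H(1) by simp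
      then show False using C less unfolding minimal_vertex_cover_def by blast
    qed
    ultimately show "?V - C \<in> facets ?I" unfolding facets_def by blast
  next
    assume C: "?V - C \<in> facets ?I"
    then have "vertex_cover G C" using cover[OF assms(2)] facets_subset by blast
    moreover have "\<not> vertex_cover G D" if D: "D \<subset> C" for D
    proof
      assume "vertex_cover G D"
      then have "?V - D \<in> ?I" using cover[of D] D assms(2) by blast
      then have "?V - D = ?V - C" by (rule facets_maximal[OF C]) (use D in blast)
      then show False using D assms(2) by blast
    qed
    ultimately show "minimal_vertex_cover G C" unfolding minimal_vertex_cover_def by blast
  qed
qed

lemma well_covered_iff_pure:
  assumes G: "simple_graph G"
  shows "well_covered G \<longleftrightarrow> pure_complex (indep_complex G)"
proof -
  let ?V = "vertices G" and ?I = "indep_complex G"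
  have fin: "finite ?V" using G by (simp add: simple_graph_def)
  have sub: "F \<subseteq> ?V" if "F \<in> facets ?I" for F
    using that facets_subset[of ?I] by (auto simp: indep_complex_def)
  have card: "card (?V - F) = card (?V - H) \<longleftrightarrow> card F = card H" if "F \<subseteq> ?V" "H \<subseteq> ?V" for F H
    using that fin card_mono[OF fin that(1)] card_mono[OF fin that(2)]
    by (auto simp: card_Diff_subset finite_subset)
  have covers: "minimal_vertex_cover G C \<longleftrightarrow> C \<subseteq> ?V \<and> ?V - C \<in> facets ?I" for C
    using minimal_vertex_cover_iff[OF G]
    by (metis minimal_vertex_cover_def vertex_cover_def)
  have "well_covered G \<longleftrightarrow> (\<forall>F\<in>facets ?I. \<forall>H\<in>facets ?I. card F = card H)"
  proof
    assume wc: "well_covered G"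
    show "\<forall>F\<in>facets ?I. \<forall>H\<in>facets ?I. card F = card H"
    proof (intro ballI)
      fix F H assume FH: "F \<in> facets ?I" "H \<in> facets ?I"
      then have "?V - (?V - F) = F" "?V - (?V - H) = H" using sub by blast+
      then have "minimal_vertex_cover G (?V - F)" "minimal_vertex_cover G (?V - H)"
        using FH covers by auto
      then show "card F = card H" using wc card[OF sub sub] FH unfolding well_covered_def by blast
    qed
  next
    assume *: "\<forall>F\<in>facets ?I. \<forall>H\<in>facets ?I. card F = card H"
    show "well_covered G" unfolding well_covered_def
    proof (intro allI impI)
      fix C D assume "minimal_vertex_cover G C \<and> minimal_vertex_cover G D"
      then have CD: "C \<subseteq> ?V" "D \<subseteq> ?V" "?V - C \<in> facets ?I" "?V - D \<in> facets ?I"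
        using covers by auto
      then have "card (?V - C) = card (?V - D)" using * by blast
      then show "card C = card D" using card[OF CD(1,2)] by simp
    qed
  qed
  then show ?thesis
    using simplicial_complex_indep_complex[OF G] by (simp add: pure_complex_def face_dim_def)
qed

text \<open>Congruences, unlike distances between representatives, are preserved by multiplication with
  units.\<close>

lemma circulant_adj_iff_dvd:
  assumes ss: "set ss \<subseteq> {1..n div 2}" and ab: "a < n" "b < n"
  shows "circulant_adj n ss a b \<longleftrightarrow>
    (\<exists>s\<in>set ss. int n dvd (int a - int b - int s) \<or> int n dvd (int a - int b + int s))"
proof -
  have small: "int n dvd z \<longleftrightarrow> z = 0 \<or> z = int n \<or> z = - int n" if "\<bar>z\<bar> < 2 * int n" for z
  proof
    assume "int n dvd z"
    then obtain q where q: "z = int n * q" by (auto simp: dvd_def)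
    then have "int n * \<bar>q\<bar> < int n * 2" using that by (simp add: abs_mult)
    then have "\<bar>q\<bar> < 2" using ab(1) by simp
    then have "q = 0 \<or> q = 1 \<or> q = - 1" by auto
    then show "z = 0 \<or> z = int n \<or> z = - int n" using q by auto
  qed auto
  have key: "(a \<noteq> b \<and> (let d = (if a < b then b - a else a - b) in d = s \<or> n - d = s)) \<longleftrightarrow>
      int n dvd (int a - int b - int s) \<or> int n dvd (int a - int b + int s)"
    if s: "s \<in> set ss" for s
  proof -
    have "s \<in> {1..n div 2}" using ss s by blast
    then have s': "1 \<le> s" "2 * s \<le> n" by auto
    have "\<bar>int a - int b - int s\<bar> < 2 * int n" "\<bar>int a - int b + int s\<bar> < 2 * int n"
      using ab s' by auto
    note * = small[OF this(1)] small[OF this(2)]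
    show ?thesis unfolding * using ab s' by (auto simp: Let_def)
  qed
  have "circulant_adj n ss a b \<longleftrightarrow> (\<exists>s\<in>set ss.
      a \<noteq> b \<and> (let d = (if a < b then b - a else a - b) in d = s \<or> n - d = s))"
    by (auto simp: circulant_adj_def Let_def)
  then show ?thesis using key by simp
qed

text \<open>The representative of \<open>\<plusminus>x\<close> modulo \<open>n\<close> between \<open>0\<close> and \<open>n div 2\<close>.\<close>

definition folded_residue :: "nat \<Rightarrow> nat \<Rightarrow> nat" where
  "folded_residue n x = (let r = x mod n in if 2 * r \<le> n then r else n - r)"

lemma folded_residue_dvd:
  assumes "0 < n"
  shows "(int n dvd (z - int x) \<or> int n dvd (z + int x)) \<longleftrightarrow>
    (int n dvd (z - int (folded_residue n x)) \<or> int n dvd (z + int (folded_residue n x)))"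
proof -
  define r where "r = x mod n"
  have r: "r < n" using assms by (simp add: r_def)
  have x: "int x = int n * int (x div n) + int r"
    unfolding r_def by (metis mult_div_mod_eq of_nat_add of_nat_mult)
  have shift: "int n dvd y + int n * q \<longleftrightarrow> int n dvd y" "int n dvd y - int n * q \<longleftrightarrow> int n dvd y"
    for y q by (simp_all add: dvd_add_left_iff dvd_diff_left_iff)
  have "z - int x = (z - int r) - int n * int (x div n)" "z + int x = (z + int r) + int n * int (x div n)"
    by (simp_all add: x)
  then have 1: "int n dvd (z - int x) \<longleftrightarrow> int n dvd (z - int r)"
    "int n dvd (z + int x) \<longleftrightarrow> int n dvd (z + int r)"
    by (simp_all only: shift)
  have "z - int (n - r) = (z + int r) - int n * 1" "z + int (n - r) = (z - int r) + int n * 1"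
    using r by auto
  then have 2: "int n dvd (z - int (n - r)) \<longleftrightarrow> int n dvd (z + int r)"
    "int n dvd (z + int (n - r)) \<longleftrightarrow> int n dvd (z - int r)"
    by (simp_all only: shift)
  show ?thesis unfolding 1 by (auto simp: folded_residue_def Let_def 2 simp flip: r_def)
qed

text \<open>Continuation by the identity turns a bijection of the vertices into one of all natural numbers,
  which has an inverse to relabel with.\<close>

lemma relabel_circulant:
  assumes f: "inj_on f {0..<n}" "f ` {0..<n} \<subseteq> {0..<n}"
    and adj: "\<And>a b. a < n \<Longrightarrow> b < n \<Longrightarrow> circulant_adj n ts (f a) (f b) \<longleftrightarrow> circulant_adj n ss a b"
  obtains g where "bij g" "\<And>a. a < n \<Longrightarrow> g a = f a"
    "indep_complex (circulant n (set ts)) = relabel g (indep_complex (circulant n (set ss)))"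
proof
  let ?g = "\<lambda>a. if a < n then f a else a"
  have img: "f ` {0..<n} = {0..<n}" using endo_inj_surj[OF _ f(2,1)] by simp
  have "?g ` {0..<n} = f ` {0..<n}" by (intro image_cong) auto
  moreover have "?g ` {n..} = {n..}" by auto
  moreover have "{0..<n} \<union> {n..} = UNIV" by auto
  ultimately have "surj ?g" using img image_Un[of ?g "{0..<n}" "{n..}"] by simp
  moreover have "inj ?g"
  proof (rule injI)
    fix a b assume ab: "?g a = ?g b"
    have stays: "f c < n" if "c < n" for c
    proof -
      have "f c \<in> {0..<n}" by (rule subsetD[OF f(2)]) (use that in simp)
      then show ?thesis by simp
    qed
    show "a = b"
      using ab stays[of a] stays[of b] inj_onD[OF f(1), of a b]
      by (cases "a < n"; cases "b < n") auto
  qed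
  ultimately show bij: "bij ?g" by (simp add: bij_def)
  show "?g a = f a" if "a < n" for a using that by simp
  have gimg: "?g ` F = f ` F" if "F \<subseteq> {0..<n}" for F
    using that by (intro image_cong) auto
  have mem: "f ` F \<in> independent_sets (circulant_adj n ts) (set [0..<n]) \<longleftrightarrow>
      F \<in> independent_sets (circulant_adj n ss) (set [0..<n])" if F: "F \<subseteq> {0..<n}" for F
  proof -
    have "circulant_adj n ts (f a) (f b) \<longleftrightarrow> circulant_adj n ss a b" if "a \<in> F" "b \<in> F" for a b
    proof (rule adj)
      show "a < n" "b < n" using F that by auto
    qed
    moreover have "f ` F \<subseteq> {0..<n}" using F f(2) by blast
    ultimately show ?thesis using F by (simp add: independent_sets_def)
  qed
  show "indep_complex (circulant n (set ts)) = relabel ?g (indep_complex (circulant n (set ss)))"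
    unfolding indep_complex_circulant
  proof (intro equalityI subsetI)
    fix H assume H: "H \<in> independent_sets (circulant_adj n ts) (set [0..<n])"
    then have "H \<subseteq> f ` {0..<n}" using img by (simp add: independent_sets_def)
    then obtain F where F: "F \<subseteq> {0..<n}" "H = f ` F" by (rule subset_imageE)
    then show "H \<in> relabel ?g (independent_sets (circulant_adj n ss) (set [0..<n]))"
      using H mem[OF F(1)] gimg[OF F(1)] by blast
  next
    fix H assume "H \<in> relabel ?g (independent_sets (circulant_adj n ss) (set [0..<n]))"
    then obtain F where F: "F \<in> independent_sets (circulant_adj n ss) (set [0..<n])" "H = ?g ` F"
      by blast
    have sub: "F \<subseteq> {0..<n}" using F(1) by (simp add: independent_sets_def)
    then show "H \<in> independent_sets (circulant_adj n ts) (set [0..<n])"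
      unfolding F(2) gimg[OF sub] using F(1) mem[OF sub] by blast
  qed
qed

lemma inj_on_affine_mod:
  fixes n :: nat
  assumes "coprime u n"
  shows "inj_on (\<lambda>a. (u * a + c) mod n) {0..<n}"
proof (rule inj_onI)
  fix a b assume ab: "a \<in> {0..<n}" "b \<in> {0..<n}" "(u * a + c) mod n = (u * b + c) mod n"
  have "int n dvd int (u * a + c) - int (u * b + c)"
    using ab(3) by (metis mod_eq_dvd_iff of_nat_mod)
  then have "int n dvd int u * (int a - int b)" by (simp add: algebra_simps)
  moreover have "coprime (int n) (int u)" using assms by (simp add: coprime_commute)
  ultimately have "int n dvd int a - int b" by (simp add: coprime_dvd_mult_right_iff)
  then show "a = b" using ab(1,2) by (metis atLeastLessThan_iff mod_eq_dvd_iff mod_less nat_int of_nat_mod)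
qed

text \<open>The slope \<open>u\<close> accounts for the isomorphism with the graph of the unit multiple of \<open>S\<close>, and the constant
  term \<open>c\<close> for vertex transitivity.\<close>

lemma circulant_affine:
  assumes u: "coprime u n" and n: "0 < n" and ss: "set ss \<subseteq> {1..n div 2}" and ts: "set ts \<subseteq> {1..n div 2}"
    and eq: "set ts = (\<lambda>s. folded_residue n (u * s)) ` set ss"
  obtains g where "bij g" "\<forall>a<n. g a = (u * a + c) mod n"
    "indep_complex (circulant n (set ts)) = relabel g (indep_complex (circulant n (set ss)))"
proof (rule relabel_circulant[where f = "\<lambda>a. (u * a + c) mod n"])
  show "inj_on (\<lambda>a. (u * a + c) mod n) {0..<n}" by (rule inj_on_affine_mod[OF u])
  show "(\<lambda>a. (u * a + c) mod n) ` {0..<n} \<subseteq> {0..<n}" using n by auto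
  fix a b assume ab: "a < n" "b < n"
  define z where "z = int ((u * a + c) mod n) - int ((u * b + c) mod n)"
  have m: "int (x mod n) = int x - int n * int (x div n)" for x
    by (metis add_diff_cancel_left' mult_div_mod_eq of_nat_add of_nat_mult)
  have z: "z = int u * (int a - int b) +
      int n * (int ((u * b + c) div n) - int ((u * a + c) div n))"
    by (simp add: z_def m algebra_simps)
  have "z - int (u * s) = int u * (int a - int b - int s) +
        int n * (int ((u * b + c) div n) - int ((u * a + c) div n))"
      "z + int (u * s) = int u * (int a - int b + int s) +
        int n * (int ((u * b + c) div n) - int ((u * a + c) div n))" for s
    by (simp_all add: z algebra_simps)
  moreover have "coprime (int n) (int u)" using u by (simp add: coprime_commute)
  ultimately have dvd: "int n dvd (z - int (u * s)) \<longleftrightarrow> int n dvd (int a - int b - int s)"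
      "int n dvd (z + int (u * s)) \<longleftrightarrow> int n dvd (int a - int b + int s)" for s
    by (simp_all add: dvd_add_left_iff coprime_dvd_mult_right_iff)
  have "circulant_adj n ts ((u * a + c) mod n) ((u * b + c) mod n) \<longleftrightarrow>
      (\<exists>t\<in>set ts. int n dvd (z - int t) \<or> int n dvd (z + int t))"
    unfolding z_def by (rule circulant_adj_iff_dvd[OF ts]) (use n in simp_all)
  also have "\<dots> \<longleftrightarrow> (\<exists>s\<in>set ss. int n dvd (z - int (u * s)) \<or> int n dvd (z + int (u * s)))"
    unfolding eq by (simp only: bex_simps folded_residue_dvd[OF n, symmetric])
  also have "\<dots> \<longleftrightarrow> circulant_adj n ss a b"
    unfolding dvd circulant_adj_iff_dvd[OF ss ab] ..
  finally show "circulant_adj n ts ((u * a + c) mod n) ((u * b + c) mod n) \<longleftrightarrow> circulant_adj n ss a b" .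
qed (use that in blast)

section \<open>Winding numbers on circulant graphs\<close>

text \<open>A table \<open>\<phi>\<close> of integers, indexed by residues, assigns \<open>\<phi> (b - a)\<close> to the edge from \<open>a\<close> to
  \<open>b\<close>.  If this is additive on the triangles of the link of \<open>F\<close> and not zero on a step \<open>d\<close> that
  preserves the vertices of the link, then the closed walks with step \<open>d\<close> have a nonzero winding
  number, although the table would have to be a difference of vertex labels if the link were
  shellable.  The face \<open>T\<close> ensures that the link has dimension at least two.\<close>

definition winding ::
    "nat \<Rightarrow> nat list \<Rightarrow> nat list \<Rightarrow> nat list \<Rightarrow> int list \<Rightarrow> nat \<Rightarrow> bool" where
  "winding n ss F T \<phi> d \<longleftrightarrow>
     (let E = circulant_adj n ss; ys = link_list E [0..<n] F;
          \<psi> = (\<lambda>a b. \<phi> ! ((b + n - a) mod n))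
      in independent_list E [0..<n] F \<and> independent_list E ys T \<and> 3 \<le> length T \<and>
        d < n \<and> \<phi> ! d \<noteq> 0 \<and>
        list_all (\<lambda>a. (a + d) mod n \<in> set ys \<and> \<not> E a ((a + d) mod n)) ys \<and>
        list_all (\<lambda>a. let as = filter (\<lambda>b. \<not> E a b) ys in
          list_all (\<lambda>b. list_all (\<lambda>c. \<psi> a b + \<psi> b c = \<psi> a c) (filter (\<lambda>c. \<not> E b c) as)) as) ys)"

lemma winding_not_shellable:
  assumes w: "winding n ss F T \<phi> d"
  shows "\<not> shellable (indep_complex (circulant n (set ss)))"
  unfolding indep_complex_circulant
proof
  interpret adjacency "circulant_adj n ss" by (rule adjacency_circulant)
  let ?E = "circulant_adj n ss" and ?ys = "link_list (circulant_adj n ss) [0..<n] F"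
  let ?I = "independent_sets ?E (set [0..<n])" and ?\<psi> = "\<lambda>a b. \<phi> ! ((b + n - a) mod n)"
  have F: "independent_list ?E [0..<n] F" and T: "independent_list ?E ?ys T" "3 \<le> length T"
    and d: "d < n" "\<phi> ! d \<noteq> 0"
    and step: "\<And>a. a \<in> set ?ys \<Longrightarrow> (a + d) mod n \<in> set ?ys"
      "\<And>a. a \<in> set ?ys \<Longrightarrow> \<not> ?E a ((a + d) mod n)"
    and add: "\<And>a b c. a \<in> set ?ys \<Longrightarrow> b \<in> set ?ys \<Longrightarrow> c \<in> set ?ys \<Longrightarrow>
      \<not> ?E a b \<Longrightarrow> \<not> ?E a c \<Longrightarrow> \<not> ?E b c \<Longrightarrow> ?\<psi> a b + ?\<psi> b c = ?\<psi> a c"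
    using w by (auto simp: winding_def Let_def list_all_iff)
  have L: "link ?I (set F) = independent_sets ?E (set ?ys)" by (rule link_list_sound[OF F])
  have less: "a < n" if "a \<in> set ?ys" for a using that by (auto simp: link_list_def)
  assume sh: "shellable ?I"
  then have pure: "pure_complex ?I" by (simp add: shellable_def)
  have "shellable (link ?I (set F))"
    by (rule shellable_link[OF sh]) (use F in \<open>simp add: independent_list_sound\<close>)
  moreover have "?\<psi> a b + ?\<psi> b c = ?\<psi> a c" if "{a, b, c} \<in> link ?I (set F)" for a b c
    using that unfolding L by (intro add) (auto simp: independent_sets_def)
  ultimately obtain g where g: "\<And>a b. {a, b} \<in> link ?I (set F) \<Longrightarrow> ?\<psi> a b = g b - g a"
    using shellable_potential[OF _ link_facets_size[OF pure F T], of ?\<psi>] by blast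
  let ?s = "\<lambda>a. (a + d) mod n"
  have "\<phi> ! d = g (?s a) - g a" if a: "a \<in> set ?ys" for a
  proof -
    have "{a, ?s a} \<in> link ?I (set F)"
      unfolding L edge_independent[OF a step(1)[OF a]] by (rule step(2)[OF a])
    then have "?\<psi> a (?s a) = g (?s a) - g a" by (rule g)
    moreover have "(?s a + n - a) mod n = d"
    proof (cases "a + d < n")
      case False
      then have "?s a = a + d - n" using less[OF a] d(1) by (simp add: mod_if)
      then show ?thesis using False less[OF a] d(1) by simp
    qed (use less[OF a] d(1) in simp)
    ultimately show ?thesis by simp
  qed
  \<comment> \<open>the differences cancel over the orbits of the step, so that \<open>\<phi> ! d\<close> would vanish\<close>
  then have "(\<Sum>a\<in>set ?ys. \<phi> ! d) = (\<Sum>a\<in>set ?ys. g (?s a)) - (\<Sum>a\<in>set ?ys. g a)"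
    by (simp add: sum_subtractf)
  moreover have inj: "inj_on ?s (set ?ys)"
  proof (rule inj_on_subset)
    show "inj_on ?s {0..<n}" using inj_on_affine_mod[of 1 n d] by simp
  qed (use less in auto)
  then have "(\<Sum>a\<in>set ?ys. g (?s a)) = (\<Sum>a\<in>?s ` set ?ys. g a)"
    by (simp add: sum.reindex)
  moreover have "?s ` set ?ys = set ?ys"
    by (rule endo_inj_surj) (use inj step(1) in auto)
  ultimately have "int (card (set ?ys)) * \<phi> ! d = 0" by simp
  moreover have "set T \<subseteq> set ?ys" "T \<noteq> []"
    using T by (auto simp: independent_list_sound independent_sets_def)
  ultimately show False using d(2) by (auto simp: card_eq_0_iff)
qed

section \<open>The classification up to fifteen vertices\<close>

datatype obstruction = Split "nat list" | Winding "int list" nat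

primrec obstructs ::
    "nat \<Rightarrow> nat list \<Rightarrow> nat list \<Rightarrow> nat list \<Rightarrow> obstruction \<Rightarrow> bool" where
  "obstructs n ss F T (Split C) \<longleftrightarrow> split_link (circulant_adj n ss) [0..<n] F T C"
| "obstructs n ss F T (Winding \<phi> d) \<longleftrightarrow> winding n ss F T \<phi> d"

text \<open>Up to multiplication of \<open>S\<close> by units modulo \<open>n\<close>, these are the well-covered circulant graphs
  on at most fifteen vertices that are not vertex decomposable.  An entry consists of \<open>n\<close>, \<open>S\<close>, a
  face \<open>F\<close>, a face \<open>T\<close> of its link that witnesses the dimension, and the obstruction in that
  link.\<close>

definition obstructed_circulants ::
    "(nat \<times> nat list \<times> nat list \<times> nat list \<times> obstruction) list" where
  "obstructed_circulants =
  [(4, [1], [], [0,2], Split [0,2]),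
   (6, [1,2], [], [0,3], Split [0,3]),
   (6, [1,3], [], [0,2], Split [0,2,4]),
   (7, [1], [], [0,2,4], Winding [0,0,1,-2,2,-1,0] 2),
   (8, [2], [0,4], [1,5], Split [1,5]),
   (8, [1,3], [], [0,2], Split [0,2,4,6]),
   (8, [1,2,3], [], [0,4], Split [0,4]),
   (8, [1,4], [], [0,2,5], Winding [0,0,2,-1,0,1,-2,0] 2),
   (8, [1,3,4], [], [0,2], Split [0,2,4,6]),
   (9, [1,3], [], [0,2,4], Winding [0,0,1,0,2,-2,0,-1,0] 2),
   (9, [1,2,4], [], [0,3], Split [0,3,6]),
   (10, [2,3], [0,5], [1,6], Split [1,6]),
   (10, [1,2,3,4], [], [0,5], Split [0,5]),
   (10, [2,5], [], [0,1,4], Winding [0,3,0,-1,2,0,-2,1,0,-3] 1),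
   (10, [1,2,5], [], [0,3,6], Winding [0,0,0,1,-2,0,2,-1,0,0] 3),
   (10, [1,3,5], [], [0,2], Split [0,2,4,6,8]),
   (10, [1,2,3,5], [], [0,4], Split [0,2,4,6,8]),
   (11, [1,2], [], [0,3,6], Winding [0,0,0,2,-1,-4,4,1,-2,0,0] 3),
   (11, [1,3], [], [0,2,4], Winding [0,0,1,0,2,-3,3,-2,0,-1,0] 2),
   (11, [1,2,4], [], [0,3,6], Winding [0,0,0,1,0,-2,2,0,-1,0,0] 3),
   (12, [3], [0,1,6,7], [2,8], Split [2,8]),
   (12, [1,4], [0,3], [5,10], Split [5,10]),
   (12, [2,4], [0,6], [1,7], Split [1,7]),
   (12, [3,4], [], [0,1,2], Winding [0,1,2,0,0,-1,0,1,0,0,-2,-1] 1),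
   (12, [2,3,4], [0,6], [1,7], Split [1,7]),
   (12, [1,3,5], [], [0,2], Split [0,2,4,6,8,10]),
   (12, [1,2,4,5], [], [0,3], Split [0,3,6,9]),
   (12, [1,3,4,5], [], [0,2], Split [0,2,4,6,8,10]),
   (12, [1,2,3,4,5], [], [0,6], Split [0,6]),
   (12, [2,6], [0,4,8], [1,5], Split [1,5,9]),
   (12, [1,2,6], [], [0,3,7], Winding [0,0,0,1,0,-1,0,1,0,-1,0,0] 3),
   (12, [2,3,6], [], [0,1,5], Winding [0,1,0,0,0,1,0,-1,0,0,0,-1] 1),
   (12, [1,4,6], [], [0,2,5], Winding [0,0,2,-3,0,-1,0,1,0,3,-2,0] 2),
   (12, [3,4,6], [], [0,1,2], Winding [0,1,2,0,0,-1,0,1,0,0,-2,-1] 1),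
   (12, [1,3,4,6], [], [0,2,7], Winding [0,0,2,0,0,-1,0,1,0,0,-2,0] 2),
   (12, [1,3,5,6], [], [0,2], Split [0,2,4,6,8,10]),
   (12, [1,2,3,5,6], [], [0,4], Split [0,4,8]),
   (12, [1,2,4,5,6], [], [0,3], Split [0,3,6,9]),
   (12, [1,3,4,5,6], [], [0,2], Split [0,2,4,6,8,10]),
   (13, [1,3], [], [0,2,4], Winding [0,0,1,0,2,-4,3,-3,4,-2,0,-1,0] 2),
   (13, [1,2,4], [], [0,3,6], Winding [0,0,0,2,0,-1,4,-4,1,0,-2,0,0] 3),
   (13, [1,3,4], [], [0,2,7], Winding [0,0,0,0,0,1,-1,1,-1,0,0,0,0] 5),
   (13, [2,3,4], [], [0,1,6], Winding [0,2,0,0,0,-3,-1,1,3,0,0,0,-2] 1),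
   (13, [1,2,4,5], [], [0,3,6], Winding [0,0,0,1,0,0,2,-2,0,0,-1,0,0] 3),
   (14, [2], [0,4,8], [1,5,9], Winding [0,0,0,0,1,0,-2,0,2,0,-1,0,0,0] 4),
   (14, [3,4], [0,1,7,8], [2,9], Split [2,9]),
   (14, [2,3,4], [], [0,1,6], Winding [0,1,0,0,0,-2,-1,0,1,2,0,0,0,-1] 1),
   (14, [1,2,5], [], [0,3,6], Winding [0,0,0,1,-1,0,2,0,-2,0,1,-1,0,0] 3),
   (14, [2,3,4,5], [0,7], [1,8], Split [1,8]),
   (14, [1,2,3,4,5,6], [], [0,7], Split [0,7]),
   (14, [2,3,7], [], [0,1,5], Winding [0,3,0,0,-2,1,4,0,-4,-1,2,0,0,-3] 1),
   (14, [1,2,3,7], [], [0,4,8], Winding [0,0,0,0,2,-1,-4,0,4,1,-2,0,0,0] 4),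
   (14, [2,4,7], [], [0,1,6], Winding [0,5,0,1,0,-3,2,0,-2,3,0,-1,0,-5] 1),
   (14, [1,2,4,7], [], [0,3,6], Winding [0,0,0,1,0,-3,2,0,-2,3,0,-1,0,0] 3),
   (14, [3,4,7], [], [0,1,2], Winding [0,1,2,0,0,-2,-1,0,1,2,0,0,-2,-1] 1),
   (14, [2,3,4,7], [], [0,1,6], Winding [0,0,0,0,0,1,1,0,-1,-1,0,0,0,0] 5),
   (14, [1,2,5,7], [], [0,3,6], Winding [0,0,0,1,-1,0,2,0,-2,0,1,-1,0,0] 3),
   (14, [1,3,5,7], [], [0,2], Split [0,2,4,6,8,10,12]),
   (14, [1,2,3,5,7], [], [0,4], Split [0,2,4,6,8,10,12]),
   (14, [1,2,4,5,7], [], [0,3,6], Winding [0,0,0,1,0,0,2,0,-2,0,0,-1,0,0] 3),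
   (14, [1,2,3,4,5,7], [], [0,6], Split [0,2,4,6,8,10,12]),
   (15, [1,2,3], [], [0,4,8], Winding [0,0,0,0,1,0,-1,-2,2,1,0,-1,0,0,0] 4),
   (15, [1,5], [0,3,9], [6,12], Split [6,12]),
   (15, [3,5], [0,2,8], [1,9], Split [1,9]),
   (15, [1,3,5], [], [0,2,4], Winding [0,0,1,0,2,0,3,-4,4,-3,0,-2,0,-1,0] 2),
   (15, [1,3,4,5], [], [0,2,8], Winding [0,0,0,0,0,0,1,-1,1,-1,0,0,0,0,0] 6),
   (15, [2,3,4,5], [], [0,1,7], Winding [0,2,0,0,0,0,-3,-1,1,3,0,0,0,0,-2] 1),
   (15, [1,2,3,6], [0], [4,8], Split [4,7,8,11]),
   (15, [1,4,6], [0,5,10], [2,7], Split [2,7,12]),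
   (15, [1,2,4,6], [], [0,3,8], Winding [0,0,0,1,0,0,0,-1,1,0,0,0,-1,0,0] 3),
   (15, [1,3,4,6], [], [0,2,7], Winding [0,0,1,0,0,0,0,1,-1,0,0,0,0,-1,0] 2),
   (15, [1,3,5,6], [], [0,2,4], Winding [0,0,1,0,2,0,0,-4,4,0,0,-2,0,-1,0] 2),
   (15, [1,2,3,5,6], [], [0,4,8], Winding [0,0,0,0,1,0,0,-2,2,0,0,-1,0,0,0] 4),
   (15, [1,2,4,5,7], [], [0,3], Split [0,3,6,9,12]),
   (15, [1,2,3,4,5,7], [], [0,6], Split [0,3,6,9,12]),
   (15, [1,2,3,4,6,7], [], [0,5], Split [0,5,10])]"

text \<open>Unlike a disjunction, the conditional keeps a rewriting evaluation from going on after the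
  first hit.\<close>

primrec some_holds :: "('a \<Rightarrow> bool) \<Rightarrow> 'a list \<Rightarrow> bool" where
  "some_holds P [] \<longleftrightarrow> False"
| "some_holds P (x # xs) \<longleftrightarrow> (if P x then True else some_holds P xs)"

lemma some_holds_iff: "some_holds P xs \<longleftrightarrow> (\<exists>x\<in>set xs. P x)"
  by (induction xs) auto

definition unit_multiple :: "nat \<Rightarrow> nat \<Rightarrow> nat list \<Rightarrow> nat list" where
  "unit_multiple n u ss =
     (let ts = map (\<lambda>s. folded_residue n (u * s)) ss in filter (\<lambda>t. t \<in> set ts) [1..<Suc (n div 2)])"

definition weight :: "nat list \<Rightarrow> nat" where
  "weight ss = sum_list (map (\<lambda>s. 2 ^ s) ss)"

definition sheds :: "('a \<Rightarrow> 'a \<Rightarrow> bool) \<Rightarrow> 'a list \<Rightarrow> bool" where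
  "sheds E xs = (case greedy_shedding [0..<Suc (length xs)] E xs of None \<Rightarrow> False | Some d \<Rightarrow> True)"

text \<open>Only one representative of each class of unit multiples has to be examined.\<close>

definition settled :: "nat \<Rightarrow> nat list \<Rightarrow> bool" where
  "settled n ss \<longleftrightarrow>
     (if some_holds (\<lambda>u. weight (unit_multiple n u ss) < weight ss) (filter (\<lambda>u. coprime u n) [1..<n])
      then True
      else if some_holds (\<lambda>e. fst e = n \<and> fst (snd e) = ss) obstructed_circulants then True
      else if sheds (circulant_adj n ss) [0..<n] then True
      else visibly_mixed (circulant_adj n ss) [0..<n])"

definition all_settled :: "nat \<Rightarrow> bool" where
  "all_settled n \<longleftrightarrow> list_all (settled n) (subseqs [1..<Suc (n div 2)])"

lemma sheds_sound:
  assumes "adjacency E" "sheds E xs" "distinct xs"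
  shows "vertex_decomposable (independent_sets E (set xs))"
proof -
  obtain d where "greedy_shedding [0..<Suc (length xs)] E xs = Some d"
    using assms(2) unfolding sheds_def by (metis (no_types, lifting) option.exhaust option.simps(4))
  then show ?thesis using adjacency.greedy_shedding_sound[OF assms(1) _ assms(3)] by blast
qed

lemma subseqs_bound: "ss \<in> set (subseqs [1..<Suc m]) \<Longrightarrow> set ss \<subseteq> {1..m}"
proof -
  assume "ss \<in> set (subseqs [1..<Suc m])"
  then have "set ss \<in> Pow (set [1..<Suc m])" unfolding subseqs_powset[symmetric] by (rule imageI)
  moreover have "set [1..<Suc m] = {1..m}" by auto
  ultimately show ?thesis by simp
qed

lemma filter_in_subseqs: "filter P xs \<in> set (subseqs xs)"
  by (induction xs) (auto simp: Let_def)

lemma unit_multiple_sound: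
  assumes u: "coprime u n" and n: "0 < n" and ss: "set ss \<subseteq> {1..n div 2}"
  shows "set (unit_multiple n u ss) = (\<lambda>s. folded_residue n (u * s)) ` set ss"
    "unit_multiple n u ss \<in> set (subseqs [1..<Suc (n div 2)])"
proof -
  have "1 \<le> folded_residue n (u * s) \<and> folded_residue n (u * s) \<le> n div 2" if s: "s \<in> set ss" for s
  proof -
    have "s \<in> {1..n div 2}" using ss s by blast
    then have s': "0 < s" "s < n" by auto
    have "\<not> n dvd u * s"
      using u s' nat_dvd_not_less by (auto simp: coprime_commute coprime_dvd_mult_right_iff)
    then have "u * s mod n \<noteq> 0" "u * s mod n < n" using n by (auto simp: mod_eq_0_iff_dvd)
    then show ?thesis by (auto simp: folded_residue_def Let_def)
  qed
  then show "set (unit_multiple n u ss) = (\<lambda>s. folded_residue n (u * s)) ` set ss"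
    unfolding unit_multiple_def Let_def by (auto simp: less_Suc_eq_le simp del: upt_Suc)
  show "unit_multiple n u ss \<in> set (subseqs [1..<Suc (n div 2)])"
    unfolding unit_multiple_def Let_def by (rule filter_in_subseqs)
qed

text \<open>Multiplication by a unit makes the weight smaller until a representative is reached.\<close>

lemma settled_sound:
  assumes n: "0 < n" and all: "all_settled n" and ss: "ss \<in> set (subseqs [1..<Suc (n div 2)])"
    and table: "list_all (\<lambda>(n, ss, F, T, ob). obstructs n ss F T ob) obstructed_circulants"
    and sh: "shellable (indep_complex (circulant n (set ss)))"
  shows "vertex_decomposable (indep_complex (circulant n (set ss)))"
  using ss sh
proof (induction "weight ss" arbitrary: ss rule: less_induct)
  case less
  let ?I = "\<lambda>ss. indep_complex (circulant n (set ss))"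
  note adj = adjacency_circulant[of n ss]
  have bound: "set ss \<subseteq> {1..n div 2}" using less.prems(1) by (rule subseqs_bound)
  consider u where "coprime u n" "weight (unit_multiple n u ss) < weight ss"
    | e where "e \<in> set obstructed_circulants" "fst e = n" "fst (snd e) = ss"
    | "sheds (circulant_adj n ss) [0..<n]"
    | "visibly_mixed (circulant_adj n ss) [0..<n]"
    using all less.prems(1)
    by (auto simp: all_settled_def list_all_iff settled_def some_holds_iff split: if_splits)
  then show ?case
  proof cases
    case 1
    let ?ts = "unit_multiple n u ss"
    note ts = unit_multiple_sound[OF 1(1) n bound]
    obtain g where g: "bij g" "\<forall>a<n. g a = (u * a + 0) mod n" "?I ?ts = relabel g (?I ss)"
      by (rule circulant_affine[OF 1(1) n bound subseqs_bound[OF ts(2)] ts(1), where c = 0])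
    have "vertex_decomposable (?I ?ts)"
      by (rule less.hyps[OF 1(2) ts(2)]) (use less.prems(2) in \<open>simp add: g(3) shellable_relabel_iff[OF g(1)]\<close>)
    then have "vertex_decomposable (relabel (inv_into UNIV g) (?I ?ts))"
      by (rule vertex_decomposable_relabel[OF bij_is_inj[OF bij_imp_bij_inv[OF g(1)]]])
    then show ?thesis
      unfolding g(3) by (simp add: image_image inv_f_f[OF bij_is_inj[OF g(1)]])
  next
    case 2
    obtain F T ob where "e = (n, ss, F, T, ob)" using 2 by (metis prod.collapse)
    then have ob: "obstructs n ss F T ob" using 2(1) table by (auto simp: list_all_iff)
    have "\<not> shellable (?I ss)"
    proof (cases ob)
      case (Split C)
      then have "split_link (circulant_adj n ss) [0..<n] F T C" using ob by simp
      then show ?thesis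
        unfolding indep_complex_circulant by (rule adjacency.split_link_not_shellable[OF adj])
    next
      case (Winding \<phi> d)
      then show ?thesis using ob winding_not_shellable by simp
    qed
    then show ?thesis using less.prems(2) by blast
  next
    case 3
    then show ?thesis
      unfolding indep_complex_circulant by (rule sheds_sound[OF adj]) simp
  next
    case 4
    have "\<not> pure_complex (?I ss)"
      unfolding indep_complex_circulant by (rule adjacency.visibly_mixed_sound[OF adj 4])
    then show ?thesis using less.prems(2) by (simp add: shellable_def)
  qed
qed

lemma obstructed_circulants_check:
  "list_all (\<lambda>(n, ss, F, T, ob). obstructs n ss F T ob) obstructed_circulants"
  by code_simp

lemma all_settled_below_13: "list_all all_settled [1..<13]"
  by code_simp

lemma all_settled_13: "all_settled 13"
  by code_simp

lemma all_settled_14: "all_settled 14"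
  by code_simp

lemma all_settled_15: "all_settled 15"
  by code_simp

lemma all_settled_below_16: "list_all all_settled [1..<16]"
proof -
  have "[1..<16 :: nat] = [1..<13] @ [13, 14, 15]" by code_simp
  then show ?thesis
    using all_settled_below_13 all_settled_13 all_settled_14 all_settled_15
    by (simp only: list_all_append list.pred_inject simp_thms)
qed

section \<open>Lists of sets that form a shelling\<close>

primrec shelling_list :: "'a list list \<Rightarrow> bool" where
  "shelling_list [] \<longleftrightarrow> True"
| "shelling_list (F # Gs) \<longleftrightarrow>
     (let ridges = filter (\<lambda>D. length D = 1) (map (\<lambda>L. filter (\<lambda>x. x \<notin> set L) F) Gs);
          xs = remdups (map hd ridges)
      in list_all (\<lambda>H. list_ex (\<lambda>x. x \<notin> set H) xs) Gs \<and> shelling_list Gs)"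

lemma shelling_list_sound: "shelling_list Fs \<Longrightarrow> shelling (map set Fs)"
proof (induction Fs)
  case (Cons F Gs)
  have "\<exists>x\<in>set F - set H. \<exists>L\<in>set Gs. set F - set L = {x}" if H: "H \<in> set Gs" for H
  proof -
    obtain L where L: "L \<in> set Gs" "length (filter (\<lambda>x. x \<notin> set L) F) = 1"
        "hd (filter (\<lambda>x. x \<notin> set L) F) \<notin> set H"
      using Cons.prems H by (auto simp: Let_def list_all_iff list_ex_iff)
    then obtain x where x: "filter (\<lambda>x. x \<notin> set L) F = [x]" by (auto simp: length_Suc_conv)
    then have "set F - set L = {x}" using set_filter[of "\<lambda>x. x \<notin> set L" F] by auto
    moreover have "x \<notin> set H" using L(3) x by simp
    ultimately show ?thesis using L(1) by blast
  qed
  then show ?case using Cons by (simp add: Let_def)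
qed simp

section \<open>Small circulant graphs\<close>

lemma circulant_graphE:
  assumes "circulant_graph G"
  obtains n ss where "0 < n" "ss \<in> set (subseqs [1..<Suc (n div 2)])" "G = circulant n (set ss)"
    "card (vertices G) = n"
proof -
  obtain n S where G: "n \<ge> 1" "S \<subseteq> {1..n div 2}" "G = circulant n S"
    using assms by (auto simp: circulant_graph_def)
  moreover have "{1..n div 2} = set [1..<Suc (n div 2)]" by auto
  ultimately have "S \<in> set ` set (subseqs [1..<Suc (n div 2)])"
    using subset_subseqs[of S "[1..<Suc (n div 2)]"] by simp
  then obtain ss where ss: "ss \<in> set (subseqs [1..<Suc (n div 2)])" "S = set ss" by blast
  show thesis
  proof (rule that)
    show "0 < n" "card (vertices G) = n" using G by (simp_all add: circulant_def)
  qed (use G ss in simp_all)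
qed

lemma circulant_graphI: "0 < n \<Longrightarrow> set ss \<subseteq> {1..n div 2} \<Longrightarrow> circulant_graph (circulant n (set ss))"
  unfolding circulant_graph_def by (intro exI[of _ n] exI[of _ "set ss"]) simp

lemma card_vertices_circulant [simp]: "card (vertices (circulant n S)) = n"
  by (simp add: circulant_def)

lemma well_covered_circulant_iff:
  "well_covered (circulant n S) \<longleftrightarrow> pure_complex (indep_complex (circulant n S))"
  by (rule well_covered_iff_pure[OF simple_graph_circulant])

lemma well_covered_circulant:
  assumes "list_all (\<lambda>F. length F = d) (facet_lists (circulant_adj n ss) [0..<n])"
  shows "well_covered (circulant n (set ss))"
    "\<forall>F\<in>facets (indep_complex (circulant n (set ss))). card F = d"
proof -
  interpret adjacency "circulant_adj n ss" by (rule adjacency_circulant)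
  show *: "\<forall>F\<in>facets (indep_complex (circulant n (set ss))). card F = d"
    unfolding indep_complex_circulant by (rule facet_lists_size[OF assms]) simp
  then show "well_covered (circulant n (set ss))"
    unfolding well_covered_circulant_iff indep_complex_circulant by (intro pure_size) auto
qed

text \<open>Circulant graphs are vertex transitive, so one vertex link decides the Buchsbaum property.\<close>

definition locally_settled :: "nat \<Rightarrow> nat list \<Rightarrow> bool" where
  "locally_settled n ss \<longleftrightarrow>
     (if sheds (circulant_adj n ss) (link_list (circulant_adj n ss) [0..<n] [0]) then True
      else visibly_mixed (circulant_adj n ss) [0..<n])"

lemma locally_settled_sound:
  fixes k :: "'k::field itself"
  assumes n: "0 < n" and ss: "set ss \<subseteq> {1..n div 2}" and loc: "locally_settled n ss"
    and wc: "well_covered (circulant n (set ss))"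
  shows "buchsbaum k (indep_complex (circulant n (set ss)))"
  unfolding buchsbaum_def
proof (intro conjI ballI)
  interpret adjacency "circulant_adj n ss" by (rule adjacency_circulant)
  let ?E = "circulant_adj n ss" and ?I = "indep_complex (circulant n (set ss))"
  show pure: "pure_complex ?I" using wc by (simp only: well_covered_circulant_iff)
  have "\<not> visibly_mixed ?E [0..<n]"
    using visibly_mixed_sound pure unfolding indep_complex_circulant by blast
  then have "sheds ?E (link_list ?E [0..<n] [0])"
    using loc by (simp add: locally_settled_def split: if_splits)
  then have "vertex_decomposable (independent_sets ?E (set (link_list ?E [0..<n] [0])))"
    by (rule sheds_sound[OF adjacency_circulant]) (simp add: link_list_def)
  moreover have "link ?I (set [0]) = independent_sets ?E (set (link_list ?E [0..<n] [0]))"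
    unfolding indep_complex_circulant
    by (rule link_list_sound) (use n in \<open>simp add: independent_list_sound singleton_independent\<close>)
  ultimately have vd0: "vertex_decomposable (link ?I {0})" by simp
  fix x assume "x \<in> \<Union>?I"
  then have x: "x < n" unfolding indep_complex_circulant Union_independent_sets by simp
  have "folded_residue n (1 * s) = s" if "s \<in> set ss" for s
  proof -
    have "s \<in> {1..n div 2}" using ss that by blast
    then show ?thesis by (auto simp: folded_residue_def Let_def)
  qed
  then have "set ss = (\<lambda>s. folded_residue n (1 * s)) ` set ss" by (simp cong: image_cong)
  then obtain g where g: "bij g" "\<forall>a<n. g a = (1 * a + x) mod n" "?I = relabel g ?I"
    by (rule circulant_affine[OF coprime_1_left n ss ss, where c = x])
  have "link ?I {x} = link (relabel g ?I) (g ` {0})"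
    using g(2)[rule_format, of 0] g(3) n x by simp
  also have "\<dots> = relabel g (link ?I {0})" by (rule link_relabel[OF bij_is_inj[OF g(1)]])
  finally have "vertex_decomposable (link ?I {x})"
    using vertex_decomposable_relabel[OF bij_is_inj[OF g(1)] vd0] by simp
  then show "cohen_macaulay k (link ?I {x})" by (rule vertex_decomposable_imp_cohen_macaulay)
qed

lemma locally_settled_below_ten:
  "list_all (\<lambda>n. list_all (\<lambda>ss. (n = 8 \<and> ss = [2]) \<or> locally_settled n ss)
     (subseqs [1..<Suc (n div 2)])) [1..<10]"
  by code_simp

lemma settled_below_four:
  "list_all (\<lambda>n. list_all (\<lambda>ss. sheds (circulant_adj n ss) [0..<n])
     (subseqs [1..<Suc (n div 2)])) [1..<4]"
  by code_simp

text \<open>The exception is the disjoint union of two 4-cycles.\<close>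

lemma buchsbaum_below_ten:
  fixes k :: "'k::field itself"
  assumes "circulant_graph G" "well_covered G" "card (vertices G) < 10" "G \<noteq> circulant 8 {2}"
  shows "buchsbaum k (indep_complex G)"
proof -
  obtain n ss where G: "0 < n" "ss \<in> set (subseqs [1..<Suc (n div 2)])" "G = circulant n (set ss)"
    "card (vertices G) = n"
    by (rule circulant_graphE[OF assms(1)])
  have "n \<in> set [1..<10]" using G(1,4) assms(3) by simp
  then have "(n = 8 \<and> ss = [2]) \<or> locally_settled n ss"
    using locally_settled_below_ten G(2) unfolding list_all_iff by blast
  moreover have "\<not> (n = 8 \<and> ss = [2])" using assms(4) G(3) by auto
  ultimately have "locally_settled n ss" by blast
  then show ?thesis
    using locally_settled_sound[OF G(1) subseqs_bound[OF G(2)]] assms(2) unfolding G(3) by blast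
qed

lemma cohen_macaulay_below_four:
  assumes "circulant_graph G" "card (vertices G) < 4"
  shows "cohen_macaulay k (indep_complex G)"
proof -
  obtain n ss where G: "0 < n" "ss \<in> set (subseqs [1..<Suc (n div 2)])" "G = circulant n (set ss)"
    "card (vertices G) = n"
    by (rule circulant_graphE[OF assms(1)])
  have "n \<in> set [1..<4]" using G(1,4) assms(2) by simp
  then have "sheds (circulant_adj n ss) [0..<n]"
    using settled_below_four G(2) unfolding list_all_iff by blast
  then have "vertex_decomposable (independent_sets (circulant_adj n ss) (set [0..<n]))"
    by (rule sheds_sound[OF adjacency_circulant]) simp
  then show ?thesis
    unfolding G(3) indep_complex_circulant by (rule vertex_decomposable_imp_cohen_macaulay)
qed

section \<open>The extremal graphs\<close>

lemma not_connected_circulant_8_2: "\<not> connected_graph (circulant 8 {2})"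
proof
  let ?R = "{(a, b). {a, b} \<in> edges (circulant 8 {2})}"
  have parity: "even u \<longleftrightarrow> even v" if "(u, v) \<in> ?R\<^sup>*" for u v
    using that
  proof (induction rule: rtrancl_induct)
    case (step v w)
    then have vw: "{v, w} \<in> edges (circulant 8 {2})" by simp
    then have less: "v < 8" "w < 8" by (auto simp: circulant_def doubleton_eq_iff)
    have "circulant_adj 8 [2] v w" using edge_circulant[OF less, of "[2]"] vw by simp
    then have "even v \<longleftrightarrow> even w"
      using less by (auto simp: circulant_adj_def Let_def split: if_splits; presburger)
    with step show ?case by simp
  qed simp
  assume "connected_graph (circulant 8 {2})"
  then have "(0, 1) \<in> ?R\<^sup>*" by (simp add: connected_graph_def circulant_def)
  then show False using parity by fastforce
qed

lemma connected_circulant_10_1_4: "connected_graph (circulant 10 {1, 4})"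
proof -
  let ?R = "{(a, b). {a, b} \<in> edges (circulant 10 {1, 4})}"
  have step: "(a, Suc a) \<in> ?R" "(Suc a, a) \<in> ?R" if "Suc a < 10" for a
    using that edge_circulant[of a 10 "Suc a" "[1, 4]"]
    by (simp_all add: circulant_adj_def Let_def insert_commute)
  have reach: "(0, a) \<in> ?R\<^sup>* \<and> (a, 0) \<in> ?R\<^sup>*" if "a < 10" for a
    using that
  proof (induction a)
    case (Suc a)
    then show ?case using step[of a]
      by (meson Suc_lessD converse_rtrancl_into_rtrancl rtrancl.rtrancl_into_rtrancl)
  qed simp
  have vert: "vertices (circulant 10 {1, 4}) = {0..<10}" by (simp add: circulant_def)
  show ?thesis
    unfolding connected_graph_def vert
  proof (intro ballI)
    fix u v :: nat assume "u \<in> {0..<10}" "v \<in> {0..<10}"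
    then have "(u, 0) \<in> ?R\<^sup>*" "(0, v) \<in> ?R\<^sup>*" using reach by simp_all
    then show "(u, v) \<in> ?R\<^sup>*" by (rule rtrancl_trans)
  qed
qed

text \<open>The facets of the independence complex in a shelling order, last facet first.\<close>

definition shelling_16_1_4_8 :: "nat list list" where
  "shelling_16_1_4_8 =
  [[5,8,11,14], [1,8,11,14], [2,5,8,11], [1,6,8,11], [2,8,11,13], [6,8,11,13],
   [1,4,6,11], [1,4,11,14], [2,8,13,15], [2,4,13,15], [2,4,9,15], [4,6,9,15],
   [4,6,9,11], [4,6,11,13], [2,4,11,13], [0,2,11,13], [0,6,11,13], [0,5,11,14],
   [4,9,11,14], [0,9,11,14], [2,4,9,11], [0,2,5,11], [0,6,9,11], [0,2,9,11],
   [4,6,13,15], [6,8,13,15], [0,3,6,13], [3,6,8,13], [0,3,10,13], [3,8,10,13],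
   [8,10,13,15], [4,10,13,15], [4,7,10,13], [2,4,7,13], [0,7,10,13], [0,2,7,13],
   [2,4,7,9], [0,2,5,7], [0,2,7,9], [2,7,9,12], [2,9,12,15], [2,5,8,15],
   [2,5,7,12], [2,5,12,15], [6,9,12,15], [0,3,6,9], [3,6,9,12], [4,7,9,14],
   [0,3,9,14], [3,9,12,14], [7,9,12,14], [0,7,9,14], [1,4,7,14], [1,4,7,10],
   [1,4,6,15], [1,4,10,15], [1,6,12,15], [1,6,8,15], [1,3,6,12], [1,3,6,8],
   [1,8,10,15], [5,8,10,15], [1,3,8,10], [3,5,8,10], [1,3,8,14], [3,5,8,14],
   [1,10,12,15], [1,3,12,14], [1,7,12,14], [1,7,10,12], [1,3,10,12], [3,5,10,12],
   [0,3,5,10], [0,3,5,14], [3,5,12,14], [5,10,12,15], [5,7,12,14], [5,7,10,12],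
   [0,5,7,10], [0,5,7,14]]"

lemma circulant_16_1_4_8_facets:
  "set (facet_lists (circulant_adj 16 [1, 4, 8]) [0..<16]) = set shelling_16_1_4_8"
  by code_simp

lemma circulant_16_1_4_8_shelling: "shelling_list shelling_16_1_4_8"
  by code_simp

lemma circulant_16_1_4_8_lists:
  "distinct shelling_16_1_4_8" "list_all sorted shelling_16_1_4_8"
  "list_all distinct shelling_16_1_4_8" "list_all (\<lambda>F. length F = Suc 3) shelling_16_1_4_8"
  by code_simp+

lemma circulant_16_1_4_8_euler:
  "euler_list (circulant_adj 16 [1, 4, 8]) [0..<16] = 1"
  "list_all (\<lambda>x. euler_list (circulant_adj 16 [1, 4, 8])
     (link_list (circulant_adj 16 [1, 4, 8]) [0..<16] [x]) = - 2) [0..<16]"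
  by code_simp+

lemma well_covered_16_1_4_8:
  "list_all (\<lambda>F. length F = Suc 3) (facet_lists (circulant_adj 16 [1, 4, 8]) [0..<16])"
  using circulant_16_1_4_8_lists(4)
  unfolding list_all_iff circulant_16_1_4_8_facets .

lemma shellable_16_1_4_8: "shellable (indep_complex (circulant 16 (set [1, 4, 8])))"
  unfolding shellable_iff_shelling
proof (intro conjI exI)
  show "pure_complex (indep_complex (circulant 16 (set [1, 4, 8])))"
    using well_covered_circulant(1)[OF well_covered_16_1_4_8]
    by (simp only: well_covered_circulant_iff)
  show "shelling (map set shelling_16_1_4_8)"
    by (rule shelling_list_sound[OF circulant_16_1_4_8_shelling])
  have "inj_on set (set shelling_16_1_4_8)"
  proof (rule inj_onI)
    fix F H assume "F \<in> set shelling_16_1_4_8" "H \<in> set shelling_16_1_4_8" "set F = set H"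
    then show "F = H"
      using circulant_16_1_4_8_lists(2,3) sorted_distinct_set_unique unfolding list_all_iff by blast
  qed
  then show "distinct (map set shelling_16_1_4_8)"
    using circulant_16_1_4_8_lists(1) by (simp only: distinct_map)
  show "set (map set shelling_16_1_4_8) = facets (indep_complex (circulant 16 (set [1, 4, 8])))"
    unfolding indep_complex_circulant adjacency.facet_lists_sound[OF adjacency_circulant, symmetric]
      set_map circulant_16_1_4_8_facets ..
qed

text \<open>The signed Euler characteristic is 1, and that of each vertex link, one dimension lower and so
  with the opposite sign, is 2.\<close>

lemma not_vertex_decomposable_16_1_4_8:
  "\<not> vertex_decomposable (indep_complex (circulant 16 (set [1, 4, 8])))"
proof -
  let ?E = "circulant_adj 16 [1, 4, 8]" and ?I = "indep_complex (circulant 16 (set [1, 4, 8]))"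
  interpret adjacency ?E by (rule adjacency_circulant)
  have euler: "euler ?I = 1"
    unfolding indep_complex_circulant using euler_list_sound circulant_16_1_4_8_euler(1)
    by (metis distinct_upt)
  show ?thesis
  proof (rule not_vertex_decomposable_if_euler)
    show "pure_complex ?I" using shellable_16_1_4_8 unfolding shellable_def by (rule conjunct1)
    show "\<forall>F\<in>facets ?I. card F = Suc 3"
      by (rule well_covered_circulant(2)[OF well_covered_16_1_4_8])
    show "euler ?I \<noteq> 0" using euler by simp
    fix x assume "x \<in> \<Union>?I"
    then have x: "x \<in> set [0..<16]"
      unfolding indep_complex_circulant Union_independent_sets .
    have "link ?I (set [x]) = independent_sets ?E (set (link_list ?E [0..<16] [x]))"
      unfolding indep_complex_circulant
      by (rule link_list_sound) (use x in \<open>simp only: independent_list_sound singleton_independent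
          distinct_singleton list.set simp_thms\<close>)
    moreover have "distinct (link_list ?E [0..<16] [x])"
      by (simp only: link_list_def distinct_filter distinct_upt simp_thms)
    moreover have "set [x] = {x}" by simp
    ultimately have "euler (link ?I {x}) = euler_list ?E (link_list ?E [0..<16] [x])"
      using euler_list_sound by metis
    also have "\<dots> = - 2" using circulant_16_1_4_8_euler(2) x unfolding list_all_iff by blast
    finally show "(- 1) ^ Suc 3 * euler ?I < (- 1) ^ 3 * euler (link ?I {x})"
      unfolding euler by simp
  qed
qed

lemma small_circulants_well_covered:
  "list_all (\<lambda>F. length F = 2) (facet_lists (circulant_adj 4 [1]) [0..<4])"
  "list_all (\<lambda>F. length F = 4) (facet_lists (circulant_adj 8 [2]) [0..<8])"
  "list_all (\<lambda>F. length F = 4) (facet_lists (circulant_adj 10 [1, 4]) [0..<10])"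
  by code_simp+

lemma small_circulants_split:
  "split_link (circulant_adj 4 [1]) [0..<4] [] [0, 2] [0, 2]"
  "split_link (circulant_adj 8 [2]) (link_list (circulant_adj 8 [2]) [0..<8] [0]) [4] [1, 5] [1, 5]"
  "split_link (circulant_adj 10 [1, 4]) (link_list (circulant_adj 10 [1, 4]) [0..<10] [0])
     [5] [2, 7] [2, 7]"
  by code_simp+

lemma not_buchsbaum_circulant:
  assumes "0 < n" "split_link (circulant_adj n ss) (link_list (circulant_adj n ss) [0..<n] [0]) F T C"
  shows "\<not> buchsbaum k (indep_complex (circulant n (set ss)))"
  unfolding indep_complex_circulant
  by (rule split_link_not_buchsbaum[OF adjacency_circulant _ assms(2)]) (use assms(1) in simp)

lemma not_cohen_macaulay_circulant:
  assumes "split_link (circulant_adj n ss) [0..<n] F T C"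
  shows "\<not> cohen_macaulay k (indep_complex (circulant n (set ss)))"
  unfolding indep_complex_circulant by (rule split_link_not_cohen_macaulay[OF adjacency_circulant assms])

lemma smallest_circulantI:
  assumes "0 < n" "set ss \<subseteq> {1..n div 2}" "P (circulant n (set ss))"
    "\<And>H. circulant_graph H \<Longrightarrow> P H \<Longrightarrow> card (vertices H) < n \<Longrightarrow> False"
  shows "smallest_circulant P (circulant n (set ss))"
  unfolding smallest_circulant_def card_vertices_circulant
  using circulant_graphI[OF assms(1,2)] assms(3,4) not_less by blast

lemma vertex_decomposable_below_16:
  assumes "circulant_graph G" "shellable (indep_complex G)" "card (vertices G) < 16"
  shows "vertex_decomposable (indep_complex G)"
proof -
  obtain n ss where G: "0 < n" "ss \<in> set (subseqs [1..<Suc (n div 2)])" "G = circulant n (set ss)"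
    "card (vertices G) = n"
    by (rule circulant_graphE[OF assms(1)])
  have "n \<in> set [1..<16]" using G(1,4) assms(3) by simp
  then have "all_settled n" using all_settled_below_16 unfolding list_all_iff by blast
  then show ?thesis
    using settled_sound[OF G(1) _ G(2) obstructed_circulants_check] assms(2) unfolding G(3) by blast
qed

theorem theorem6p1:
  fixes k :: "'k::field itself"
  shows
    "(\<not> connected_graph (circulant 8 {2}) \<and>
      smallest_circulant
        (\<lambda>G. well_covered G \<and> \<not> buchsbaum k (indep_complex G))
        (circulant 8 {2}) \<and>
      smallest_circulant
        (\<lambda>G. connected_graph G \<and> well_covered G \<and> \<not> buchsbaum k (indep_complex G))
        (circulant 10 {1, 4})) \<and>
     smallest_circulant
        (\<lambda>G. well_covered G \<and> buchsbaum k (indep_complex G) \<and>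
             \<not> cohen_macaulay k (indep_complex G))
        (circulant 4 {1}) \<and>
     smallest_circulant
        (\<lambda>G. well_covered G \<and> shellable (indep_complex G) \<and>
             \<not> vertex_decomposable (indep_complex G))
        (circulant 16 {1, 4, 8})"
proof (intro conjI)
  have sets: "{2} = set [2::nat]" "{1, 4} = set [1, 4::nat]" "{1} = set [1::nat]"
    "{1, 4, 8} = set [1, 4, 8::nat]" by simp_all
  show "\<not> connected_graph (circulant 8 {2})" by (rule not_connected_circulant_8_2)
  have nb8: "\<not> buchsbaum k (indep_complex (circulant 8 {2}))"
    unfolding sets by (rule not_buchsbaum_circulant[OF _ small_circulants_split(2)]) simp
  have wc8: "well_covered (circulant 8 {2})"
    unfolding sets by (rule well_covered_circulant(1)[OF small_circulants_well_covered(2)])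
  show "smallest_circulant
      (\<lambda>G. well_covered G \<and> \<not> buchsbaum k (indep_complex G)) (circulant 8 {2})"
    unfolding sets
  proof (rule smallest_circulantI, unfold sets[symmetric])
    fix H assume H: "circulant_graph H" "well_covered H \<and> \<not> buchsbaum k (indep_complex H)"
      "card (vertices H) < 8"
    then have "H \<noteq> circulant 8 {2}" by auto
    then show False using buchsbaum_below_ten[OF H(1)] H(2,3) by force
  qed (use nb8 wc8 in simp_all)
  have nb10: "\<not> buchsbaum k (indep_complex (circulant 10 {1, 4}))"
    unfolding sets by (rule not_buchsbaum_circulant[OF _ small_circulants_split(3)]) simp
  have wc10: "well_covered (circulant 10 {1, 4})"
    unfolding sets by (rule well_covered_circulant(1)[OF small_circulants_well_covered(3)])
  show "smallest_circulant
      (\<lambda>G. connected_graph G \<and> well_covered G \<and> \<not> buchsbaum k (indep_complex G))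
      (circulant 10 {1, 4})"
    unfolding sets
  proof (rule smallest_circulantI, unfold sets[symmetric])
    fix H assume H: "circulant_graph H"
      "connected_graph H \<and> well_covered H \<and> \<not> buchsbaum k (indep_complex H)"
      "card (vertices H) < 10"
    then have "H \<noteq> circulant 8 {2}" using not_connected_circulant_8_2 by blast
    then show False using buchsbaum_below_ten[OF H(1) _ H(3)] H(2) by blast
  qed (use nb10 wc10 connected_circulant_10_1_4 in simp_all)
  have nc4: "\<not> cohen_macaulay k (indep_complex (circulant 4 {1}))"
    unfolding sets by (rule not_cohen_macaulay_circulant[OF small_circulants_split(1)])
  have wc4: "well_covered (circulant 4 {1})"
    unfolding sets by (rule well_covered_circulant(1)[OF small_circulants_well_covered(1)])
  have "circulant_graph (circulant 4 {1})"
    unfolding sets by (rule circulant_graphI) simp_all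
  then have b4: "buchsbaum k (indep_complex (circulant 4 {1}))"
  proof (rule buchsbaum_below_ten[OF _ wc4])
    show "circulant 4 {1} \<noteq> circulant 8 {2}"
    proof
      assume eq: "circulant 4 {1} = circulant 8 {2}"
      have "card (vertices (circulant 4 {1})) = card (vertices (circulant 8 {2}))"
        unfolding eq ..
      then show False unfolding card_vertices_circulant by simp
    qed
  qed simp
  show "smallest_circulant
      (\<lambda>G. well_covered G \<and> buchsbaum k (indep_complex G) \<and>
           \<not> cohen_macaulay k (indep_complex G)) (circulant 4 {1})"
    unfolding sets
  proof (rule smallest_circulantI, unfold sets[symmetric])
    fix H assume "circulant_graph H" "card (vertices H) < 4"
      "well_covered H \<and> buchsbaum k (indep_complex H) \<and> \<not> cohen_macaulay k (indep_complex H)"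
    then show False using cohen_macaulay_below_four by blast
  qed (use nc4 wc4 b4 in simp_all)
  show "smallest_circulant
      (\<lambda>G. well_covered G \<and> shellable (indep_complex G) \<and>
           \<not> vertex_decomposable (indep_complex G)) (circulant 16 {1, 4, 8})"
    unfolding sets
  proof (rule smallest_circulantI)
    show "well_covered (circulant 16 (set [1, 4, 8])) \<and>
        shellable (indep_complex (circulant 16 (set [1, 4, 8]))) \<and>
        \<not> vertex_decomposable (indep_complex (circulant 16 (set [1, 4, 8])))"
      using well_covered_circulant(1)[OF well_covered_16_1_4_8] shellable_16_1_4_8
        not_vertex_decomposable_16_1_4_8 by blast
    fix H assume "circulant_graph H" "card (vertices H) < 16"
      "well_covered H \<and> shellable (indep_complex H) \<and> \<not> vertex_decomposable (indep_complex H)"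
    then show False using vertex_decomposable_below_16 by blast
  qed simp_all
qed

end
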